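(* Let $n\ge 1$ and let $\Gamma_{n+1}$ be a graph on the node set $[n+1]$. For all $i=0,\ldots,\lfloor n/2\rfloor$ the following hold: 1) if $\Gamma_{n+1}$ is connected, then $\gamma_i(As^n)\le \gamma_i(P_{\Gamma_{n+1}})\le \gamma_i(Pe^n)$; 2) if $\Gamma_{n+1}$ is Hamiltonian, then $\gamma_i(Cy^n)\le \gamma_i(P_{\Gamma_{n+1}})\le \gamma_i(Pe^n)$; 3) if $\Gamma_{n+1}$ is a tree, then $\gamma_i(As^n)\le \gamma_i(P_{\Gamma_{n+1}})\le \gamma_i(St^n)$. Moreover, these bounds are unimprovable: in each of 1), 2), 3) both the lower bound and the upper bound are attained by graphs in the corresponding class on $[n+1]$ (connected graphs, Hamiltonian graphs, trees, respectively; in 2) whenever $n\ge 2$).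
   Context: Notation: $[m]=\{1,\ldots,m\}$. Graphs are finite, with no loops or multiple edges. A graph is Hamiltonian if it contains a Hamiltonian cycle, i.e. a cycle visiting each vertex exactly once (so it has at least 3 vertices). For a graph $\Gamma$ on $[n+1]$, the graphical building set $B(\Gamma)$ is the collection of nonempty $S\subseteq[n+1]$ such that the induced subgraph $\Gamma|_S$ is connected. The graph-associahedron is the Minkowski sum $P_\Gamma=\sum_{S\in B(\Gamma)}\Delta^S\subset\mathbb{R}^{n+1}$, where $\Delta^S=\mathrm{conv}\{e_i : i\in S\}$ and $e_1,\ldots,e_{n+1}$ are the standard basis vectors of $\mathbb{R}^{n+1}$. For connected $\Gamma$ on $[n+1]$, $P_\Gamma$ is a simple polytope of dimension $n$ (a polytope of dimension $n$ is simple if every vertex lies in exactly $n$ facets). Special series: $As^n=P_{L_{n+1}}$ (associahedron), $L_{n+1}$ the path graph on $[n+1]$; $Cy^n=P_{C_{n+1}}$ (cyclohedron), $C_{n+1}$ the cycle graph on $[n+1]$; $Pe^n=P_{K_{n+1}}$ (permutohedron), $K_{n+1}$ the complete graph on $[n+1]$; $St^n=P_{K_{1,n}}$ (stellohedron), $K_{1,n}$ the star graph on $[n+1]$ (one node adjacent to the other $n$ nodes, no other edges). For an $n$-dimensional simple polytope $P$, let $f_i$ be the number of its $i$-dimensional faces ($f_n=1$), $F(P)(\alpha,t)=\sum_{i=0}^n f_i\alpha^i t^{n-i}$ and $H(P)(\alpha,t)=F(P)(\alpha-t,t)=\sum_{i=0}^n h_i\alpha^{n-i}t^i$. By the Dehn–Sommerville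 equations $H(P)$ is symmetric in $\alpha,t$, so it is uniquely written as $H(P)=\sum_{i=0}^{\lfloor n/2\rfloor}\gamma_i(\alpha t)^i(\alpha+t)^{n-2i}$; the numbers $\gamma_i=\gamma_i(P)$ form the $\gamma$-vector of $P$. *)

theory Defs
  imports "HOL-Analysis.Analysis" "Graph_Theory.Digraph_Component"
begin

section \<open>Graphs\<close>

text \<open>
  A finite simple graph is a \<open>pair_graph\<close>: a finite vertex set \<open>pverts\<close> with a symmetric,
  irreflexive arc relation \<open>parcs\<close>, each edge being present in both directions.

  The library predicate \<open>cycle\<close> counts the closed walk \<open>u, v, u\<close> along a single edge as a cycle
  (so its predicate \<open>tree\<close> only holds for edgeless symmetric digraphs). A cycle of the
  undirected graph is a directed cycle of length at least 3.
\<close>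

definition graph_on :: "nat \<Rightarrow> nat pair_pre_digraph \<Rightarrow> bool" where
  "graph_on m G \<longleftrightarrow> pair_graph G \<and> pverts G = {1..m}"

definition graph_cycle :: "'v pair_pre_digraph \<Rightarrow> ('v \<times> 'v) list \<Rightarrow> bool" where
  "graph_cycle G p \<longleftrightarrow> pre_digraph.cycle (with_proj G) p \<and> length p \<ge> 3"

abbreviation graph_connected :: "'v pair_pre_digraph \<Rightarrow> bool" where
  "graph_connected G \<equiv> Digraph_Component.connected (with_proj G)"

definition hamiltonian :: "'v pair_pre_digraph \<Rightarrow> bool" where
  "hamiltonian G \<longleftrightarrow> (\<exists>p. graph_cycle G p \<and> fst ` set p = pverts G)"

definition graph_tree :: "'v pair_pre_digraph \<Rightarrow> bool" where
  "graph_tree G \<longleftrightarrow> graph_connected G \<and> (\<nexists>p. graph_cycle G p)"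

definition path_graph :: "nat \<Rightarrow> nat pair_pre_digraph" where
  "path_graph m = \<lparr> pverts = {1..m},
     parcs = {(i, j). i \<in> {1..m} \<and> j \<in> {1..m} \<and> (j = i + 1 \<or> i = j + 1)} \<rparr>"

text \<open>Intended for \<open>m \<ge> 3\<close>; for \<open>m = 2\<close> this is a single edge.\<close>

definition cycle_graph :: "nat \<Rightarrow> nat pair_pre_digraph" where
  "cycle_graph m = \<lparr> pverts = {1..m}, parcs = parcs (path_graph m) \<union> {(1, m), (m, 1)} \<rparr>"

definition complete_graph :: "nat \<Rightarrow> nat pair_pre_digraph" where
  "complete_graph m = \<lparr> pverts = {1..m},
     parcs = {(i, j). i \<in> {1..m} \<and> j \<in> {1..m} \<and> i \<noteq> j} \<rparr>"

definition star_graph :: "nat \<Rightarrow> nat pair_pre_digraph" where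
  "star_graph m = \<lparr> pverts = {1..m},
     parcs = {(i, j). i \<in> {1..m} \<and> j \<in> {1..m} \<and> i \<noteq> j \<and> (i = 1 \<or> j = 1)} \<rparr>"


section \<open>Graph-associahedra\<close>

text \<open>
  Below, \<open>e\<close> enumerates the standard basis of the ambient Euclidean space by the vertices of
  the graph, and the sum of sets is the Minkowski sum of \<open>HOL-Library.Set_Algebras\<close>.
\<close>

definition building_set :: "'v pair_pre_digraph \<Rightarrow> 'v set set" where
  "building_set G =
     {S. S \<noteq> {} \<and> S \<subseteq> pverts G \<and> Digraph_Component.connected (with_proj G \<restriction> S)}"

definition graph_associahedron ::
    "('v \<Rightarrow> 'a::euclidean_space) \<Rightarrow> 'v pair_pre_digraph \<Rightarrow> 'a set" where
  "graph_associahedron e G = (\<Sum>S\<in>building_set G. convex hull (e ` S))"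

definition associahedron :: "(nat \<Rightarrow> 'a::euclidean_space) \<Rightarrow> nat \<Rightarrow> 'a set" where
  "associahedron e n = graph_associahedron e (path_graph (n + 1))"

definition cyclohedron :: "(nat \<Rightarrow> 'a::euclidean_space) \<Rightarrow> nat \<Rightarrow> 'a set" where
  "cyclohedron e n = graph_associahedron e (cycle_graph (n + 1))"

definition permutohedron :: "(nat \<Rightarrow> 'a::euclidean_space) \<Rightarrow> nat \<Rightarrow> 'a set" where
  "permutohedron e n = graph_associahedron e (complete_graph (n + 1))"

definition stellohedron :: "(nat \<Rightarrow> 'a::euclidean_space) \<Rightarrow> nat \<Rightarrow> 'a set" where
  "stellohedron e n = graph_associahedron e (star_graph (n + 1))"


section \<open>The gamma-vector of a polytope\<close>

definition poly_dim :: "'a::euclidean_space set \<Rightarrow> nat" where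
  "poly_dim P = nat (aff_dim P)"

definition f_vector :: "'a::euclidean_space set \<Rightarrow> nat \<Rightarrow> nat" where
  "f_vector P i = card {F. F face_of P \<and> aff_dim F = int i}"

text \<open>The bivariate polynomials \<open>F(P)\<close> and \<open>H(P)\<close> are represented by the real functions they
  induce, which determine them.\<close>

definition F_poly :: "'a::euclidean_space set \<Rightarrow> real \<Rightarrow> real \<Rightarrow> real" where
  "F_poly P \<alpha> t = (\<Sum>i\<le>poly_dim P. real (f_vector P i) * \<alpha> ^ i * t ^ (poly_dim P - i))"

definition H_poly :: "'a::euclidean_space set \<Rightarrow> real \<Rightarrow> real \<Rightarrow> real" where
  "H_poly P \<alpha> t = F_poly P (\<alpha> - t) t"

text \<open>The condition on large indices only makes the description unique.  For simple polytopes
  the described sequence exists by the Dehn--Sommerville equations.\<close>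

definition gamma_vector :: "'a::euclidean_space set \<Rightarrow> nat \<Rightarrow> real" where
  "gamma_vector P = (THE g.
     (\<forall>i > poly_dim P div 2. g i = 0) \<and>
     (\<forall>\<alpha> t. H_poly P \<alpha> t =
        (\<Sum>i\<le>poly_dim P div 2. g i * (\<alpha> * t) ^ i * (\<alpha> + t) ^ (poly_dim P - 2 * i))))"

end

theory Submission
  imports Defs
begin

text \<open>
  For a direction \<open>w\<close>, the face of the Minkowski sum \<open>\<Sum>S. \<Delta>\<^sup>S\<close> where \<open>w\<close> is maximal is the sum of
  the corresponding faces of the simplices. Hence faces of a graph-associahedron correspond to
  the records \<open>maxima E w V\<close> of which vertices maximise a weight \<open>w\<close> on each tube (connected vertex
  set), and \<open>facepoly\<close> counts these records by the dimension of the face (\<open>sum_faces_tube_sum\<close>).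
  Raising the weights on a set \<open>A\<close> above all others relates the records of \<open>W\<close> to those of
  \<open>W - A\<close>. The result, \<open>facepoly_recursion\<close>, is
  \<open>\<Sum>A \<subseteq> W. x ^ card A * f (W - A) = (1 + x) ^ num_comps W * f W\<close>. It determines the face polynomial
  of every induced subgraph, and everything combinatorial below is derived from it.

  When an edge \<open>uv\<close> is added, finitely many vertex sets \<open>S\<close> become connected, and each contributes
  \<open>(1 + x) * f S * f (contraction by S)\<close> to the face polynomial (\<open>facepoly_add_edge\<close>). Geometrically
  each new tube shaves off a face of codimension 2. In the variables of the gamma-vector the factor
  \<open>1 + x\<close> shifts the indices by one. By induction on the number of vertices, gamma polynomials
  therefore exist, have nonnegative coefficients, and grow with the edge set of a connected graph
  (\<open>has_nonneg_gamma\<close>, \<open>gamma_poly_mono\<close>). This gives the upper bound by the permutohedron and the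
  lower bound by the cyclohedron.

  For a leaf \<open>l\<close> attached to \<open>v\<close>, the same formula expresses the gamma polynomial as that of the graph
  without \<open>l\<close> plus a sum of products over the proper connected sets \<open>A\<close> containing \<open>v\<close>
  (\<open>gamma_poly_leaf\<close>). If \<open>v\<close> is the end of a path, there is exactly one such \<open>A\<close> of each size;
  in an arbitrary connected graph there is at least one of each size. Induction shows that paths are
  minimal (\<open>gamma_poly_path_le\<close>). If \<open>v\<close> is the centre of a star, every set through \<open>v\<close> is
  connected and contracting it leaves a complete graph, so each summand that a tree has is dominated by a
  summand of the star (\<open>gamma_poly_tree_le_star\<close>).
\<close>

section \<open>Connectivity of induced subgraphs\<close>

definition comps :: "'v rel \<Rightarrow> 'v set \<Rightarrow> 'v set set" where
  "comps E W = W // rtrancl_on W E"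

definition num_comps :: "'v rel \<Rightarrow> 'v set \<Rightarrow> nat" where
  "num_comps E W = card (comps E W)"

definition conn :: "'v rel \<Rightarrow> 'v set \<Rightarrow> bool" where
  "conn E S \<longleftrightarrow> S \<noteq> {} \<and> (\<forall>a\<in>S. \<forall>b\<in>S. (a, b) \<in> rtrancl_on S E)"

lemma reach_local:
  assumes "E \<inter> W \<times> W = E' \<inter> W \<times> W"
  shows "rtrancl_on W E = rtrancl_on W E'"
proof -
  have *: "(a, b) \<in> rtrancl_on W F'" if "(a, b) \<in> rtrancl_on W F" "F \<inter> W \<times> W = F' \<inter> W \<times> W"
    for a b and F F' :: "'a rel"
    using that(1)
  proof (induct rule: rtrancl_on_induct)
    case (step y z)
    then have "(y, z) \<in> F'" using that(2) by blast
    then show ?case using step by (meson rtrancl_on_into_rtrancl_on)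
  qed auto
  show ?thesis using *[of _ _ E E'] *[of _ _ E' E] assms by auto
qed

lemma num_comps_local: "E \<inter> W \<times> W = E' \<inter> W \<times> W \<Longrightarrow> num_comps E W = num_comps E' W"
  and conn_local: "E \<inter> W \<times> W = E' \<inter> W \<times> W \<Longrightarrow> conn E W = conn E' W"
  unfolding num_comps_def comps_def conn_def by (simp_all add: reach_local[of E W E'])

lemma reach_sub: "rtrancl_on W E \<subseteq> W \<times> W"
  by (auto dest: in_rtrancl_on_in_F)

lemma reach_symD: "sym E \<Longrightarrow> (a, b) \<in> rtrancl_on W E \<Longrightarrow> (b, a) \<in> rtrancl_on W E"
  using rtrancl_on_sym symD by metis

lemma reach_edge: "(a, b) \<in> E \<Longrightarrow> a \<in> W \<Longrightarrow> b \<in> W \<Longrightarrow> (a, b) \<in> rtrancl_on W E"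
  by (meson rtrancl_on_into_rtrancl_on rtrancl_on_refl)

lemma equiv_reach: "sym E \<Longrightarrow> equiv W (rtrancl_on W E)"
  by (rule equivI)
    (auto simp: reach_sub refl_on_def rtrancl_on_sym intro!: transI elim: rtrancl_on_trans
       dest: in_rtrancl_on_in_F)

lemma finite_comps: "finite W \<Longrightarrow> finite (comps E W)"
  unfolding comps_def by (rule finite_quotient[OF _ reach_sub])

lemma comps_empty [simp]: "comps E {} = {}"
  by (simp add: comps_def)

lemma num_comps_empty [simp]: "num_comps E {} = 0"
  by (simp add: num_comps_def)

lemma num_comps_le_card: "finite W \<Longrightarrow> num_comps E W \<le> card W"
proof -
  assume "finite W"
  have "comps E W = (\<lambda>a. rtrancl_on W E `` {a}) ` W"
    by (auto simp: comps_def quotient_def)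
  then show ?thesis using \<open>finite W\<close> unfolding num_comps_def by (simp add: card_image_le)
qed

lemma reach_split:
  assumes "sym E" "U \<inter> U' = {}" "E \<inter> U \<times> U' = {}"
  shows "rtrancl_on (U \<union> U') E = rtrancl_on U E \<union> rtrancl_on U' E"
proof (intro subset_antisym subrelI)
  fix a b assume "(a, b) \<in> rtrancl_on (U \<union> U') E"
  then show "(a, b) \<in> rtrancl_on U E \<union> rtrancl_on U' E"
  proof (induct rule: rtrancl_on_induct)
    case (step y z)
    consider "(a, y) \<in> rtrancl_on U E" | "(a, y) \<in> rtrancl_on U' E" using step by blast
    then show ?case
    proof cases
      case 1
      then have "y \<in> U" by (meson in_rtrancl_on_in_F)
      then have "z \<in> U" using step assms by auto
      then show ?thesis using 1 step by (meson UnI1 rtrancl_on_into_rtrancl_on)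
    next
      case 2
      then have "y \<in> U'" by (meson in_rtrancl_on_in_F)
      then have "z \<in> U'" using step assms by (auto dest: symD)
      then show ?thesis using 2 step by (meson UnI2 rtrancl_on_into_rtrancl_on)
    qed
  qed auto
next
  fix a b assume "(a, b) \<in> rtrancl_on U E \<union> rtrancl_on U' E"
  then show "(a, b) \<in> rtrancl_on (U \<union> U') E"
    using rtrancl_on_mono[OF subset_refl, of U "U \<union> U'" a b E]
      rtrancl_on_mono[OF subset_refl, of U' "U \<union> U'" a b E] by auto
qed

lemma comps_nonempty: "C \<in> comps E W \<Longrightarrow> C \<noteq> {}"
  and comps_sub: "C \<in> comps E W \<Longrightarrow> C \<subseteq> W"
  unfolding comps_def quotient_def by (auto dest: in_rtrancl_on_in_F)

lemma comps_split:
  assumes "sym E" "U \<inter> U' = {}" "E \<inter> U \<times> U' = {}"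
  shows "comps E (U \<union> U') = comps E U \<union> comps E U'" "comps E U \<inter> comps E U' = {}"
proof -
  have 1: "rtrancl_on (U \<union> U') E `` {a} = rtrancl_on U E `` {a}" if "a \<in> U" for a
    unfolding reach_split[OF assms] using that assms(2) by (auto dest: in_rtrancl_on_in_F)
  have 2: "rtrancl_on (U \<union> U') E `` {a} = rtrancl_on U' E `` {a}" if "a \<in> U'" for a
    unfolding reach_split[OF assms] using that assms(2) by (auto dest: in_rtrancl_on_in_F)
  show "comps E (U \<union> U') = comps E U \<union> comps E U'"
    unfolding comps_def quotient_def using 1 2 by auto
  have "False" if "C \<in> comps E U" "C \<in> comps E U'" for C
    using comps_nonempty[OF that(1)] comps_sub[OF that(1)] comps_sub[OF that(2)] assms(2) by blast
  then show "comps E U \<inter> comps E U' = {}" by blast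
qed

lemma num_comps_split:
  assumes "sym E" "U \<inter> U' = {}" "E \<inter> U \<times> U' = {}" "finite U" "finite U'"
  shows "num_comps E (U \<union> U') = num_comps E U + num_comps E U'"
  unfolding num_comps_def comps_split(1)[OF assms(1-3)]
  by (rule card_Un_disjoint) (auto simp: finite_comps assms comps_split(2)[OF assms(1-3)])

lemma conn_comps_eq:
  assumes "conn E W" shows "comps E W = {W}"
proof -
  have "rtrancl_on W E = W \<times> W" using assms reach_sub[of W E] by (auto simp: conn_def)
  then show ?thesis using assms by (auto simp: comps_def quotient_def conn_def)
qed

lemma num_comps_conn: "conn E W \<Longrightarrow> num_comps E W = 1"
  by (simp add: num_comps_def conn_comps_eq)

lemma conn_nonempty: "conn E S \<Longrightarrow> S \<noteq> {}"
  by (simp add: conn_def)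

lemma conn_reach: "conn E S \<Longrightarrow> a \<in> S \<Longrightarrow> b \<in> S \<Longrightarrow> (a, b) \<in> rtrancl_on S E"
  by (simp add: conn_def)

lemma connI_center:
  assumes "sym E" "a \<in> S" "\<And>b. b \<in> S \<Longrightarrow> (a, b) \<in> rtrancl_on S E"
  shows "conn E S"
  unfolding conn_def using assms reach_symD rtrancl_on_trans by (metis empty_iff)

lemma conn_singleton [simp]: "conn E {a}"
  by (simp add: conn_def)

lemma conn_mono: "conn E S \<Longrightarrow> E \<inter> S \<times> S \<subseteq> E' \<Longrightarrow> conn E' S"
proof -
  assume *: "conn E S" "E \<inter> S \<times> S \<subseteq> E'"
  have "rtrancl_on S E = rtrancl_on S (E \<inter> S \<times> S)" by (rule reach_local) auto
  then show ?thesis using * rtrancl_on_mono[OF *(2) subset_refl] unfolding conn_def by auto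
qed

lemma conn_union:
  assumes "sym E" "conn E S" "conn E T" "a \<in> S" "b \<in> T" "a = b \<or> (a, b) \<in> E"
  shows "conn E (S \<union> T)"
proof (rule connI_center)
  show "a \<in> S \<union> T" using assms by auto
  fix c assume "c \<in> S \<union> T"
  have S: "(a, c) \<in> rtrancl_on (S \<union> T) E" if "c \<in> S"
    by (rule rtrancl_on_mono[OF subset_refl _ conn_reach[OF assms(2,4) that]]) auto
  have T: "(b, c) \<in> rtrancl_on (S \<union> T) E" if "c \<in> T"
    by (rule rtrancl_on_mono[OF subset_refl _ conn_reach[OF assms(3,5) that]]) auto
  have "(a, b) \<in> rtrancl_on (S \<union> T) E" using assms(4-6) by (auto intro: reach_edge)
  then show "(a, c) \<in> rtrancl_on (S \<union> T) E"
    using S T \<open>c \<in> S \<union> T\<close> rtrancl_on_trans by (metis UnE)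
qed (fact assms)

lemma conn_insert:
  assumes "sym E" "conn E S" "a \<in> S" "(a, b) \<in> E"
  shows "conn E (insert b S)"
  using conn_union[OF assms(1,2) conn_singleton[of E b] assms(3), of b] assms(4) by simp

lemma reach_class:
  assumes "(a, b) \<in> rtrancl_on W E"
  shows "(a, b) \<in> rtrancl_on (rtrancl_on W E `` {a}) E"
  using assms
proof (induct rule: rtrancl_on_induct)
  case (step y z)
  then have "(a, z) \<in> rtrancl_on W E" by (meson rtrancl_on_into_rtrancl_on)
  then show ?case using step by (meson Image_singleton_iff rtrancl_on_into_rtrancl_on)
qed auto

lemma conn_class: "sym E \<Longrightarrow> a \<in> W \<Longrightarrow> conn E (rtrancl_on W E `` {a})"
  by (rule connI_center[of E a]) (auto intro: reach_class)

lemma no_edge_class: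
  assumes "sym E" shows "E \<inter> (rtrancl_on W E `` {a}) \<times> (W - rtrancl_on W E `` {a}) = {}"
  by (auto intro: rtrancl_on_into_rtrancl_on)

lemma comps_conn: "sym E \<Longrightarrow> C \<in> comps E W \<Longrightarrow> conn E C"
  unfolding comps_def quotient_def using conn_class by auto

lemma comps_cover: "a \<in> W \<Longrightarrow> \<exists>C\<in>comps E W. a \<in> C"
  unfolding comps_def quotient_def by auto

lemma comps_disj: "sym E \<Longrightarrow> C \<in> comps E W \<Longrightarrow> D \<in> comps E W \<Longrightarrow> a \<in> C \<Longrightarrow> a \<in> D \<Longrightarrow> C = D"
  unfolding comps_def using quotient_disj[OF equiv_reach] by (metis disjoint_iff)

lemma comps_closed:
  "sym E \<Longrightarrow> C \<in> comps E W \<Longrightarrow> a \<in> C \<Longrightarrow> (a, b) \<in> E \<Longrightarrow> b \<in> W \<Longrightarrow> b \<in> C"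
  unfolding comps_def quotient_def by (auto intro: rtrancl_on_into_rtrancl_on)

lemma reach_comps:
  "sym E \<Longrightarrow> C \<in> comps E W \<Longrightarrow> a \<in> C \<Longrightarrow> (a, b) \<in> rtrancl_on W E \<longleftrightarrow> b \<in> C"
  unfolding comps_def quotient_def by (auto intro: rtrancl_on_trans dest: reach_symD)

lemma conn_sub_comps:
  assumes "sym E" "conn E S" "S \<subseteq> W" "C \<in> comps E W" "S \<inter> C \<noteq> {}"
  shows "S \<subseteq> C"
proof
  fix b assume "b \<in> S"
  obtain a where a: "a \<in> S" "a \<in> C" using assms by auto
  have "(a, b) \<in> rtrancl_on W E"
    by (rule rtrancl_on_mono[OF subset_refl assms(3) conn_reach[OF assms(2) a(1) \<open>b \<in> S\<close>]])
  then show "b \<in> C" using reach_comps[OF assms(1,4) a(2)] by simp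
qed

lemma conn_crossing:
  assumes "conn E S" "T \<subseteq> S" "T \<noteq> {}" "T \<noteq> S"
  obtains a b where "a \<in> T" "b \<in> S - T" "(a, b) \<in> E"
proof -
  obtain a b where ab: "a \<in> T" "b \<in> S - T" using assms by auto
  then have "(a, b) \<in> rtrancl_on S E" using assms conn_reach by fastforce
  then have "b \<in> T \<or> (\<exists>x\<in>T. \<exists>y\<in>S - T. (x, y) \<in> E)"
    by (induct rule: rtrancl_on_induct) (use ab in auto)
  then show ?thesis using ab that by auto
qed

lemma connI_crossing:
  assumes "sym E" "S \<noteq> {}"
    "\<And>T. T \<subseteq> S \<Longrightarrow> T \<noteq> {} \<Longrightarrow> T \<noteq> S \<Longrightarrow> E \<inter> T \<times> (S - T) \<noteq> {}"
  shows "conn E S"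
proof -
  obtain a where a: "a \<in> S" using assms by auto
  let ?C = "rtrancl_on S E `` {a}"
  have "?C = S"
    using assms(3)[of ?C] no_edge_class[OF assms(1), of S a] a by (auto dest: in_rtrancl_on_in_F)
  then show ?thesis using conn_class[OF assms(1) a] by simp
qed

text \<open>A proper connected subset always has a neighbour outside it, so it can be grown one vertex at
  a time.\<close>

lemma conn_subset_card:
  assumes "sym E" "finite V" "conn E V" "v \<in> V" "1 \<le> k" "k \<le> card V"
  shows "\<exists>A. v \<in> A \<and> A \<subseteq> V \<and> conn E A \<and> card A = k"
  using assms(5,6)
proof (induct k rule: dec_induct)
  case base
  show ?case by (rule exI[of _ "{v}"]) (use assms in auto)
next
  case (step k)
  then obtain A where A: "v \<in> A" "A \<subseteq> V" "conn E A" "card A = k" by auto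
  then obtain a b where ab: "a \<in> A" "b \<in> V - A" "(a, b) \<in> E"
    using step conn_crossing[OF assms(3) A(2)] by (metis Suc_n_not_le_n empty_iff)
  have "conn E (insert b A)" by (rule conn_insert[OF assms(1) A(3) ab(1,3)])
  moreover have "card (insert b A) = Suc k"
    using A ab finite_subset[OF A(2) assms(2)] by simp
  ultimately show ?case using A ab by (intro exI[of _ "insert b A"]) auto
qed

text \<open>Grow a connected set to one vertex less than \<open>V\<close>; the missing vertex is not a cut vertex.\<close>

lemma conn_remove_vertex:
  assumes "sym E" "finite V" "conn E V" "card V \<ge> 2"
  obtains l v where "l \<in> V" "v \<in> V - {l}" "(v, l) \<in> E" "conn E (V - {l})"
proof -
  obtain x where "x \<in> V" using assms(3) by (auto simp: conn_def)
  then obtain A where A: "A \<subseteq> V" "conn E A" "card A = card V - 1"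
    using conn_subset_card[OF assms(1,2,3), of x "card V - 1"] assms(4) by (metis One_nat_def Suc_leI diff_le_self less_le_trans lessI
        numeral_2_eq_2 zero_less_diff)
  have "A \<noteq> V" using A assms(4) by auto
  then obtain v l where vl: "v \<in> A" "l \<in> V - A" "(v, l) \<in> E"
    using conn_crossing[OF assms(3) A(1)] conn_nonempty[OF A(2)] by metis
  have "A = V - {l}"
    by (rule card_subset_eq) (use A vl assms in auto)
  then show ?thesis using that[of l v] vl A by auto
qed

section \<open>The face polynomial of a graph\<close>

text \<open>A face of a graph-associahedron is encoded by the relation between the tubes \<open>S\<close> and the vertices
  of \<open>S\<close> spanning the face of the simplex on \<open>S\<close> that is selected by \<open>w\<close>. As a set of pairs,
  this record restricts to a smaller vertex set by intersection.\<close>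

definition maxima :: "'v rel \<Rightarrow> ('v \<Rightarrow> real) \<Rightarrow> 'v set \<Rightarrow> ('v set \<times> 'v) set" where
  "maxima E w W = {(S, i). S \<subseteq> W \<and> conn E S \<and> i \<in> S \<and> (\<forall>j\<in>S. w j \<le> w i)}"

definition faces :: "'v rel \<Rightarrow> 'v set \<Rightarrow> ('v set \<times> 'v) set set" where
  "faces E W = range (\<lambda>w. maxima E w W)"

text \<open>The edge directions \<open>e i - e j\<close> with \<open>(i, j)\<close> in this relation span the direction space of the
  face, which therefore has dimension \<open>card W - num_comps (tied \<Theta>) W\<close>.\<close>

definition tied :: "('v set \<times> 'v) set \<Rightarrow> 'v rel" where
  "tied \<Theta> = {(i, j). \<exists>S. (S, i) \<in> \<Theta> \<and> (S, j) \<in> \<Theta>}"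

definition facepoly :: "'v rel \<Rightarrow> 'v set \<Rightarrow> real \<Rightarrow> real" where
  "facepoly E W x = (\<Sum>\<Theta>\<in>faces E W. x ^ (card W - num_comps (tied \<Theta>) W))"

lemma sym_tied [simp]: "sym (tied \<Theta>)"
  by (auto simp: tied_def intro: symI)

lemma faces_sub: "\<Theta> \<in> faces E W \<Longrightarrow> \<Theta> \<subseteq> Pow W \<times> W"
  by (auto simp: faces_def maxima_def)

lemma finite_faces: "finite W \<Longrightarrow> finite (faces E W)"
  by (rule finite_subset[of _ "Pow (Pow W \<times> W)"]) (use faces_sub in blast)+

lemma maxima_local:
  assumes "E \<inter> W \<times> W = E' \<inter> W \<times> W"
  shows "maxima E w W = maxima E' w W"
proof -
  have "conn E S = conn E' S" if "S \<subseteq> W" for S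
    by (rule conn_local) (use assms that in blast)
  then show ?thesis by (auto simp: maxima_def)
qed

lemma facepoly_local: "E \<inter> W \<times> W = E' \<inter> W \<times> W \<Longrightarrow> facepoly E W = facepoly E' W"
  by (rule ext) (simp add: facepoly_def faces_def maxima_local[of E W E'])

text \<open>On tubes meeting \<open>A\<close>, this is the record of a weight that is constant on \<open>A\<close> and smaller
  elsewhere.\<close>

definition raised_maxima :: "'v rel \<Rightarrow> 'v set \<Rightarrow> 'v set \<Rightarrow> ('v set \<times> 'v) set" where
  "raised_maxima E W A = {(S, i). S \<subseteq> W \<and> conn E S \<and> i \<in> S \<inter> A}"

lemma maxima_raise:
  assumes "finite W" "A \<subseteq> W"
  shows "raised_maxima E W A \<union> maxima E w (W - A) \<in> faces E W"
proof -
  obtain M where M: "\<And>j. j \<in> W \<Longrightarrow> w j < M"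
  proof
    fix j assume "j \<in> W"
    then have "w j \<le> Max (w ` W)" using assms(1) by simp
    then show "w j < Max (w ` W) + 1" by simp
  qed
  define w' where "w' i = (if i \<in> A then M else w i)" for i
  have "maxima E w' W = raised_maxima E W A \<union> maxima E w (W - A)"
  proof (intro set_eqI iffI; clarify)
    fix S i assume a: "(S, i) \<in> maxima E w' W" "(S, i) \<notin> maxima E w (W - A)"
    then have S: "S \<subseteq> W" "conn E S" "i \<in> S" "\<And>j. j \<in> S \<Longrightarrow> w' j \<le> w' i"
      by (auto simp: maxima_def)
    have "S \<inter> A \<noteq> {}"
    proof
      assume "S \<inter> A = {}"
      then have "\<And>j. j \<in> S \<Longrightarrow> w' j = w j" by (auto simp: w'_def)
      then show False using a S \<open>S \<inter> A = {}\<close> by (auto simp: maxima_def)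
    qed
    then obtain j where j: "j \<in> S" "j \<in> A" by auto
    have "i \<in> A"
    proof (rule ccontr)
      assume "i \<notin> A"
      then have "M \<le> w i" using S(4)[OF j(1)] j by (simp add: w'_def)
      then show False using M[of i] S by auto
    qed
    then show "(S, i) \<in> raised_maxima E W A" using S by (auto simp: raised_maxima_def)
  next
    fix S i assume "(S, i) \<in> raised_maxima E W A \<union> maxima E w (W - A)"
    then show "(S, i) \<in> maxima E w' W"
    proof
      assume "(S, i) \<in> raised_maxima E W A"
      then show ?thesis using M by (auto simp: raised_maxima_def maxima_def w'_def less_imp_le)
    next
      assume "(S, i) \<in> maxima E w (W - A)"
      then show ?thesis unfolding maxima_def w'_def by auto
    qed
  qed
  then show ?thesis unfolding faces_def by (metis rangeI)
qed

definition maximizers :: "('v set \<times> 'v) set \<Rightarrow> 'v set set \<Rightarrow> 'v set" where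
  "maximizers \<Theta> I = {i. \<exists>C\<in>I. (C, i) \<in> \<Theta>}"

definition met_comps :: "'v rel \<Rightarrow> 'v set \<Rightarrow> 'v set \<Rightarrow> 'v set set" where
  "met_comps E W A = {C \<in> comps E W. C \<inter> A \<noteq> {}}"

text \<open>Conversely, a record of \<open>W\<close> and a choice \<open>I\<close> of components determine a set \<open>A\<close>, the maximisers in
  these components, such that the record splits again. A tube meeting \<open>A\<close> lies in one component
  of \<open>I\<close> and contains a maximiser of that component, so its own maximisers are its elements
  of \<open>A\<close>.\<close>

lemma maxima_lower:
  fixes w :: "'v \<Rightarrow> real"
  assumes "sym E" "finite W" "I \<subseteq> comps E W"
  defines "A \<equiv> maximizers (maxima E w W) I"
  shows "A \<subseteq> W" "met_comps E W A = I" "maxima E w W = raised_maxima E W A \<union> maxima E w (W - A)"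
proof -
  show AW: "A \<subseteq> W" by (auto simp: A_def maximizers_def maxima_def)
  have max: "\<exists>i. (C, i) \<in> maxima E w W" if "C \<in> I" for C
  proof -
    have C: "C \<in> comps E W" using assms that by auto
    then have fin: "finite C" "C \<noteq> {}"
      using comps_sub[OF C] assms(2) finite_subset comps_nonempty[OF C] by auto
    then have "Max (w ` C) \<in> w ` C" by simp
    then obtain i where i: "i \<in> C" "w i = Max (w ` C)" by auto
    then have "\<forall>j\<in>C. w j \<le> w i" using fin by simp
    then show ?thesis using i comps_sub[OF C] comps_conn[OF assms(1) C] by (auto simp: maxima_def)
  qed
  show "met_comps E W A = I"
  proof (intro set_eqI iffI)
    fix C assume "C \<in> met_comps E W A"
    then obtain i D where *: "C \<in> comps E W" "i \<in> C" "D \<in> I" "i \<in> D"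
      by (auto simp: met_comps_def A_def maximizers_def maxima_def)
    then have "C = D" using comps_disj[OF assms(1)] assms(3) by blast
    then show "C \<in> I" using * by simp
  next
    fix C assume "C \<in> I"
    then show "C \<in> met_comps E W A"
      using max[of C] assms(3) unfolding met_comps_def A_def maximizers_def maxima_def by blast
  qed
  show "maxima E w W = raised_maxima E W A \<union> maxima E w (W - A)"
  proof (intro subset_antisym subsetI; clarify)
    fix S i assume a: "(S, i) \<in> maxima E w W" "(S, i) \<notin> maxima E w (W - A)"
    then have S: "S \<subseteq> W" "conn E S" "i \<in> S" "\<And>j. j \<in> S \<Longrightarrow> w j \<le> w i"
      by (auto simp: maxima_def)
    have "S \<inter> A \<noteq> {}" using a S by (auto simp: maxima_def)
    then obtain j C where j: "j \<in> S" "C \<in> I" "(C, j) \<in> maxima E w W"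
      by (auto simp: A_def maximizers_def)
    have "S \<subseteq> C"
      by (rule conn_sub_comps[OF assms(1) S(2,1)]) (use j assms(3) in \<open>auto simp: maxima_def\<close>)
    then have "(C, i) \<in> maxima E w W"
      using j S(3) S(4)[OF j(1)] by (fastforce simp: maxima_def)
    then show "(S, i) \<in> raised_maxima E W A" using S j by (auto simp: raised_maxima_def A_def maximizers_def)
  next
    fix S i assume "(S, i) \<in> raised_maxima E W A \<union> maxima E w (W - A)"
    then show "(S, i) \<in> maxima E w W"
    proof
      assume c: "(S, i) \<in> raised_maxima E W A"
      then obtain C where C: "C \<in> I" "(C, i) \<in> maxima E w W" "i \<in> S"
        by (auto simp: raised_maxima_def A_def maximizers_def)
      have "S \<subseteq> C"
        by (rule conn_sub_comps[OF assms(1), of _ W])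
          (use c C assms(3) in \<open>auto simp: maxima_def raised_maxima_def\<close>)
      then show ?thesis using C c by (auto simp: maxima_def raised_maxima_def)
    qed (auto simp: maxima_def)
  qed
qed

text \<open>The raised tubes tie two vertices of \<open>A\<close> exactly when these lie in the same component of \<open>W\<close>, since
  that component is itself a tube; the other tubes avoid \<open>A\<close>.\<close>

lemma num_comps_tied_raised:
  assumes "sym E" "finite W" "A \<subseteq> W" "\<psi> \<in> faces E (W - A)"
  shows "num_comps (tied (raised_maxima E W A \<union> \<psi>)) W = card (met_comps E W A) + num_comps (tied \<psi>) (W - A)"
proof -
  let ?L = "tied (raised_maxima E W A \<union> \<psi>)"
  have \<psi>: "S \<subseteq> W - A \<and> i \<in> W - A" if "(S, i) \<in> \<psi>" for S i
    using faces_sub[OF assms(4)] that by auto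
  have raised_maxima: "S \<inter> A \<noteq> {} \<and> i \<in> A" if "(S, i) \<in> raised_maxima E W A" for S i
    using that by (auto simp: raised_maxima_def)
  have excl: "(S, j) \<notin> raised_maxima E W A" if "(S, i) \<in> \<psi>" for S i j
    using \<psi>[OF that] raised_maxima[of S j] by auto
  have noedge: "?L \<inter> A \<times> (W - A) = {}"
    using \<psi> raised_maxima unfolding tied_def by blast
  have fin: "finite A" using assms finite_subset by auto
  have "num_comps ?L (A \<union> (W - A)) = num_comps ?L A + num_comps ?L (W - A)"
    by (rule num_comps_split) (use noedge assms fin in auto)
  moreover have "A \<union> (W - A) = W" using assms by auto
  moreover have "num_comps ?L (W - A) = num_comps (tied \<psi>) (W - A)"
  proof (rule num_comps_local)
    have "(i, j) \<in> ?L \<longleftrightarrow> (i, j) \<in> tied \<psi>" if "i \<in> W - A" for i j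
      using raised_maxima[of _ i] excl that unfolding tied_def by auto
    then show "?L \<inter> (W - A) \<times> (W - A) = tied \<psi> \<inter> (W - A) \<times> (W - A)" by blast
  qed
  moreover have "num_comps ?L A = card (met_comps E W A)"
  proof -
    have cls: "rtrancl_on A ?L `` {a} = C \<inter> A" if C: "C \<in> comps E W" "a \<in> C" "a \<in> A" for C a
    proof (intro subset_antisym subsetI)
      fix b assume "b \<in> rtrancl_on A ?L `` {a}"
      then have "(a, b) \<in> rtrancl_on A ?L" by simp
      then show "b \<in> C \<inter> A"
      proof (induct rule: rtrancl_on_induct)
        case (step y z)
        then obtain S where "(S, y) \<in> raised_maxima E W A" "(S, z) \<in> raised_maxima E W A"
          using \<psi>[of _ y] \<psi>[of _ z] excl by (auto simp: tied_def)
        then have S: "y \<in> S" "z \<in> S" "S \<subseteq> W" "conn E S"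
          by (auto simp: raised_maxima_def)
        have "S \<subseteq> C" by (rule conn_sub_comps[OF assms(1) S(4,3) C(1)]) (use S step in auto)
        then show ?case using S step by auto
      qed (use that in auto)
    next
      fix b assume b: "b \<in> C \<inter> A"
      have "(C, a) \<in> raised_maxima E W A" "(C, b) \<in> raised_maxima E W A"
        using b that comps_sub[OF C(1)] comps_conn[OF assms(1) C(1)] by (auto simp: raised_maxima_def)
      then have "(a, b) \<in> ?L" by (auto simp: tied_def)
      then show "b \<in> rtrancl_on A ?L `` {a}" using b C reach_edge by fastforce
    qed
    have "comps ?L A = (\<lambda>C. C \<inter> A) ` met_comps E W A"
    proof (intro set_eqI iffI)
      fix X assume "X \<in> comps ?L A"
      then obtain a where a: "a \<in> A" "X = rtrancl_on A ?L `` {a}"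
        by (auto simp: comps_def quotient_def)
      obtain C where C: "C \<in> comps E W" "a \<in> C" using comps_cover[of a W E] a assms by auto
      then show "X \<in> (\<lambda>C. C \<inter> A) ` met_comps E W A" using cls[OF C a(1)] a by (auto simp: met_comps_def)
    next
      fix X assume "X \<in> (\<lambda>C. C \<inter> A) ` met_comps E W A"
      then obtain C a where "C \<in> comps E W" "a \<in> C" "a \<in> A" "X = C \<inter> A" by (auto simp: met_comps_def)
      then show "X \<in> comps ?L A" using cls[of C a] by (auto simp: comps_def quotient_def)
    qed
    moreover have "inj_on (\<lambda>C. C \<inter> A) (met_comps E W A)"
      by (rule inj_onI) (auto simp: met_comps_def dest: comps_disj[OF assms(1)])
    ultimately show ?thesis by (simp add: num_comps_def card_image)
  qed
  ultimately show ?thesis by simp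
qed

text \<open>Both sides enumerate the same objects: pairs of a set \<open>A\<close> and a record of \<open>W - A\<close> on the left,
  pairs of a set of components and a record of \<open>W\<close> on the right. Raising \<open>A\<close> translates the
  first into the second, and taking the maximisers of the chosen components translates
  back.\<close>

lemma facepoly_recursion:
  assumes "sym E" "finite W"
  shows "(\<Sum>A\<in>Pow W. x ^ card A * facepoly E (W - A) x) = (1 + x) ^ num_comps E W * facepoly E W x"
proof -
  let ?d = "\<lambda>\<Theta> W. card W - num_comps (tied \<Theta>) W"
  let ?P = "Sigma (Pow W) (\<lambda>A. faces E (W - A))"
  have "(\<Sum>A\<in>Pow W. x ^ card A * facepoly E (W - A) x) =
      (\<Sum>A\<in>Pow W. \<Sum>\<psi>\<in>faces E (W - A). x ^ card A * x ^ ?d \<psi> (W - A))"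
    by (simp add: facepoly_def sum_distrib_left)
  also have "\<dots> = (\<Sum>(A, \<psi>)\<in>?P. x ^ card A * x ^ ?d \<psi> (W - A))"
    by (rule sum.Sigma) (use assms in \<open>auto intro!: finite_faces\<close>)
  also have "\<dots> = (\<Sum>(I, \<Theta>)\<in>Pow (comps E W) \<times> faces E W. x ^ card I * x ^ ?d \<Theta> W)"
  proof (rule sum.reindex_bij_witness[where
        j = "\<lambda>(A, \<psi>). (met_comps E W A, raised_maxima E W A \<union> \<psi>)" and
        i = "\<lambda>(I, \<Theta>). (maximizers \<Theta> I, \<Theta> \<inter> Pow (W - maximizers \<Theta> I) \<times> UNIV)"])
    fix p assume "p \<in> ?P"
    then obtain A w where p: "p = (A, maxima E w (W - A))" "A \<subseteq> W" by (auto simp: faces_def)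
    let ?\<psi> = "maxima E w (W - A)"
    have \<psi>: "?\<psi> \<in> faces E (W - A)" by (auto simp: faces_def)
    have A: "maximizers (raised_maxima E W A \<union> ?\<psi>) (met_comps E W A) = A"
    proof (intro subset_antisym subsetI)
      fix a assume "a \<in> maximizers (raised_maxima E W A \<union> ?\<psi>) (met_comps E W A)"
      then show "a \<in> A" by (auto simp: maximizers_def met_comps_def raised_maxima_def maxima_def)
    next
      fix a assume a: "a \<in> A"
      then obtain C where C: "C \<in> comps E W" "a \<in> C" using comps_cover[of a W E] p by auto
      then show "a \<in> maximizers (raised_maxima E W A \<union> ?\<psi>) (met_comps E W A)"
        using a comps_sub[OF C(1)] comps_conn[OF assms(1) C(1)]
        unfolding maximizers_def met_comps_def raised_maxima_def by blast
    qed
    have "(raised_maxima E W A \<union> ?\<psi>) \<inter> Pow (W - A) \<times> UNIV = ?\<psi>"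
      by (auto simp: raised_maxima_def maxima_def)
    then show "(case (case p of (A, \<psi>) \<Rightarrow> (met_comps E W A, raised_maxima E W A \<union> \<psi>)) of
        (I, \<Theta>) \<Rightarrow> (maximizers \<Theta> I, \<Theta> \<inter> Pow (W - maximizers \<Theta> I) \<times> UNIV)) = p"
      using A p by simp
    show "(case p of (A, \<psi>) \<Rightarrow> (met_comps E W A, raised_maxima E W A \<union> \<psi>)) \<in> Pow (comps E W) \<times> faces E W"
      using maxima_raise[OF assms(2) p(2)] p by (auto simp: met_comps_def)
    have d: "card A + ?d ?\<psi> (W - A) = card (met_comps E W A) + ?d (raised_maxima E W A \<union> ?\<psi>) W"
    proof -
      have "card W = card A + card (W - A)"
        using p assms by (metis card_Diff_subset card_mono finite_subset le_add_diff_inverse)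
      moreover have "num_comps (tied ?\<psi>) (W - A) \<le> card (W - A)" using assms by (simp add: num_comps_le_card)
      moreover have "num_comps (tied (raised_maxima E W A \<union> ?\<psi>)) W \<le> card W" using assms by (simp add: num_comps_le_card)
      ultimately show ?thesis using num_comps_tied_raised[OF assms p(2) \<psi>] by simp
    qed
    show "(case (case p of (A, \<psi>) \<Rightarrow> (met_comps E W A, raised_maxima E W A \<union> \<psi>)) of
        (I, \<Theta>) \<Rightarrow> x ^ card I * x ^ ?d \<Theta> W) = (case p of (A, \<psi>) \<Rightarrow> x ^ card A * x ^ ?d \<psi> (W - A))"
      using d by (simp add: p flip: power_add)
  next
    fix q assume "q \<in> Pow (comps E W) \<times> faces E W"
    then obtain I w where q: "q = (I, maxima E w W)" "I \<subseteq> comps E W" by (auto simp: faces_def)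
    define A where "A = maximizers (maxima E w W) I"
    note low = maxima_lower[OF assms q(2), of w, folded A_def]
    have r: "maxima E w W \<inter> Pow (W - A) \<times> UNIV = maxima E w (W - A)"
      by (auto simp: maxima_def)
    show "(case (case q of (I, \<Theta>) \<Rightarrow> (maximizers \<Theta> I, \<Theta> \<inter> Pow (W - maximizers \<Theta> I) \<times> UNIV)) of
        (A, \<psi>) \<Rightarrow> (met_comps E W A, raised_maxima E W A \<union> \<psi>)) = q"
      by (simp only: q prod.case r low(2) low(3)[symmetric] flip: A_def)
    show "(case q of (I, \<Theta>) \<Rightarrow> (maximizers \<Theta> I, \<Theta> \<inter> Pow (W - maximizers \<Theta> I) \<times> UNIV)) \<in> ?P"
      using low(1) by (simp add: q r faces_def flip: A_def)
  qed
  also have "\<dots> = (\<Sum>I\<in>Pow (comps E W). x ^ card I) * facepoly E W x"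
    by (simp add: facepoly_def sum_product sum.cartesian_product)
  also have "(\<Sum>I\<in>Pow (comps E W). x ^ card I) = (1 + x) ^ num_comps E W"
    using prod_add[of "comps E W" "\<lambda>_. x" "\<lambda>_. 1::real"] finite_comps[OF assms(2), of E]
    by (simp add: num_comps_def add.commute)
  finally show ?thesis .
qed

section \<open>Consequences of the recursion\<close>

lemma num_comps_pos: "finite W \<Longrightarrow> W \<noteq> {} \<Longrightarrow> 1 \<le> num_comps E W"
proof -
  assume W: "finite W" "W \<noteq> {}"
  then obtain a where "a \<in> W" by auto
  then have "comps E W \<noteq> {}" using comps_cover[of a W E] by auto
  then show ?thesis using finite_comps[OF W(1), of E] by (simp add: num_comps_def Suc_le_eq card_gt_0_iff)
qed

lemma facepoly_empty [simp]: "facepoly E {} x = 1"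
proof -
  have "faces E {} = {{}}" by (auto simp: faces_def maxima_def)
  then show ?thesis by (simp add: facepoly_def)
qed

lemma sum_Pow_remove_empty:
  fixes h :: "'v set \<Rightarrow> real"
  assumes "finite U"
  shows "(\<Sum>A\<in>Pow U. h A) = h {} + (\<Sum>A\<in>Pow U - {{}}. h A)"
  by (rule sum.remove) (use assms in auto)

text \<open>The recursion has a single solution because the coefficient \<open>(1 + x) ^ num_comps E U - 1\<close> of
  the unknown value at a nonempty \<open>U\<close> is nonzero. This turns isomorphism invariance and multiplicativity
  into statements about numbers of components.\<close>

lemma facepoly_unique:
  fixes E :: "'v rel" and g :: "'v set \<Rightarrow> real"
  assumes "sym E" "finite W" "0 < x" "g {} = 1"
    and rec: "\<And>U. U \<subseteq> W \<Longrightarrow> (\<Sum>A\<in>Pow U. x ^ card A * g (U - A)) = (1 + x) ^ num_comps E U * g U"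
  shows "g W = facepoly E W x"
proof -
  have "finite U \<Longrightarrow> U \<subseteq> W \<Longrightarrow> g U = facepoly E U x" for U
  proof (induct U rule: finite_psubset_induct)
    case (psubset U)
    show ?case
    proof (cases "U = {}")
      case False
      have "(\<Sum>A\<in>Pow U - {{}}. x ^ card A * g (U - A)) =
          (\<Sum>A\<in>Pow U - {{}}. x ^ card A * facepoly E (U - A) x)"
        by (rule sum.cong) (use psubset in auto)
      then have "(1 + x) ^ num_comps E U * g U - g U =
          (1 + x) ^ num_comps E U * facepoly E U x - facepoly E U x"
        using rec[OF psubset(3)] facepoly_recursion[OF assms(1) psubset(1), of x]
        by (simp add: sum_Pow_remove_empty[OF psubset(1)])
      then have "((1 + x) ^ num_comps E U - 1) * (g U - facepoly E U x) = 0" by (simp add: algebra_simps)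
      moreover have "1 < (1 + x) ^ num_comps E U"
        using num_comps_pos[OF psubset(1) False, of E] assms(3) by (intro one_less_power) auto
      ultimately show ?thesis by simp
    qed (use assms in simp)
  qed
  then show ?thesis using assms(2) by simp
qed

lemma reach_image:
  assumes "inj_on p U" "\<And>a b. a \<in> U \<Longrightarrow> b \<in> U \<Longrightarrow> (a, b) \<in> E \<longleftrightarrow> (p a, p b) \<in> E'" "a \<in> U"
  shows "rtrancl_on (p ` U) E' `` {p a} = p ` (rtrancl_on U E `` {a})"
proof (intro subset_antisym subsetI)
  fix c assume "c \<in> rtrancl_on (p ` U) E' `` {p a}"
  then have "(p a, c) \<in> rtrancl_on (p ` U) E'" by simp
  then have "\<exists>b. c = p b \<and> (a, b) \<in> rtrancl_on U E"
  proof (induct rule: rtrancl_on_induct)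
    case (step y z)
    then obtain b b' where *: "y = p b" "(a, b) \<in> rtrancl_on U E" "z = p b'" "b' \<in> U" by auto
    have "b \<in> U" using *(2) by (meson in_rtrancl_on_in_F)
    then have "(b, b') \<in> E" using step(2) assms(2)[of b b'] * by simp
    then have "(a, b') \<in> rtrancl_on U E" using rtrancl_on_into_rtrancl_on[OF *(2) _ *(4)] by simp
    then show ?case using * by blast
  qed (use assms in auto)
  then show "c \<in> p ` (rtrancl_on U E `` {a})" by auto
next
  fix c assume "c \<in> p ` (rtrancl_on U E `` {a})"
  then obtain b where b: "(a, b) \<in> rtrancl_on U E" "c = p b" by auto
  from b(1) have "(p a, p b) \<in> rtrancl_on (p ` U) E'"
  proof (induct rule: rtrancl_on_induct)
    case (step y z)
    then show ?case using assms(2)[of y z] by (meson image_eqI rtrancl_on_into_rtrancl_on)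
  qed (use assms in auto)
  then show "c \<in> rtrancl_on (p ` U) E' `` {p a}" using b by simp
qed

lemma num_comps_image:
  assumes "inj_on p U" "\<And>a b. a \<in> U \<Longrightarrow> b \<in> U \<Longrightarrow> (a, b) \<in> E \<longleftrightarrow> (p a, p b) \<in> E'"
  shows "num_comps E' (p ` U) = num_comps E U"
proof -
  have "comps E' (p ` U) = image p ` comps E U"
    unfolding comps_def quotient_def using reach_image[OF assms] by (simp add: image_UN)
  moreover have "inj_on (image p) (comps E U)"
    by (rule inj_on_subset[OF inj_on_image_Pow[OF assms(1)]]) (auto dest: comps_sub)
  ultimately show ?thesis by (simp add: num_comps_def card_image)
qed

lemma facepoly_image:
  assumes "sym E" "sym E'" "finite W" "0 < x" "inj_on p W"
    and iso: "\<And>a b. a \<in> W \<Longrightarrow> b \<in> W \<Longrightarrow> (a, b) \<in> E \<longleftrightarrow> (p a, p b) \<in> E'"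
  shows "facepoly E' (p ` W) x = facepoly E W x"
proof (rule facepoly_unique[OF assms(1,3,4)])
  fix U assume U: "U \<subseteq> W"
  then have inj: "inj_on p U" and fin: "finite U" using assms inj_on_subset finite_subset by blast+
  have "(\<Sum>A\<in>Pow U. x ^ card A * facepoly E' (p ` (U - A)) x) =
      (\<Sum>B\<in>image p ` Pow U. x ^ card B * facepoly E' (p ` U - B) x)"
    unfolding sum.reindex[OF inj_on_image_Pow[OF inj]]
    by (rule sum.cong) (auto simp: card_image inj_on_subset[OF inj] inj_on_image_set_diff[OF inj])
  also have "image p ` Pow U = Pow (p ` U)" by (simp add: image_Pow_surj)
  also have "(\<Sum>B\<in>Pow (p ` U). x ^ card B * facepoly E' (p ` U - B) x) =
      (1 + x) ^ num_comps E' (p ` U) * facepoly E' (p ` U) x"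
    by (rule facepoly_recursion) (use assms fin in auto)
  also have "num_comps E' (p ` U) = num_comps E U" by (rule num_comps_image[OF inj]) (use iso U in blast)
  finally show "(\<Sum>A\<in>Pow U. x ^ card A * facepoly E' (p ` (U - A)) x) =
      (1 + x) ^ num_comps E U * facepoly E' (p ` U) x" .
qed simp

lemma sum_Pow_Un:
  fixes h :: "'v set \<Rightarrow> real"
  assumes "finite X" "finite Y" "X \<inter> Y = {}"
  shows "(\<Sum>A\<in>Pow (X \<union> Y). h A) = (\<Sum>A\<in>Pow X. \<Sum>B\<in>Pow Y. h (A \<union> B))"
proof -
  have "(\<Sum>A\<in>Pow (X \<union> Y). h A) = (\<Sum>(A, B)\<in>Pow X \<times> Pow Y. h (A \<union> B))"
    by (rule sum.reindex_bij_witness[where i = "\<lambda>(A, B). A \<union> B" and j = "\<lambda>A. (A \<inter> X, A \<inter> Y)"])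
      (use assms in \<open>auto simp: Int_Un_distrib[symmetric] Int_absorb2 intro!: arg_cong[of _ _ h]\<close>)
  then show ?thesis by (simp add: sum.cartesian_product)
qed

lemma facepoly_split:
  assumes "sym E" "finite X" "finite Y" "X \<inter> Y = {}" "E \<inter> X \<times> Y = {}" "0 < x"
  shows "facepoly E (X \<union> Y) x = facepoly E X x * facepoly E Y x"
proof -
  define g where "g T = facepoly E (T \<inter> X) x * facepoly E (T \<inter> Y) x" for T
  have "g (X \<union> Y) = facepoly E (X \<union> Y) x"
  proof (rule facepoly_unique[OF assms(1)])
    fix U assume "U \<subseteq> X \<union> Y"
    define P Q where "P = U \<inter> X" and "Q = U \<inter> Y"
    have PQ: "U = P \<union> Q" "P \<inter> Q = {}" "finite P" "finite Q" "E \<inter> P \<times> Q = {}" "P \<subseteq> X" "Q \<subseteq> Y"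
      using assms \<open>U \<subseteq> X \<union> Y\<close> by (auto simp: P_def Q_def)
    have "(\<Sum>A\<in>Pow U. x ^ card A * g (U - A)) =
        (\<Sum>A\<in>Pow P. \<Sum>B\<in>Pow Q. x ^ card (A \<union> B) * g (U - (A \<union> B)))"
      unfolding PQ(1) by (rule sum_Pow_Un) (use PQ in auto)
    also have "\<dots> = (\<Sum>A\<in>Pow P. \<Sum>B\<in>Pow Q.
        (x ^ card A * facepoly E (P - A) x) * (x ^ card B * facepoly E (Q - B) x))"
    proof (intro sum.cong refl)
      fix A B assume AB: "A \<in> Pow P" "B \<in> Pow Q"
      have "card (A \<union> B) = card A + card B"
        using AB PQ finite_subset by (intro card_Un_disjoint) blast+
      moreover have "(U - (A \<union> B)) \<inter> X = P - A" "(U - (A \<union> B)) \<inter> Y = Q - B"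
        using AB PQ assms(4) by auto
      ultimately show "x ^ card (A \<union> B) * g (U - (A \<union> B)) =
          (x ^ card A * facepoly E (P - A) x) * (x ^ card B * facepoly E (Q - B) x)"
        by (simp add: g_def power_add)
    qed
    also have "\<dots> = (1 + x) ^ num_comps E P * facepoly E P x * ((1 + x) ^ num_comps E Q * facepoly E Q x)"
      unfolding sum_product[symmetric] by (simp add: facepoly_recursion assms(1) PQ)
    also have "\<dots> = (1 + x) ^ num_comps E U * g U"
      using num_comps_split[OF assms(1) PQ(2,5,3,4)]
      by (simp add: g_def power_add flip: PQ(1) P_def Q_def)
    finally show "(\<Sum>A\<in>Pow U. x ^ card A * g (U - A)) = (1 + x) ^ num_comps E U * g U" .
  qed (use assms in \<open>auto simp: g_def\<close>)
  moreover have "(X \<union> Y) \<inter> X = X" "(X \<union> Y) \<inter> Y = Y" by auto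
  ultimately show ?thesis by (simp add: g_def)
qed

section \<open>Adding an edge\<close>

definition add_edge :: "'v \<Rightarrow> 'v \<Rightarrow> 'v rel \<Rightarrow> 'v rel" where
  "add_edge u v E = E \<union> {(u, v), (v, u)}"

text \<open>Used on vertex sets disjoint from \<open>S\<close>: vertices adjacent to \<open>S\<close> become adjacent to each other. This is
  the graph of the contracted building set, also known as the reconnected complement of \<open>S\<close>. Leaving out the
  diagonal keeps loopless graphs loopless, so that they stay below the complete graph \<open>- Id\<close>.\<close>

definition contract :: "'v rel \<Rightarrow> 'v set \<Rightarrow> 'v rel" where
  "contract E S = E \<union> ((E `` S) \<times> (E `` S) - Id)"

definition new_tubes :: "'v rel \<Rightarrow> 'v rel \<Rightarrow> 'v set \<Rightarrow> 'v set set" where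
  "new_tubes E E' W = {S. S \<subseteq> W \<and> conn E' S \<and> \<not> conn E S}"

lemma sym_add_edge [simp]: "sym E \<Longrightarrow> sym (add_edge u v E)"
  by (auto simp: add_edge_def sym_def)

lemma sym_contract [simp]: "sym E \<Longrightarrow> sym (contract E S)"
  by (auto simp: contract_def sym_def)

lemma finite_new_tubes: "finite W \<Longrightarrow> finite (new_tubes E E' W)"
  by (auto simp: new_tubes_def)

lemma add_edge_local: "u \<notin> S \<or> v \<notin> S \<Longrightarrow> add_edge u v E \<inter> S \<times> S = E \<inter> S \<times> S"
  by (auto simp: add_edge_def)

lemma new_tube_mem:
  assumes "S \<in> new_tubes E (add_edge u v E) W"
  shows "u \<in> S" "v \<in> S" "S \<subseteq> W" "conn (add_edge u v E) S" "\<not> conn E S"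
  using assms conn_local[OF add_edge_local[of u S v E]] by (auto simp: new_tubes_def)

text \<open>Without the new edge a new tube falls apart into the component of \<open>u\<close> and that of \<open>v\<close>.\<close>

lemma num_comps_new_tube:
  assumes "sym E" "finite S" "conn (add_edge u v E) S" "\<not> conn E S"
  shows "num_comps E S = 2"
proof -
  have uv: "u \<in> S" "v \<in> S" using assms conn_local[OF add_edge_local[of u S v E]] by blast+
  define C D where "C = rtrancl_on S E `` {u}" and "D = rtrancl_on S E `` {v}"
  have C: "conn E C" "C \<in> comps E S" "u \<in> C" and D: "conn E D" "D \<in> comps E S" "v \<in> D"
    using conn_class[OF assms(1)] uv by (auto simp: C_def D_def comps_def quotient_def)
  have sub: "C \<subseteq> S" "D \<subseteq> S" using C D comps_sub by auto
  have "C \<union> D = S"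
  proof (rule ccontr)
    assume "C \<union> D \<noteq> S"
    then obtain a b where "a \<in> C \<union> D" "b \<in> S - (C \<union> D)" "(a, b) \<in> add_edge u v E"
      using conn_crossing[OF assms(3), of "C \<union> D"] sub C by blast
    then show False
      using C D comps_closed[OF assms(1) C(2), of a b] comps_closed[OF assms(1) D(2), of a b]
      by (auto simp: add_edge_def)
  qed
  moreover have "C \<inter> D = {}"
  proof (rule ccontr)
    assume "C \<inter> D \<noteq> {}"
    then have "C = D" using comps_disj[OF assms(1) C(2) D(2)] by blast
    then show False using \<open>C \<union> D = S\<close> C assms(4) by simp
  qed
  moreover have "E \<inter> C \<times> D = {}"
    using comps_closed[OF assms(1) C(2)] sub \<open>C \<inter> D = {}\<close> by blast
  ultimately have "num_comps E S = num_comps E C + num_comps E D"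
    using num_comps_split[OF assms(1), of C D] sub finite_subset[OF _ assms(2)] by metis
  then show ?thesis using num_comps_conn[OF C(1)] num_comps_conn[OF D(1)] by simp
qed

text \<open>Every edge leaving a set \<open>T\<close> of vertices outside \<open>S\<close> leads to \<open>S\<close> or to another vertex outside
  \<open>S\<close>. If neither \<open>T\<close> nor its complement in \<open>W - S\<close> has an edge to the other, both are
  adjacent to \<open>S\<close>, hence joined in the contraction.\<close>

lemma conn_contract:
  assumes "sym E" "conn (add_edge u v E) W" "u \<in> S" "v \<in> S" "S \<subseteq> W" "S \<noteq> W"
  shows "conn (contract E S) (W - S)"
proof (rule connI_crossing)
  fix T assume T: "T \<subseteq> W - S" "T \<noteq> {}" "T \<noteq> W - S"
  have cross: "(\<exists>a\<in>T. \<exists>b\<in>W - S - T. (a, b) \<in> E) \<or> (\<exists>a\<in>T. \<exists>b\<in>S. (a, b) \<in> E)"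
    if T: "T \<subseteq> W - S" "T \<noteq> {}" for T
  proof -
    obtain a b where "a \<in> T" "b \<in> W - T" "(a, b) \<in> add_edge u v E"
    proof (rule conn_crossing[OF assms(2), of T])
      show "T \<subseteq> W" "T \<noteq> W" using T assms(3,5) by auto
    qed (use T in auto)
    moreover have "a \<noteq> u" "a \<noteq> v" using T assms(3,4) \<open>a \<in> T\<close> by auto
    ultimately have "(a, b) \<in> E" by (auto simp: add_edge_def)
    then show ?thesis using \<open>a \<in> T\<close> \<open>b \<in> W - T\<close> by (cases "b \<in> S") auto
  qed
  let ?T' = "W - S - T"
  have T': "?T' \<subseteq> W - S" "?T' \<noteq> {}" "W - S - ?T' = T" using T by auto
  show "contract E S \<inter> T \<times> (W - S - T) \<noteq> {}"
  proof (cases "\<exists>a\<in>T. \<exists>b\<in>W - S - T. (a, b) \<in> E")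
    case True
    then show ?thesis by (auto simp: contract_def)
  next
    case False
    then obtain a s where a: "a \<in> T" "s \<in> S" "(a, s) \<in> E" using cross[OF T(1,2)] by blast
    have "\<not> (\<exists>a\<in>?T'. \<exists>b\<in>T. (a, b) \<in> E)" using False symD[OF assms(1)] by auto
    then obtain b t where b: "b \<in> ?T'" "t \<in> S" "(b, t) \<in> E"
      using cross[OF T'(1,2)] unfolding T'(3) by auto
    have "a \<in> E `` S" "b \<in> E `` S"
      using a(2) b(2) symD[OF assms(1) a(3)] symD[OF assms(1) b(3)] by auto
    then show ?thesis using a b by (auto simp: contract_def)
  qed
qed (use assms in auto)

text \<open>Induction on \<open>W\<close>. If \<open>W\<close> is disconnected even with the new edge, both sides are multiplicative over
  the component of \<open>u\<close>. Otherwise both graphs satisfy the recursion, and the convolution of the right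
  hand side with the powers \<open>x ^ card A\<close> can be evaluated by the recursion for each contraction, which
  is connected unless \<open>S = W\<close>. The exceptional summand \<open>S = W\<close>, present exactly when \<open>W\<close> is
  disconnected without the new edge, accounts for the different exponents of \<open>1 + x\<close>.\<close>

theorem facepoly_add_edge:
  fixes u v :: "'v"
  assumes "sym E" "finite W" "0 < x"
  defines "E' \<equiv> add_edge u v E"
  shows "facepoly E' W x = facepoly E W x +
    (1 + x) * (\<Sum>S\<in>new_tubes E E' W. facepoly E S x * facepoly (contract E S) (W - S) x)"
  using assms(2)
proof (induct W rule: finite_psubset_induct)
  case (psubset W)
  note fin = psubset(1)
  have sE: "sym E" and sE': "sym E'" using assms by auto
  define f f' where "f U = facepoly E U x" and "f' U = facepoly E' U x" for U
  define k where "k S U = facepoly (contract E S) U x" for S U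
  define R where "R U = (\<Sum>S\<in>new_tubes E E' U. f S * k S (U - S))" for U
  note mem = new_tube_mem[of _ E u v, folded E'_def]
  have IH: "f' U - f U = (1 + x) * R U" if "U \<subset> W" for U
    using psubset(2)[OF that] by (simp add: f_def f'_def R_def k_def)
  have "f' W - f W = (1 + x) * R W"
  proof (cases "u \<in> W \<and> v \<in> W")
    case False
    then have "f' W = f W"
      unfolding f_def f'_def E'_def by (subst facepoly_local[of _ W E]) (auto simp: add_edge_def)
    moreover have "new_tubes E E' W = {}" using False mem by blast
    ultimately show ?thesis by (simp add: R_def)
  next
    case uv: True
    show ?thesis
    proof (cases "conn E' W")
      case False
      define C where "C = rtrancl_on W E' `` {u}"
      have C: "conn E' C" "C \<in> comps E' W" "u \<in> C"
        using conn_class[OF sE'] uv by (auto simp: C_def comps_def quotient_def)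
      have CW: "C \<subset> W" using comps_sub[OF C(2)] False C(1) by auto
      have vC: "v \<in> C"
        using comps_closed[OF sE' C(2,3), of v] uv by (auto simp: E'_def add_edge_def)
      have no: "E' \<inter> C \<times> (W - C) = {}" using comps_closed[OF sE' C(2)] by blast
      have no_edge_E: "E \<inter> C \<times> (W - C) = {}" using no by (auto simp: E'_def add_edge_def)
      have W: "C \<union> (W - C) = W" using CW by auto
      have finC: "finite C" "finite (W - C)" using CW fin finite_subset by auto
      have f': "f' W = f' C * f' (W - C)"
        using facepoly_split[OF sE' finC _ no assms(3)] W by (simp add: f'_def)
      have f: "f W = f C * f (W - C)"
        using facepoly_split[OF sE finC _ no_edge_E assms(3)] W by (simp add: f_def)
      have ff: "f' (W - C) = f (W - C)"
        unfolding f_def f'_def E'_def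
        by (subst facepoly_local[of _ "W - C" E]) (use C in \<open>auto simp: add_edge_def\<close>)
      have "new_tubes E E' W = new_tubes E E' C"
      proof (intro set_eqI iffI)
        fix S assume S: "S \<in> new_tubes E E' W"
        have "S \<subseteq> C"
          by (rule conn_sub_comps[OF sE' mem(4)[OF S] mem(3)[OF S] C(2)])
            (use mem(1)[OF S] C in auto)
        then show "S \<in> new_tubes E E' C" using S by (auto simp: new_tubes_def)
      qed (use CW in \<open>auto simp: new_tubes_def\<close>)
      moreover have "k S (W - S) = k S (C - S) * f (W - C)" if S: "S \<in> new_tubes E E' C" for S
      proof -
        have SC: "S \<subseteq> C" using mem(3)[OF S] .
        then have W': "(C - S) \<union> (W - C) = W - S" using CW by auto
        have nb: "E `` S \<inter> (W - C) = {}" using no_edge_E SC by blast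
        have "k S (W - S) = k S (C - S) * k S (W - C)"
          unfolding k_def W'[symmetric]
          by (rule facepoly_split)
            (use finC sE no_edge_E nb assms(3) in \<open>auto simp: contract_def sym_contract[unfolded contract_def]\<close>)
        moreover have "k S (W - C) = f (W - C)"
          unfolding k_def f_def
          by (subst facepoly_local[of _ "W - C" E]) (use nb in \<open>auto simp: contract_def\<close>)
        ultimately show ?thesis by simp
      qed
      ultimately have "R W = R C * f (W - C)"
        by (simp add: R_def sum_distrib_right mult.assoc)
      then show ?thesis using f' f ff IH[OF CW] by (metis left_diff_distrib mult.assoc)
    next
      case True
      have num_comps': "num_comps E' W = 1" using num_comps_conn[OF True] .
      have rec: "(\<Sum>A\<in>Pow W. x ^ card A * f (W - A)) = (1 + x) ^ num_comps E W * f W"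
        "(\<Sum>A\<in>Pow W. x ^ card A * f' (W - A)) = (1 + x) * f' W"
        using facepoly_recursion[OF sE fin, of x] facepoly_recursion[OF sE' fin, of x] num_comps'
        by (simp_all add: f_def f'_def)
      \<comment> \<open>\<open>Q\<close> is the convolution of \<open>R\<close>; it is computed below from the recursion for the contractions.\<close>
      define Q where "Q = (\<Sum>A\<in>Pow W. x ^ card A * R (W - A))"
      have "(1 + x) * f' W - (1 + x) ^ num_comps E W * f W =
          (\<Sum>A\<in>Pow W. x ^ card A * (f' (W - A) - f (W - A)))"
        by (simp add: rec right_diff_distrib sum_subtractf)
      also have "\<dots> = f' W - f W + (\<Sum>A\<in>Pow W - {{}}. x ^ card A * ((1 + x) * R (W - A)))"
      proof -
        have "(\<Sum>A\<in>Pow W - {{}}. x ^ card A * (f' (W - A) - f (W - A))) =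
            (\<Sum>A\<in>Pow W - {{}}. x ^ card A * ((1 + x) * R (W - A)))"
          by (intro sum.cong refl arg_cong2[of _ _ _ _ "(*)"] IH) auto
        then show ?thesis by (simp add: sum_Pow_remove_empty[OF fin])
      qed
      also have "(\<Sum>A\<in>Pow W - {{}}. x ^ card A * ((1 + x) * R (W - A))) = (1 + x) * (Q - R W)"
        unfolding Q_def sum_Pow_remove_empty[OF fin] by (simp add: sum_distrib_left mult.left_commute)
      finally have main: "(1 + x) * f' W - (1 + x) ^ num_comps E W * f W = f' W - f W + (1 + x) * (Q - R W)" .
      have "Q = (\<Sum>A\<in>Pow W. \<Sum>S\<in>{S \<in> new_tubes E E' W. S \<inter> A = {}}.
          x ^ card A * (f S * k S (W - A - S)))"
      proof -
        have "new_tubes E E' (W - A) = {S \<in> new_tubes E E' W. S \<inter> A = {}}" if "A \<subseteq> W" for A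
          using that by (auto simp: new_tubes_def)
        then show ?thesis by (auto simp: Q_def R_def sum_distrib_left intro!: sum.cong)
      qed
      also have "\<dots> = (\<Sum>S\<in>new_tubes E E' W. \<Sum>A\<in>{A \<in> Pow W. S \<inter> A = {}}.
          x ^ card A * (f S * k S (W - A - S)))"
        by (rule sum.swap_restrict) (use fin in \<open>auto simp: finite_new_tubes\<close>)
      also have "\<dots> = (\<Sum>S\<in>new_tubes E E' W. f S * ((1 + x) ^ num_comps (contract E S) (W - S) * k S (W - S)))"
      proof (rule sum.cong[OF refl])
        fix S assume S: "S \<in> new_tubes E E' W"
        have "{A \<in> Pow W. S \<inter> A = {}} = Pow (W - S)" by auto
        then have "(\<Sum>A\<in>{A \<in> Pow W. S \<inter> A = {}}. x ^ card A * (f S * k S (W - A - S))) =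
            f S * (\<Sum>A\<in>Pow (W - S). x ^ card A * k S (W - S - A))"
          by (auto simp: sum_distrib_left mult.left_commute Diff_eq Int_ac intro!: sum.cong)
        also have "(\<Sum>A\<in>Pow (W - S). x ^ card A * k S (W - S - A)) =
            (1 + x) ^ num_comps (contract E S) (W - S) * k S (W - S)"
          unfolding k_def by (rule facepoly_recursion) (use fin sE in auto)
        finally show "(\<Sum>A\<in>{A \<in> Pow W. S \<inter> A = {}}. x ^ card A * (f S * k S (W - A - S))) =
            f S * ((1 + x) ^ num_comps (contract E S) (W - S) * k S (W - S))" .
      qed
      also have "\<dots> = (\<Sum>S\<in>new_tubes E E' W. (1 + x) * (f S * k S (W - S)) -
          (if S = W then x * f W else 0))"
      proof (rule sum.cong[OF refl])
        fix S assume S: "S \<in> new_tubes E E' W"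
        show "f S * ((1 + x) ^ num_comps (contract E S) (W - S) * k S (W - S)) =
            (1 + x) * (f S * k S (W - S)) - (if S = W then x * f W else 0)"
        proof (cases "S = W")
          case True
          then show ?thesis by (simp add: k_def algebra_simps)
        next
          case False
          have "num_comps (contract E S) (W - S) = 1"
            by (rule num_comps_conn, rule conn_contract[of E u v])
              (use mem[OF S] False True sE in \<open>auto simp: E'_def\<close>)
          then show ?thesis using False by simp
        qed
      qed
      also have "\<dots> = (1 + x) * R W - (if W \<in> new_tubes E E' W then x * f W else 0)"
        by (simp add: R_def sum_subtractf sum_distrib_left sum.delta finite_new_tubes[OF fin])
      finally have Q: "Q = (1 + x) * R W - (if W \<in> new_tubes E E' W then x * f W else 0)" .
      have "x * (f' W - f W) = x * ((1 + x) * R W)"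
      proof (cases "conn E W")
        case True
        then show ?thesis
          using main num_comps_conn[OF True] by (simp add: Q new_tubes_def algebra_simps)
      next
        case False
        then have "W \<in> new_tubes E E' W" using True by (simp add: new_tubes_def)
        moreover have "num_comps E W = 2"
          using num_comps_new_tube[OF sE fin _ False] True by (simp add: E'_def)
        ultimately show ?thesis
          using main by (simp add: Q power2_eq_square algebra_simps)
      qed
      then show ?thesis using assms(3) by simp
    qed
  qed
  then show ?case by (simp add: f_def f'_def R_def k_def)
qed

section \<open>Gamma polynomials\<close>

text \<open>For an \<open>f\<close>-polynomial \<open>f x = F(P)(x, 1)\<close> of a polytope of dimension \<open>d\<close>, the substitution
  \<open>\<alpha> = x + 1\<close>, \<open>t = 1\<close> in the definition of the gamma-vector gives
  \<open>f x = (\<Sum>i. \<gamma>\<^sub>i * (x + 1) ^ i * (x + 2) ^ (d - 2 * i))\<close>. Dividing by \<open>(x + 2) ^ d\<close> turns this into the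
  value of the polynomial with coefficients \<open>\<gamma>\<^sub>i\<close> at \<open>(x + 1) / (x + 2)\<^sup>2\<close>, a form that is visibly
  multiplicative. Restricting to \<open>x > 0\<close> avoids the pole.\<close>

definition gamma_expansion :: "nat \<Rightarrow> (real \<Rightarrow> real) \<Rightarrow> real poly \<Rightarrow> bool" where
  "gamma_expansion d f g \<longleftrightarrow> 2 * degree g \<le> d \<and>
     (\<forall>x>0. f x = (x + 2) ^ d * poly g ((x + 1) / (x + 2)\<^sup>2))"

lemma gamma_expansion_unique:
  assumes "gamma_expansion d f g" "gamma_expansion d f g'"
  shows "g = g'"
proof (rule ccontr)
  assume "g \<noteq> g'"
  let ?y = "\<lambda>x::real. (x + 1) / (x + 2)\<^sup>2"
  have "inj_on ?y {0<..}"
  proof (rule inj_onI)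
    fix x z :: real assume "x \<in> {0<..}" "z \<in> {0<..}" and eq: "?y x = ?y z"
    then have pos: "x > 0" "z > 0" by auto
    then have "(x + 1) * (z + 2)\<^sup>2 = (z + 1) * (x + 2)\<^sup>2"
      using eq by (simp add: frac_eq_eq)
    then have "(z - x) * (x * z + x + z) = 0" by (simp add: power2_eq_square algebra_simps)
    moreover have "x * z + x + z > 0" using pos by (simp add: add_pos_pos)
    ultimately show "x = z" by simp
  qed
  then have "infinite (?y ` {0<..})"
    using finite_imageD infinite_Ioi by blast
  moreover have "?y ` {0<..} \<subseteq> {y. poly (g - g') y = 0}"
  proof clarify
    fix x :: real assume "x > 0"
    then have "(x + 2) ^ d * poly g (?y x) = (x + 2) ^ d * poly g' (?y x)"
      using assms by (simp add: gamma_expansion_def)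
    then show "poly (g - g') (?y x) = 0" using \<open>x > 0\<close> by simp
  qed
  ultimately show False
    using poly_roots_finite[of "g - g'"] \<open>g \<noteq> g'\<close> finite_subset by auto
qed

lemma gamma_expansion_cong:
    "gamma_expansion d f g \<Longrightarrow> (\<And>x. 0 < x \<Longrightarrow> f' x = f x) \<Longrightarrow> gamma_expansion d f' g"
  by (simp add: gamma_expansion_def)

lemma gamma_expansion_one: "gamma_expansion 0 (\<lambda>x. 1) 1"
  by (simp add: gamma_expansion_def)

lemma gamma_expansion_zero: "gamma_expansion d (\<lambda>x. 0) 0"
  by (simp add: gamma_expansion_def)

lemma gamma_expansion_add:
    "gamma_expansion d f g \<Longrightarrow> gamma_expansion d f' g' \<Longrightarrow> gamma_expansion d (\<lambda>x. f x + f' x) (g + g')"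
  using degree_add_le_max[of g g'] by (auto simp: gamma_expansion_def algebra_simps)

lemma gamma_expansion_sum:
    "(\<And>i. i \<in> I \<Longrightarrow> gamma_expansion d (f i) (g i)) \<Longrightarrow> gamma_expansion d (\<lambda>x. \<Sum>i\<in>I. f i x) (\<Sum>i\<in>I. g i)"
  by (induct I rule: infinite_finite_induct) (simp_all add: gamma_expansion_zero gamma_expansion_add)

lemma gamma_expansion_mult:
  "gamma_expansion d f g \<Longrightarrow> gamma_expansion d' f' g' \<Longrightarrow> gamma_expansion (d + d') (\<lambda>x. f x * f' x) (g * g')"
  using degree_mult_le[of g g'] by (auto simp: gamma_expansion_def power_add)

text \<open>The factor \<open>x + 2\<close> is the face polynomial of a segment, with gamma polynomial 1.\<close>

lemma gamma_expansion_interval: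
    "gamma_expansion d f g \<Longrightarrow> gamma_expansion (Suc d) (\<lambda>x. (x + 2) * f x) g"
  by (auto simp: gamma_expansion_def)

lemma gamma_expansion_tau:
    "gamma_expansion d f g \<Longrightarrow> gamma_expansion (d + 2) (\<lambda>x. (1 + x) * f x) (pCons 0 g)"
proof -
  assume g: "gamma_expansion d f g"
  have "(1 + x) * f x = (x + 2) ^ (d + 2) * poly (pCons 0 g) ((x + 1) / (x + 2)\<^sup>2)" if "x > 0" for x
  proof -
    define y where "y = (x + 1) / (x + 2)\<^sup>2"
    have "1 + x = (x + 2)\<^sup>2 * y" using that by (simp add: y_def)
    moreover have "f x = (x + 2) ^ d * poly g y" using g that by (simp add: gamma_expansion_def y_def)
    ultimately have "(1 + x) * f x = (x + 2) ^ (d + 2) * (y * poly g y)"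
      by (simp only: power_add ac_simps)
    then show ?thesis by (simp add: y_def)
  qed
  then show ?thesis using g by (auto simp: gamma_expansion_def degree_pCons_eq_if)
qed

text \<open>Here \<open>card W - num_comps E W\<close> is the dimension of the product of the graph-associahedra of the
  components.\<close>

definition gamma_poly :: "'v rel \<Rightarrow> 'v set \<Rightarrow> real poly" where
  "gamma_poly E W = (THE g. gamma_expansion (card W - num_comps E W) (facepoly E W) g)"

definition coeff_nonneg :: "real poly \<Rightarrow> bool" where
  "coeff_nonneg g \<longleftrightarrow> (\<forall>i. 0 \<le> coeff g i)"

definition coeff_le :: "real poly \<Rightarrow> real poly \<Rightarrow> bool" where
  "coeff_le g g' \<longleftrightarrow> (\<forall>i. coeff g i \<le> coeff g' i)"

lemma coeff_le_refl [simp]: "coeff_le g g"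
  and coeff_le_trans [trans]: "coeff_le g g' \<Longrightarrow> coeff_le g' g'' \<Longrightarrow> coeff_le g g''"
  by (auto simp: coeff_le_def intro: order_trans)

lemma coeff_nonneg_add: "coeff_nonneg g \<Longrightarrow> coeff_nonneg g' \<Longrightarrow> coeff_nonneg (g + g')"
  by (simp add: coeff_nonneg_def)

lemma coeff_nonneg_mult: "coeff_nonneg g \<Longrightarrow> coeff_nonneg g' \<Longrightarrow> coeff_nonneg (g * g')"
  by (simp add: coeff_nonneg_def coeff_mult sum_nonneg)

lemma coeff_nonneg_sum: "(\<And>i. i \<in> I \<Longrightarrow> coeff_nonneg (g i)) \<Longrightarrow> coeff_nonneg (\<Sum>i\<in>I. g i)"
  by (simp add: coeff_nonneg_def coeff_sum sum_nonneg)

lemma coeff_nonneg_pCons: "coeff_nonneg g \<Longrightarrow> coeff_nonneg (pCons 0 g)"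
  by (simp add: coeff_nonneg_def coeff_pCons split: nat.split)

lemma coeff_nonneg_one: "coeff_nonneg 1"
  by (simp add: coeff_nonneg_def)

lemma coeff_le_add: "coeff_le g g' \<Longrightarrow> coeff_le h h' \<Longrightarrow> coeff_le (g + h) (g' + h')"
  by (simp add: coeff_le_def add_mono)

lemma coeff_le_add_nonneg: "coeff_nonneg h \<Longrightarrow> coeff_le g (g + h)"
  by (simp add: coeff_le_def coeff_nonneg_def)

lemma coeff_le_pCons: "coeff_le g g' \<Longrightarrow> coeff_le (pCons 0 g) (pCons 0 g')"
  by (simp add: coeff_le_def coeff_pCons split: nat.split)

lemma coeff_le_mult:
    "coeff_le g g' \<Longrightarrow> coeff_le h h' \<Longrightarrow> coeff_nonneg g' \<Longrightarrow> coeff_nonneg h \<Longrightarrow> coeff_le (g * h) (g' * h')"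
  by (auto simp: coeff_le_def coeff_nonneg_def coeff_mult intro!: sum_mono mult_mono)

lemma coeff_le_sum: "(\<And>i. i \<in> I \<Longrightarrow> coeff_le (g i) (g' i)) \<Longrightarrow> coeff_le (\<Sum>i\<in>I. g i) (\<Sum>i\<in>I. g' i)"
  by (simp add: coeff_le_def coeff_sum sum_mono)

lemma coeff_le_sum_subset:
  assumes "finite J" "I \<subseteq> J" "\<And>i. i \<in> J \<Longrightarrow> coeff_nonneg (g i)"
  shows "coeff_le (\<Sum>i\<in>I. g i) (\<Sum>i\<in>J. g i)"
  using assms by (auto simp: coeff_le_def coeff_nonneg_def coeff_sum intro!: sum_mono2)

definition has_nonneg_gamma :: "'v rel \<Rightarrow> 'v set \<Rightarrow> bool" where
  "has_nonneg_gamma E W \<longleftrightarrow> (\<exists>g. gamma_expansion (card W - num_comps E W) (facepoly E W) g \<and> coeff_nonneg g)"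

lemma gamma_polyI: "gamma_expansion (card W - num_comps E W) (facepoly E W) g \<Longrightarrow> gamma_poly E W = g"
  unfolding gamma_poly_def using gamma_expansion_unique by blast

lemma has_nonneg_gammaI:
  "gamma_expansion (card W - num_comps E W) (facepoly E W) g \<Longrightarrow> coeff_nonneg g \<Longrightarrow> has_nonneg_gamma E W \<and> gamma_poly E W = g"
  using gamma_polyI by (auto simp: has_nonneg_gamma_def)

lemma has_nonneg_gammaD:
  assumes "has_nonneg_gamma E W"
  shows "gamma_expansion (card W - num_comps E W) (facepoly E W) (gamma_poly E W)" "coeff_nonneg (gamma_poly E W)"
  using assms gamma_polyI by (auto simp: has_nonneg_gamma_def)

lemma gamma_poly_local:
  assumes "E \<inter> W \<times> W = E' \<inter> W \<times> W"
  shows "gamma_poly E W = gamma_poly E' W" "has_nonneg_gamma E W = has_nonneg_gamma E' W"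
  using num_comps_local[OF assms] facepoly_local[OF assms] by (simp_all add: gamma_poly_def has_nonneg_gamma_def)

text \<open>A new tube splits into two components and its contraction is connected, so the summands of
  \<open>facepoly_add_edge\<close> are face polynomials of dimension \<open>card W - 3\<close>, two less than
  the whole polytope; \<open>gamma_expansion_tau\<close> makes up for the difference.\<close>

lemma has_nonneg_gamma_add_edge:
  assumes "sym E" "finite W" "conn E W" "has_nonneg_gamma E W"
    and small: "\<And>E' U :: 'v set. sym (E' :: 'v rel) \<Longrightarrow> U \<subset> W \<Longrightarrow> has_nonneg_gamma E' U"
  shows "has_nonneg_gamma (add_edge u v E) W \<and> gamma_poly (add_edge u v E) W = gamma_poly E W +
    pCons 0 (\<Sum>S\<in>new_tubes E (add_edge u v E) W. gamma_poly E S * gamma_poly (contract E S) (W - S))"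
proof (rule has_nonneg_gammaI)
  let ?E = "add_edge u v E" and ?N = "new_tubes E (add_edge u v E) W"
  have conn': "conn ?E W" by (rule conn_mono[OF assms(3)]) (auto simp: add_edge_def)
  have gx: "gamma_expansion (card W - 3) (\<lambda>x. facepoly E S x * facepoly (contract E S) (W - S) x)
      (gamma_poly E S * gamma_poly (contract E S) (W - S))" "card W \<ge> 3"
    and coeff_nonneg: "coeff_nonneg (gamma_poly E S * gamma_poly (contract E S) (W - S))" if S: "S \<in> ?N" for S
  proof -
    note S' = new_tube_mem[OF S]
    have "S \<noteq> W" using S' assms(3) by auto
    then have sub: "S \<subset> W" "W - S \<subset> W" using S' by auto
    have fin: "finite S" "finite (W - S)" using sub assms(2) finite_subset by auto
    have num_comps: "num_comps E S = 2" "num_comps (contract E S) (W - S) = 1"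
      using num_comps_new_tube[OF assms(1) fin(1) S'(4,5)]
        num_comps_conn[OF conn_contract[OF assms(1) conn' S'(1-3) \<open>S \<noteq> W\<close>]] by auto
    have c: "card S \<ge> 2" "card (W - S) \<ge> 1" "card W = card S + card (W - S)"
      using num_comps_le_card[OF fin(1), of E] num_comps_le_card[OF fin(2), of "contract E S"] num_comps
        card_Diff_subset[OF fin(1) S'(3)] card_mono[OF assms(2) S'(3)] by auto
    have g: "has_nonneg_gamma E S" "has_nonneg_gamma (contract E S) (W - S)" using small sub assms(1) by auto
    show "gamma_expansion (card W - 3) (\<lambda>x. facepoly E S x * facepoly (contract E S) (W - S) x)
      (gamma_poly E S * gamma_poly (contract E S) (W - S))"
      using gamma_expansion_mult[OF has_nonneg_gammaD(1)[OF g(1)] has_nonneg_gammaD(1)[OF g(2)]] num_comps c by simp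
    show "coeff_nonneg (gamma_poly E S * gamma_poly (contract E S) (W - S))"
      using coeff_nonneg_mult has_nonneg_gammaD(2) g by blast
    show "card W \<ge> 3" using c by simp
  qed
  let ?s = "\<Sum>S\<in>?N. gamma_poly E S * gamma_poly (contract E S) (W - S)"
  have "gamma_expansion (card W - 1) (\<lambda>x. (1 + x) * (\<Sum>S\<in>?N. facepoly E S x * facepoly (contract E S) (W - S) x))
      (pCons 0 ?s)"
  proof (cases "?N = {}")
    case False
    then obtain S where "S \<in> ?N" by auto
    from gx(2)[OF this] have "card W - 3 + 2 = card W - 1" by simp
    then show ?thesis using gamma_expansion_tau[OF gamma_expansion_sum[where I = ?N, OF gx(1)]] by (simp only:)
  qed (simp add: gamma_expansion_zero)
  from gamma_expansion_add[OF _ this] has_nonneg_gammaD(1)[OF assms(4)] num_comps_conn[OF assms(3)]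
  have "gamma_expansion (card W - 1) (\<lambda>x. facepoly E W x +
      (1 + x) * (\<Sum>S\<in>?N. facepoly E S x * facepoly (contract E S) (W - S) x)) (gamma_poly E W + pCons 0 ?s)"
    by simp
  then show "gamma_expansion (card W - num_comps ?E W) (facepoly ?E W) (gamma_poly E W + pCons 0 ?s)"
    unfolding num_comps_conn[OF conn'] by (rule gamma_expansion_cong) (rule facepoly_add_edge[OF assms(1,2)])
  show "coeff_nonneg (gamma_poly E W + pCons 0 ?s)"
    by (intro coeff_nonneg_add coeff_nonneg_pCons coeff_nonneg_sum has_nonneg_gammaD(2) assms coeff_nonneg)
qed

lemma has_nonneg_gamma_mono:
  assumes "sym E" "sym E'" "finite W" "conn E W" "has_nonneg_gamma E W" "E \<inter> W \<times> W \<subseteq> E'"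
    and small: "\<And>E' U :: 'v set. sym (E' :: 'v rel) \<Longrightarrow> U \<subset> W \<Longrightarrow> has_nonneg_gamma E' U"
  shows "has_nonneg_gamma E' W \<and> coeff_le (gamma_poly E W) (gamma_poly E' W)"
  using assms(1,4,5,6)
proof (induct "card (E' \<inter> W \<times> W - E)" arbitrary: E rule: less_induct)
  case less
  show ?case
  proof (cases "E' \<inter> W \<times> W \<subseteq> E")
    case True
    then have "E \<inter> W \<times> W = E' \<inter> W \<times> W" using less by auto
    then show ?thesis using gamma_poly_local[of E W E'] less by simp
  next
    case False
    then obtain u v where uv: "(u, v) \<in> E'" "u \<in> W" "v \<in> W" "(u, v) \<notin> E" by auto
    then have vu: "(v, u) \<in> E'" using symD[OF assms(2)] by auto
    let ?E = "add_edge u v E"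
    note step = has_nonneg_gamma_add_edge[OF less(2) assms(3) less(3,4) small, where u = u and v = v]
    have "coeff_nonneg (\<Sum>S\<in>new_tubes E ?E W. gamma_poly E S * gamma_poly (contract E S) (W - S))"
    proof (intro coeff_nonneg_sum coeff_nonneg_mult has_nonneg_gammaD(2) small less(2) sym_contract)
      fix S assume "S \<in> new_tubes E ?E W"
      then show "S \<subset> W" "W - S \<subset> W" using new_tube_mem[of S E u v W] less(3) by auto
    qed
    then have 1: "coeff_le (gamma_poly E W) (gamma_poly ?E W)"
      using step by (simp add: coeff_le_add_nonneg coeff_nonneg_pCons)
    have "has_nonneg_gamma E' W \<and> coeff_le (gamma_poly ?E W) (gamma_poly E' W)"
    proof (rule less(1))
      show "card (E' \<inter> W \<times> W - ?E) < card (E' \<inter> W \<times> W - E)"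
        by (rule psubset_card_mono) (use uv assms(3) in \<open>auto simp: add_edge_def\<close>)
      show "conn ?E W" by (rule conn_mono[OF less(3)]) (auto simp: add_edge_def)
      show "has_nonneg_gamma ?E W" using step by simp
      show "?E \<inter> W \<times> W \<subseteq> E'" using less(5) uv vu by (auto simp: add_edge_def)
    qed (use less in simp)
    then show ?thesis using 1 coeff_le_trans by blast
  qed
qed

lemma facepoly_singleton: "sym E \<Longrightarrow> facepoly E {a} x = 1" if "0 < x"
  using facepoly_recursion[of E "{a}" x] num_comps_conn[OF conn_singleton[of E a]] that
  by (simp add: Pow_insert algebra_simps)

lemma new_tubes_leaf:
  assumes "sym E" "l \<notin> V" "v \<in> V" and iso: "\<And>a. a \<in> V \<Longrightarrow> (l, a) \<notin> E"
  shows "new_tubes E (add_edge l v E) (insert l V) = insert l ` {A. v \<in> A \<and> A \<subseteq> V \<and> conn E A}"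
proof (intro set_eqI iffI)
  let ?E = "add_edge l v E"
  have iso': "(a, l) \<notin> E" if "a \<in> V" for a using iso[OF that] symD[OF assms(1)] by blast
  {
    fix S assume S: "S \<in> new_tubes E ?E (insert l V)"
    note S' = new_tube_mem[OF S]
    have "conn E (S - {l})"
    proof (rule connI_crossing)
      fix T assume T: "T \<subseteq> S - {l}" "T \<noteq> {}" "T \<noteq> S - {l}"
      show "E \<inter> T \<times> (S - {l} - T) \<noteq> {}"
      proof (cases "v \<in> T")
        case True
        obtain a b where ab: "a \<in> insert l T" "b \<in> S - insert l T" "(a, b) \<in> ?E"
          by (rule conn_crossing[OF S'(4), of "insert l T"]) (use T S' in auto)
        then have "(a, b) \<in> E" using True by (auto simp: add_edge_def)
        moreover have "a \<noteq> l" using calculation iso[of b] ab S'(3) by auto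
        ultimately show ?thesis using ab by auto
      next
        case False
        obtain a b where ab: "a \<in> T" "b \<in> S - T" "(a, b) \<in> ?E"
          by (rule conn_crossing[OF S'(4), of "T"]) (use T S' in auto)
        then have "(a, b) \<in> E" using False T by (auto simp: add_edge_def)
        moreover have "b \<noteq> l" using calculation iso'[of a] ab T S'(3) by auto
        ultimately show ?thesis using ab by auto
      qed
    qed (use S' assms in auto)
    then have "S = insert l (S - {l}) \<and> v \<in> S - {l} \<and> S - {l} \<subseteq> V \<and> conn E (S - {l})"
      using S' assms by auto
    then show "S \<in> insert l ` {A. v \<in> A \<and> A \<subseteq> V \<and> conn E A}" by blast
  next
    fix S assume "S \<in> insert l ` {A. v \<in> A \<and> A \<subseteq> V \<and> conn E A}"
    then obtain A where A: "S = insert l A" "v \<in> A" "A \<subseteq> V" "conn E A" by auto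
    have "conn ?E A" by (rule conn_mono[OF A(4)]) (auto simp: add_edge_def)
    then have "conn ?E S"
      using conn_insert[OF sym_add_edge[OF assms(1)] _ A(2), of l v l] A(1)
      by (simp add: add_edge_def)
    moreover have "\<not> conn E S"
    proof
      assume "conn E S"
      then obtain b where "b \<in> S - {l}" "(l, b) \<in> E"
        using conn_crossing[of E S "{l}"] A assms(2) by blast
      then show False using iso A by auto
    qed
    ultimately show "S \<in> new_tubes E ?E (insert l V)" using A by (auto simp: new_tubes_def)
  }
qed

text \<open>Attaching a leaf is the case of \<open>facepoly_add_edge\<close> in which one end of the new edge is isolated. The
  new tube \<open>insert l V\<close> contributes \<open>(1 + x) * f V\<close>, which together with the old value \<open>f V\<close> gives
  \<open>(x + 2) * f V\<close>: the prism over the old polytope.\<close>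

lemma has_nonneg_gamma_leaf:
  assumes "sym E" "finite V" "conn E V" "v \<in> V" "l \<notin> V"
    and iso: "\<And>a. a \<in> V \<Longrightarrow> (l, a) \<notin> E"
    and small: "\<And>E' U :: 'v set. sym (E' :: 'v rel) \<Longrightarrow> U \<subseteq> V \<Longrightarrow> has_nonneg_gamma E' U"
  shows "has_nonneg_gamma (add_edge l v E) (insert l V) \<and> gamma_poly (add_edge l v E) (insert l V) = gamma_poly E V +
    pCons 0 (\<Sum>A | v \<in> A \<and> A \<subset> V \<and> conn E A. gamma_poly E A * gamma_poly (contract E A) (V - A))"
proof (rule has_nonneg_gammaI)
  let ?E = "add_edge l v E" and ?N = "{A. v \<in> A \<and> A \<subset> V \<and> conn E A}"
  let ?s = "\<Sum>A\<in>?N. gamma_poly E A * gamma_poly (contract E A) (V - A)"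
  have conn': "conn ?E (insert l V)"
  proof (rule conn_insert)
    show "conn ?E V" by (rule conn_mono[OF assms(3)]) (auto simp: add_edge_def)
    show "(v, l) \<in> ?E" by (simp add: add_edge_def)
  qed (use assms in auto)
  have finN: "finite ?N" by (rule finite_subset[of _ "Pow V"]) (use assms(2) in auto)
  have face_leaf: "facepoly E (insert l A) x = facepoly E A x" if "A \<subseteq> V" "0 < x" for A x
  proof -
    have "facepoly E ({l} \<union> A) x = facepoly E {l} x * facepoly E A x"
      by (rule facepoly_split) (use that assms finite_subset in auto)
    then show ?thesis by (simp add: facepoly_singleton[OF that(2) assms(1)])
  qed
  have contr_leaf: "facepoly (contract E (insert l A)) (V - A) = facepoly (contract E A) (V - A)" for A
    by (rule facepoly_local) (use iso in \<open>auto simp: contract_def\<close>)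
  have face: "facepoly ?E (insert l V) x = (x + 2) * facepoly E V x +
      (1 + x) * (\<Sum>A\<in>?N. facepoly E A x * facepoly (contract E A) (V - A) x)" if "0 < x" for x
  proof -
    have eq: "{A. v \<in> A \<and> A \<subseteq> V \<and> conn E A} = insert V ?N" using assms(3,4) by auto
    have N: "new_tubes E ?E (insert l V) = insert l ` insert V ?N"
      using new_tubes_leaf[OF assms(1,5,4)] iso eq by simp
    have inj: "inj_on (insert l) (insert V ?N)" using assms(5) by (auto simp: inj_on_def)
    have "(\<Sum>S\<in>new_tubes E ?E (insert l V). facepoly E S x * facepoly (contract E S) (insert l V - S) x) =
      (\<Sum>A\<in>insert V ?N. facepoly E (insert l A) x * facepoly (contract E (insert l A)) (insert l V - insert l A) x)"
      unfolding N sum.reindex[OF inj] comp_def ..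
    also have "\<dots> = (\<Sum>A\<in>insert V ?N. facepoly E A x * facepoly (contract E A) (V - A) x)"
    proof (rule sum.cong[OF refl])
      fix A assume "A \<in> insert V ?N"
      then have "A \<subseteq> V" "insert l V - insert l A = V - A" using assms(5) by auto
      then show "facepoly E (insert l A) x * facepoly (contract E (insert l A)) (insert l V - insert l A) x =
          facepoly E A x * facepoly (contract E A) (V - A) x"
        by (simp add: face_leaf that contr_leaf)
    qed
    also have "\<dots> = facepoly E V x + (\<Sum>A\<in>?N. facepoly E A x * facepoly (contract E A) (V - A) x)"
      using finN by (subst sum.insert) auto
    finally show ?thesis
      using facepoly_add_edge[OF assms(1) _ that, of "insert l V" l v] assms(2)
      by (simp add: face_leaf that algebra_simps)
  qed
  have gx: "gamma_expansion (card V - 2) (\<lambda>x. facepoly E A x * facepoly (contract E A) (V - A) x)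
      (gamma_poly E A * gamma_poly (contract E A) (V - A))" "card V \<ge> 2"
    and coeff_nonneg: "coeff_nonneg (gamma_poly E A * gamma_poly (contract E A) (V - A))" if A: "A \<in> ?N" for A
  proof -
    have fin: "finite A" "finite (V - A)" using A assms(2) finite_subset by auto
    have "conn (contract E A) (V - A)"
      using conn_contract[of E v v V A] A assms(1,3) conn_mono[of E V "add_edge v v E"]
      by (auto simp: add_edge_def)
    then have num_comps: "num_comps E A = 1" "num_comps (contract E A) (V - A) = 1" using A by (simp_all only: num_comps_conn mem_Collect_eq)
    have c: "card A \<ge> 1" "card (V - A) \<ge> 1" "card V = card A + card (V - A)"
      using num_comps_le_card[OF fin(1), of E] num_comps_le_card[OF fin(2), of "contract E A"] num_comps
        card_Diff_subset[OF fin(1), of V] card_mono[OF assms(2), of A] A by auto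
    have g: "has_nonneg_gamma E A" "has_nonneg_gamma (contract E A) (V - A)" using small A assms(1) by auto
    show "gamma_expansion (card V - 2) (\<lambda>x. facepoly E A x * facepoly (contract E A) (V - A) x)
      (gamma_poly E A * gamma_poly (contract E A) (V - A))"
      using gamma_expansion_mult[OF has_nonneg_gammaD(1)[OF g(1)] has_nonneg_gammaD(1)[OF g(2)]] num_comps c by (simp add: numeral_2_eq_2)
    show "coeff_nonneg (gamma_poly E A * gamma_poly (contract E A) (V - A))"
      using coeff_nonneg_mult has_nonneg_gammaD(2) g by blast
    show "card V \<ge> 2" using c by simp
  qed
  have "gamma_expansion (card V) (\<lambda>x. (1 + x) * (\<Sum>A\<in>?N. facepoly E A x * facepoly (contract E A) (V - A) x))
      (pCons 0 ?s)"
  proof (cases "?N = {}")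
    case False
    then obtain A where "A \<in> ?N" by auto
    from gx(2)[OF this] have "card V - 2 + 2 = card V" by simp
    then show ?thesis using gamma_expansion_tau[OF gamma_expansion_sum[where I = ?N, OF gx(1)]] by (simp only:)
  next
    case True
    then show ?thesis by (simp only: True) (simp add: gamma_expansion_zero)
  qed
  moreover have "gamma_expansion (card V) (\<lambda>x. (x + 2) * facepoly E V x) (gamma_poly E V)"
  proof -
    have "Suc (card V - num_comps E V) = card V"
      using num_comps_conn[OF assms(3)] num_comps_le_card[OF assms(2), of E] by simp
    then show ?thesis
      using gamma_expansion_interval[OF has_nonneg_gammaD(1)[OF small[OF assms(1), of V]]] by simp
  qed
  ultimately have "gamma_expansion (card V) (facepoly ?E (insert l V)) (gamma_poly E V + pCons 0 ?s)"
    by (auto intro: gamma_expansion_cong[OF gamma_expansion_add] simp: face)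
  then show "gamma_expansion (card (insert l V) - num_comps ?E (insert l V)) (facepoly ?E (insert l V))
      (gamma_poly E V + pCons 0 ?s)"
    using assms(2,5) num_comps_conn[OF conn'] by simp
  show "coeff_nonneg (gamma_poly E V + pCons 0 ?s)"
    by (intro coeff_nonneg_add coeff_nonneg_pCons coeff_nonneg_sum has_nonneg_gammaD(2) small assms coeff_nonneg) auto
qed

text \<open>Disconnected graphs are products. A connected graph with at least two vertices has a vertex \<open>l\<close> that
  is not a cut vertex; it is rebuilt by attaching \<open>l\<close> as a leaf to the rest and then adding the
  remaining edges at \<open>l\<close> one at a time.\<close>

theorem has_nonneg_gamma:
  fixes E :: "'v rel"
  assumes "finite W" "sym E"
  shows "has_nonneg_gamma E W"
  using assms
proof (induct W arbitrary: E rule: finite_psubset_induct)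
  case (psubset W)
  show ?case
  proof (cases "conn E W")
    case False
    show ?thesis
    proof (cases "W = {}")
      case True
      then have "facepoly E W = (\<lambda>x. 1)" by auto
      then show ?thesis using has_nonneg_gammaI[of W E 1] gamma_expansion_one coeff_nonneg_one True by simp
    next
      case nonempty: False
      then obtain a where a: "a \<in> W" by auto
      define C where "C = rtrancl_on W E `` {a}"
      have C: "conn E C" "C \<in> comps E W"
        using conn_class[OF psubset(3) a] a by (auto simp: C_def comps_def quotient_def)
      then have sub: "C \<subset> W" "W - C \<subset> W" "C \<union> (W - C) = W"
        using comps_sub[OF C(2)] False comps_nonempty[OF C(2)] by auto
      have no: "E \<inter> C \<times> (W - C) = {}" using comps_closed[OF psubset(3) C(2)] by blast
      have fin: "finite C" "finite (W - C)" using sub psubset(1) finite_subset by auto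
      have "has_nonneg_gamma E C" "has_nonneg_gamma E (W - C)" using psubset sub by auto
      then have g: "gamma_expansion ((card C - num_comps E C) + (card (W - C) - num_comps E (W - C)))
          (\<lambda>x. facepoly E C x * facepoly E (W - C) x) (gamma_poly E C * gamma_poly E (W - C))"
        "coeff_nonneg (gamma_poly E C * gamma_poly E (W - C))"
        by (auto intro: gamma_expansion_mult coeff_nonneg_mult has_nonneg_gammaD)
      have "num_comps E W = num_comps E C + num_comps E (W - C)"
        using num_comps_split[OF psubset(3) _ no fin] sub by simp
      moreover have "card W = card C + card (W - C)"
        using card_Un_disjoint[OF fin] sub by auto
      ultimately have "(card C - num_comps E C) + (card (W - C) - num_comps E (W - C)) = card W - num_comps E W"
        using num_comps_le_card[OF fin(1), of E] num_comps_le_card[OF fin(2), of E] by simp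
      moreover have "facepoly E W x = facepoly E C x * facepoly E (W - C) x" if "x > 0" for x
        using facepoly_split[OF psubset(3) fin _ no that] sub by simp
      ultimately have "gamma_expansion (card W - num_comps E W) (facepoly E W) (gamma_poly E C * gamma_poly E (W - C))"
        using g(1) by (auto intro: gamma_expansion_cong)
      then show ?thesis using has_nonneg_gammaI g(2) by blast
    qed
  next
    case True
    show ?thesis
    proof (cases "card W \<ge> 2")
      case False
      then have "card W = 1"
        using conn_nonempty[OF True] psubset(1) by (cases "card W") auto
      then obtain a where a: "W = {a}" by (auto simp: card_1_singleton_iff)
      then have "gamma_expansion (card W - num_comps E W) (facepoly E W) 1"
        using num_comps_conn[OF True] facepoly_singleton[OF _ psubset(3)]
        by (auto intro: gamma_expansion_cong[OF gamma_expansion_one])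
      then show ?thesis using has_nonneg_gammaI coeff_nonneg_one by blast
    next
      case card: True
      obtain l v where lv: "l \<in> W" "v \<in> W - {l}" "(v, l) \<in> E" "conn E (W - {l})"
        by (rule conn_remove_vertex[OF psubset(3,1) True card])
      define E0 where "E0 = {(a, b) \<in> E. a \<noteq> l \<and> b \<noteq> l}"
      have symE0: "sym E0" using psubset(3) by (auto simp: E0_def sym_def)
      have conn0: "conn E0 (W - {l})" by (rule conn_mono[OF lv(4)]) (auto simp: E0_def)
      have W: "insert l (W - {l}) = W" using lv by auto
      have "has_nonneg_gamma (add_edge l v E0) (insert l (W - {l}))"
        by (rule conjunct1[OF has_nonneg_gamma_leaf[OF symE0 _ conn0 lv(2)]])
          (use psubset lv in \<open>auto simp: E0_def\<close>)
      then have g: "has_nonneg_gamma (add_edge l v E0) W" by (simp only: W)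
      have "conn (add_edge l v E0) (W - {l})"
        by (rule conn_mono[OF conn0]) (auto simp: add_edge_def)
      then have "conn (add_edge l v E0) (insert l (W - {l}))"
        using conn_insert[OF sym_add_edge[OF symE0, of l v] _ lv(2), of l] by (simp add: add_edge_def)
      then have c: "conn (add_edge l v E0) W" by (simp only: W)
      show ?thesis
        by (rule conjunct1[OF has_nonneg_gamma_mono[OF _ psubset(3,1) c g]])
          (use symE0 psubset lv symD[OF psubset(3)] in \<open>auto simp: add_edge_def E0_def sym_def\<close>)
    qed
  qed
qed

lemma gamma_expansion_gamma_poly:
    "finite W \<Longrightarrow> sym E \<Longrightarrow> gamma_expansion (card W - num_comps E W) (facepoly E W) (gamma_poly E W)"
  and gamma_poly_nonneg: "finite W \<Longrightarrow> sym E \<Longrightarrow> coeff_nonneg (gamma_poly E W)"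
  using has_nonneg_gamma has_nonneg_gammaD by blast+

theorem gamma_poly_mono:
  assumes "finite W" "sym E" "sym E'" "conn E W" "E \<inter> W \<times> W \<subseteq> E'"
  shows "coeff_le (gamma_poly E W) (gamma_poly E' W)"
  by (rule conjunct2[OF has_nonneg_gamma_mono]) (use assms finite_subset in \<open>auto intro!: has_nonneg_gamma\<close>)

lemma conn_contract_tube:
  assumes "sym E" "conn E W" "S \<noteq> {}" "S \<subset> W"
  shows "conn (contract E S) (W - S)"
proof -
  obtain v where "v \<in> S" using assms(3) by auto
  then show ?thesis
    using conn_contract[OF assms(1) _ _ _ _, of v v W S] assms(4) conn_mono[OF assms(2), of "add_edge v v E"]
    by (auto simp: add_edge_def)
qed

theorem gamma_poly_leaf:
  assumes "finite V" "sym E" "conn E V" "v \<in> V" "l \<notin> V"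
    and nb: "\<And>a. a \<in> insert l V \<Longrightarrow> (l, a) \<in> E \<longleftrightarrow> a = v"
  shows "gamma_poly E (insert l V) = gamma_poly E V +
    pCons 0 (\<Sum>A | v \<in> A \<and> A \<subset> V \<and> conn E A. gamma_poly E A * gamma_poly (contract E A) (V - A))"
proof -
  define E0 where "E0 = {(a, b) \<in> E. a \<noteq> l \<and> b \<noteq> l}"
  have sym0: "sym E0" using assms(2) by (auto simp: E0_def sym_def)
  have loc: "E0 \<inter> A \<times> A = E \<inter> A \<times> A" if "A \<subseteq> V" for A
    using that assms(5) by (auto simp: E0_def)
  have nb': "(a, l) \<in> E \<longleftrightarrow> a = v" if "a \<in> insert l V" for a
    using nb[OF that] symD[OF assms(2)] by blast
  have loc_contr: "contract E0 A \<inter> (V - A) \<times> (V - A) = contract E A \<inter> (V - A) \<times> (V - A)"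
    if "A \<subseteq> V" for A
    using that assms(5) by (auto simp: E0_def contract_def)
  have "gamma_poly (add_edge l v E0) (insert l V) = gamma_poly E0 V +
      pCons 0 (\<Sum>A | v \<in> A \<and> A \<subset> V \<and> conn E0 A. gamma_poly E0 A * gamma_poly (contract E0 A) (V - A))"
    by (rule conjunct2[OF has_nonneg_gamma_leaf])
      (use assms finite_subset sym0 conn_local[OF loc] in \<open>auto intro!: has_nonneg_gamma simp: E0_def\<close>)
  moreover have "gamma_poly (add_edge l v E0) (insert l V) = gamma_poly E (insert l V)"
  proof (rule gamma_poly_local)
    have "(a, b) \<in> add_edge l v E0 \<longleftrightarrow> (a, b) \<in> E" if "a \<in> insert l V" "b \<in> insert l V" for a b
      using nb[OF that(2)] nb'[OF that(1)] that assms(4,5)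
      by (cases "a = l"; cases "b = l") (auto simp: add_edge_def E0_def)
    then show "add_edge l v E0 \<inter> insert l V \<times> insert l V = E \<inter> insert l V \<times> insert l V" by auto
  qed
  moreover have "{A. v \<in> A \<and> A \<subset> V \<and> conn E0 A} = {A. v \<in> A \<and> A \<subset> V \<and> conn E A}"
    using conn_local[OF loc] by auto
  moreover have "gamma_poly E0 V = gamma_poly E V" by (rule gamma_poly_local(1)[OF loc]) simp
  moreover have "(\<Sum>A | v \<in> A \<and> A \<subset> V \<and> conn E A. gamma_poly E0 A * gamma_poly (contract E0 A) (V - A)) =
      (\<Sum>A | v \<in> A \<and> A \<subset> V \<and> conn E A. gamma_poly E A * gamma_poly (contract E A) (V - A))"
    by (intro sum.cong refl arg_cong2[of _ _ _ _ "(*)"] gamma_poly_local(1) loc loc_contr) auto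
  ultimately show ?thesis by simp
qed

lemma gamma_poly_singleton [simp]: "sym E \<Longrightarrow> gamma_poly E {a} = 1"
  by (rule gamma_polyI) (auto simp: num_comps_conn facepoly_singleton intro: gamma_expansion_cong[OF gamma_expansion_one])

lemma gamma_poly_image:
  assumes "finite W" "sym E" "sym E'" "inj_on p W"
    and iso: "\<And>a b. a \<in> W \<Longrightarrow> b \<in> W \<Longrightarrow> (a, b) \<in> E \<longleftrightarrow> (p a, p b) \<in> E'"
  shows "gamma_poly E' (p ` W) = gamma_poly E W"
proof (rule gamma_polyI)
  show "gamma_expansion (card (p ` W) - num_comps E' (p ` W)) (facepoly E' (p ` W)) (gamma_poly E W)"
    using gamma_expansion_gamma_poly[OF assms(1,2)] facepoly_image[OF assms(2,3,1) _ assms(4) iso]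
    by (simp add: card_image assms(4) num_comps_image[OF assms(4) iso] gamma_expansion_cong)
qed


lemma gamma_poly_hom:
  assumes "finite W" "sym E" "sym E'" "inj_on p W" "conn E W"
    and hom: "\<And>a b. a \<in> W \<Longrightarrow> b \<in> W \<Longrightarrow> (a, b) \<in> E \<Longrightarrow> (p a, p b) \<in> E'"
  shows "conn E' (p ` W)" "coeff_le (gamma_poly E W) (gamma_poly E' (p ` W))"
proof -
  define E1 where "E1 = {(p a, p b) | a b. a \<in> W \<and> b \<in> W \<and> (a, b) \<in> E}"
  have sym1: "sym E1" using assms(2) unfolding E1_def sym_def by blast
  have iso: "(a, b) \<in> E \<longleftrightarrow> (p a, p b) \<in> E1" if "a \<in> W" "b \<in> W" for a b
    using that inj_onD[OF assms(4)] unfolding E1_def by blast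
  obtain a where a: "a \<in> W" using conn_nonempty[OF assms(5)] by auto
  have "rtrancl_on W E `` {a} = W"
    using conn_reach[OF assms(5) a] reach_sub[of W E] by auto
  then have conn1: "conn E1 (p ` W)"
    using reach_image[OF assms(4) iso a] a by (intro connI_center[OF sym1, of "p a"]) auto
  have sub: "E1 \<inter> p ` W \<times> p ` W \<subseteq> E'" using hom by (auto simp: E1_def)
  show "conn E' (p ` W)" by (rule conn_mono[OF conn1 sub])
  have "gamma_poly E1 (p ` W) = gamma_poly E W" by (rule gamma_poly_image[OF assms(1,2) sym1 assms(4) iso])
  moreover have "coeff_le (gamma_poly E1 (p ` W)) (gamma_poly E' (p ` W))"
    by (rule gamma_poly_mono) (use assms sym1 conn1 sub in auto)
  ultimately show "coeff_le (gamma_poly E W) (gamma_poly E' (p ` W))" by simp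
qed

section \<open>Extremal graphs\<close>

definition path_rel :: "nat rel" where
  "path_rel = {(i, j). j = Suc i \<or> i = Suc j}"

definition star_rel :: "'v \<Rightarrow> 'v rel" where
  "star_rel c = {(i, j). i \<noteq> j \<and> (i = c \<or> j = c)}"

text \<open>Two neighbours of a vertex that are joined by a path avoiding the vertex would close a cycle through
  it. This form of acyclicity passes to subsets directly and shows at once that a vertex
  which is not a cut vertex is a leaf.\<close>

definition acyclic_on :: "'v rel \<Rightarrow> 'v set \<Rightarrow> bool" where
  "acyclic_on E V \<longleftrightarrow> (\<forall>l\<in>V. \<forall>a\<in>V - {l}. \<forall>b\<in>V - {l}.
     (l, a) \<in> E \<longrightarrow> (l, b) \<in> E \<longrightarrow> a \<noteq> b \<longrightarrow> (a, b) \<notin> rtrancl_on (V - {l}) E)"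

lemma path_rel_iff [simp]: "(i, j) \<in> path_rel \<longleftrightarrow> j = Suc i \<or> i = Suc j"
  and star_rel_iff [simp]: "(a, b) \<in> star_rel c \<longleftrightarrow> a \<noteq> b \<and> (a = c \<or> b = c)"
  by (simp_all add: path_rel_def star_rel_def)

lemma sym_path_rel [simp]: "sym path_rel"
  and sym_star_rel [simp]: "sym (star_rel c)"
  by (auto simp: sym_def)

lemma gamma_poly_le_complete:
  assumes "finite W" "sym E" "conn E W" "irrefl E"
  shows "coeff_le (gamma_poly E W) (gamma_poly (- Id) W)"
  by (rule gamma_poly_mono) (use assms in \<open>auto simp: irrefl_def sym_def\<close>)

subsection \<open>Paths\<close>

lemma conn_interval: "a \<le> b \<Longrightarrow> conn path_rel {a..b}"
proof (induct b rule: dec_induct)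
  case (step n)
  have "conn path_rel (insert (Suc n) {a..n})"
    by (rule conn_insert[OF sym_path_rel step(3), of n]) (use step in \<open>auto\<close>)
  then show ?case using step by (simp add: atLeastAtMostSuc_conv)
qed simp

text \<open>The connected subsets of a path through its end are the final segments, one for each size.\<close>

lemma conn_path_through_end:
  assumes "conn path_rel A" "A \<subseteq> {1..m}" "m \<in> A"
  shows "A = {Suc (m - card A)..m}"
proof -
  have closed: "Suc i \<in> A" if i: "i \<in> A" "i < m" for i
  proof (rule ccontr)
    assume no: "Suc i \<notin> A"
    have "m \<notin> {a \<in> A. a \<le> i}" using i by simp
    then have ne: "{a \<in> A. a \<le> i} \<noteq> A" using assms(3) by metis
    obtain x y where xy: "x \<in> {a \<in> A. a \<le> i}" "y \<in> A - {a \<in> A. a \<le> i}" "(x, y) \<in> path_rel"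
      by (rule conn_crossing[OF assms(1), of "{a \<in> A. a \<le> i}"]) (use i ne in auto)
    then have "x \<le> i" "y > i" by auto
    then have "y = Suc i" using xy(3) by (auto)
    then show False using no xy by simp
  qed
  have fin: "finite A" using assms finite_subset by blast
  have "A \<noteq> {}" using assms(3) by auto
  define c where "c = Min A"
  have c: "c \<in> A" "\<And>i. i \<in> A \<Longrightarrow> c \<le> i" using fin Min_in[OF fin \<open>A \<noteq> {}\<close>] by (auto simp: c_def)
  have "c + k \<in> A" if "c + k \<le> m" for k
    using that by (induct k) (use c closed in auto)
  then have "{c..m} \<subseteq> A" by (metis atLeastAtMost_iff le_Suc_ex subsetI)
  then have A: "A = {c..m}" using c assms by auto
  moreover have "c \<ge> 1" "c \<le> m" using c(1) assms(2) by auto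
  ultimately show ?thesis by auto
qed

lemma gamma_poly_path_shift: "gamma_poly path_rel {Suc k..k + m} = gamma_poly path_rel {1..m}"
proof -
  have "gamma_poly path_rel ((+) k ` {1..m}) = gamma_poly path_rel {1..m}"
    by (rule gamma_poly_image) (auto)
  then show ?thesis by (simp add: image_add_atLeastAtMost add.commute)
qed

lemma gamma_poly_path_Suc:
  assumes "m \<ge> 1"
  shows "gamma_poly path_rel {1..Suc m} = gamma_poly path_rel {1..m} +
    pCons 0 (\<Sum>k\<in>{1..<m}. gamma_poly path_rel {1..k} * gamma_poly path_rel {1..m - k})"
proof -
  let ?A = "\<lambda>k. {Suc (m - k)..m}"
  have eq: "{A. m \<in> A \<and> A \<subset> {1..m} \<and> conn path_rel A} = ?A ` {1..<m}"
  proof (intro set_eqI iffI)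
    fix A assume "A \<in> {A. m \<in> A \<and> A \<subset> {1..m} \<and> conn path_rel A}"
    then have A: "m \<in> A" "A \<subset> {1..m}" "conn path_rel A" by auto
    then have "card A \<noteq> 0" using finite_subset[of A "{1..m}"] by auto
    moreover have "card A < m" using psubset_card_mono[OF _ A(2)] by simp
    ultimately show "A \<in> ?A ` {1..<m}"
      using conn_path_through_end[of A m] A by (intro image_eqI[of _ _ "card A"]) auto
  next
    fix A assume "A \<in> ?A ` {1..<m}"
    then show "A \<in> {A. m \<in> A \<and> A \<subset> {1..m} \<and> conn path_rel A}"
      by (auto intro!: conn_interval)
  qed
  have inj: "inj_on ?A {1..<m}"
  proof (rule inj_onI)
    fix k k' assume "k \<in> {1..<m}" "k' \<in> {1..<m}" "?A k = ?A k'"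
    then show "k = k'" by (simp add: Icc_eq_Icc) arith
  qed
  have "gamma_poly path_rel (insert (Suc m) {1..m}) = gamma_poly path_rel {1..m} +
    pCons 0 (\<Sum>A | m \<in> A \<and> A \<subset> {1..m} \<and> conn path_rel A.
      gamma_poly path_rel A * gamma_poly (contract path_rel A) ({1..m} - A))"
    by (rule gamma_poly_leaf) (use assms conn_interval in \<open>auto simp del: One_nat_def\<close>)
  also have "(\<Sum>A | m \<in> A \<and> A \<subset> {1..m} \<and> conn path_rel A.
      gamma_poly path_rel A * gamma_poly (contract path_rel A) ({1..m} - A)) =
    (\<Sum>k\<in>{1..<m}. gamma_poly path_rel {1..k} * gamma_poly path_rel {1..m - k})"
    unfolding eq sum.reindex[OF inj] comp_def
  proof (rule sum.cong[OF refl])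
    fix k assume k: "k \<in> {1..<m}"
    have "gamma_poly path_rel (?A k) = gamma_poly path_rel {1..k}"
      using gamma_poly_path_shift[of "m - k" k] k by simp
    moreover have "{1..m} - ?A k = {1..m - k}" using k by auto
    moreover have "gamma_poly (contract path_rel (?A k)) {1..m - k} = gamma_poly path_rel {1..m - k}"
    proof (rule gamma_poly_local)
      have "path_rel `` ?A k \<inter> {1..m - k} \<subseteq> {m - k}" by (auto)
      then show "contract path_rel (?A k) \<inter> {1..m - k} \<times> {1..m - k} =
          path_rel \<inter> {1..m - k} \<times> {1..m - k}"
        unfolding contract_def by blast
    qed
    ultimately show "gamma_poly path_rel (?A k) * gamma_poly (contract path_rel (?A k)) ({1..m} - ?A k) =
        gamma_poly path_rel {1..k} * gamma_poly path_rel {1..m - k}" by simp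
  qed
  finally show ?thesis by (simp add: atLeastAtMostSuc_conv)
qed

text \<open>Delete all edges at a vertex that is not a cut vertex, except one, to turn it into a leaf. In the leaf
  formula choose one connected set through the neighbour for each size; by induction its two factors
  dominate the factors belonging to that size in the formula for the path.\<close>

theorem gamma_poly_path_le:
  fixes E :: "'v rel"
  assumes "finite V" "sym E" "conn E V"
  shows "coeff_le (gamma_poly path_rel {1..card V}) (gamma_poly E V)"
  using assms
proof (induct "card V" arbitrary: E V rule: less_induct)
  case less
  show ?case
  proof (cases "card V \<ge> 2")
    case False
    then have "card V = 1" using conn_nonempty[OF less(4)] less(2) by (cases "card V") auto
    then obtain a where "V = {a}" by (auto simp: card_1_singleton_iff)
    then show ?thesis using less(3) by simp
  next
    case True
    obtain l v where lv: "l \<in> V" "v \<in> V - {l}" "(v, l) \<in> E" "conn E (V - {l})"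
      by (rule conn_remove_vertex[OF less(3,2,4) True])
    define U where "U = V - {l}"
    define m where "m = card U"
    have U: "finite U" "conn E U" "v \<in> U" "l \<notin> U" "insert l U = V" "card V = Suc m"
      using lv less(2) card.remove[OF less(2) lv(1)] by (auto simp: U_def m_def)
    define F where "F = {(a, b) \<in> E. (a = l \<longrightarrow> b = v) \<and> (b = l \<longrightarrow> a = v)}"
    have symF: "sym F" using less(3) by (auto simp: F_def sym_def)
    have connF: "conn F U" by (rule conn_mono[OF U(2)]) (use U in \<open>auto simp: F_def\<close>)
    have lvF: "(v, l) \<in> F" "(l, v) \<in> F"
      using lv U symD[OF less(3)] by (auto simp: F_def)
    have connFV: "conn F V" using conn_insert[OF symF connF U(3) lvF(1)] U by simp
    have m: "m \<ge> 1" using True U by simp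
    let ?N = "{A. v \<in> A \<and> A \<subset> U \<and> conn F A}"
    let ?g = "\<lambda>A. gamma_poly F A * gamma_poly (contract F A) (U - A)"
    have finN: "finite ?N" by (rule finite_subset[of _ "Pow U"]) (use U in auto)
    have "\<exists>A. A \<in> ?N \<and> card A = k" if k: "k \<in> {1..<m}" for k
    proof -
      obtain A where "v \<in> A" "A \<subseteq> U" "conn F A" "card A = k"
        using conn_subset_card[OF symF U(1) connF U(3), of k] k by (auto simp: m_def)
      moreover have "A \<noteq> U" using \<open>card A = k\<close> k by (auto simp: m_def)
      ultimately show ?thesis by auto
    qed
    then have "\<forall>k\<in>{1..<m}. \<exists>A. A \<in> ?N \<and> card A = k" by blast
    from bchoice[OF this] obtain A where A: "\<And>k. k \<in> {1..<m} \<Longrightarrow> A k \<in> ?N \<and> card (A k) = k"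
      by blast
    have inj: "inj_on A {1..<m}" by (rule inj_on_inverseI[of _ card]) (use A in blast)
    have "coeff_le (\<Sum>k\<in>{1..<m}. gamma_poly path_rel {1..k} * gamma_poly path_rel {1..m - k}) (\<Sum>k\<in>{1..<m}. ?g (A k))"
    proof (rule coeff_le_sum)
      fix k assume k: "k \<in> {1..<m}"
      then have Ak: "v \<in> A k" "A k \<subset> U" "conn F (A k)" "card (A k) = k" using A by auto
      have fin: "finite (A k)" using Ak U finite_subset by auto
      have c: "card (U - A k) = m - k" using Ak fin by (simp add: card_Diff_subset m_def)
      have p2: "coeff_le (gamma_poly path_rel {1..k}) (gamma_poly F (A k))"
        using less(1)[of "A k" F] Ak k U fin symF by simp
      have conn: "conn (contract F (A k)) (U - A k)"
        by (rule conn_contract_tube[OF symF connF _ Ak(2)]) (use Ak in auto)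
      have p1: "coeff_le (gamma_poly path_rel {1..m - k}) (gamma_poly (contract F (A k)) (U - A k))"
        using less(1)[of "U - A k" "contract F (A k)"] conn c U(1,6) symF by simp
      show "coeff_le (gamma_poly path_rel {1..k} * gamma_poly path_rel {1..m - k}) (?g (A k))"
        by (rule coeff_le_mult[OF p2 p1]) (use fin symF in \<open>auto intro: gamma_poly_nonneg\<close>)
    qed
    moreover have "coeff_le (\<Sum>k\<in>{1..<m}. ?g (A k)) (\<Sum>A\<in>?N. ?g A)"
    proof -
      have "(\<Sum>k\<in>{1..<m}. ?g (A k)) = (\<Sum>A\<in>A ` {1..<m}. ?g A)"
        unfolding sum.reindex[OF inj] comp_def ..
      moreover have "coeff_le \<dots> (\<Sum>A\<in>?N. ?g A)"
      proof (rule coeff_le_sum_subset[OF finN])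
        show "A ` {1..<m} \<subseteq> ?N" using A by blast
        fix B assume "B \<in> ?N"
        then have "finite B" using U finite_subset by auto
        then show "coeff_nonneg (?g B)"
          using U symF by (intro coeff_nonneg_mult gamma_poly_nonneg) auto
      qed
      ultimately show ?thesis by simp
    qed
    moreover have "coeff_le (gamma_poly path_rel {1..m}) (gamma_poly F U)"
      using less(1)[of U F] U symF connF by (simp add: m_def)
    ultimately have "coeff_le (gamma_poly path_rel {1..Suc m}) (gamma_poly F U + pCons 0 (\<Sum>A\<in>?N. ?g A))"
      unfolding gamma_poly_path_Suc[OF m] by (intro coeff_le_add coeff_le_pCons) (auto intro: coeff_le_trans)
    also have "gamma_poly F U + pCons 0 (\<Sum>A\<in>?N. ?g A) = gamma_poly F V"
      unfolding U(5)[symmetric]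
      by (rule gamma_poly_leaf[symmetric]) (use U symF connF lvF in \<open>auto simp: F_def\<close>)
    also have "coeff_le (gamma_poly F V) (gamma_poly E V)"
      by (rule gamma_poly_mono[OF less(2) symF less(3) connFV]) (auto simp: F_def)
    finally show ?thesis using U by simp
  qed
qed

subsection \<open>Stars\<close>

lemma conn_star:
  assumes "c \<in> A" shows "conn (star_rel c) A"
proof (rule connI_center[OF sym_star_rel assms])
  fix b assume "b \<in> A"
  then show "(c, b) \<in> rtrancl_on A (star_rel c)"
    using assms by (cases "b = c") (auto intro: reach_edge)
qed

lemma gamma_poly_star_center:
  assumes "finite V" "c \<in> V" "v \<in> V"
  shows "gamma_poly (star_rel v) V = gamma_poly (star_rel c) V"
proof -
  have "Transposition.transpose c v ` V = V" using assms by (simp add: transpose_image_eq)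
  moreover have "gamma_poly (star_rel v) (Transposition.transpose c v ` V) = gamma_poly (star_rel c) V"
    by (rule gamma_poly_image[OF assms(1)])
      (auto simp: transpose_eq_iff)
  ultimately show ?thesis by simp
qed

lemma acyclic_on_subset: "acyclic_on E V \<Longrightarrow> A \<subseteq> V \<Longrightarrow> acyclic_on E A"
  unfolding acyclic_on_def using rtrancl_on_mono[OF subset_refl, of "A - {_}" "V - {_}"]
  by (meson Diff_mono in_mono subset_refl)

text \<open>The centre is arbitrary, so that the induction hypothesis can be used with the neighbour of the removed
  leaf as centre. Subtrees through the neighbour are bounded by the induction hypothesis, and
  contractions by the complete graph, which is what the star contracts to.\<close>

theorem gamma_poly_tree_le_star:
  fixes E :: "'v rel"
  assumes "finite V" "sym E" "irrefl E" "conn E V" "acyclic_on E V" "c \<in> V"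
  shows "coeff_le (gamma_poly E V) (gamma_poly (star_rel c) V)"
  using assms(1,4,5,6)
proof (induct "card V" arbitrary: V c rule: less_induct)
  case less
  show ?case
  proof (cases "card V \<ge> 2")
    case False
    then have "card V = 1" using conn_nonempty[OF less(3)] less(2) by (cases "card V") auto
    then obtain a where "V = {a}" by (auto simp: card_1_singleton_iff)
    then show ?thesis using assms(2) by simp
  next
    case True
    obtain l v where lv: "l \<in> V" "v \<in> V - {l}" "(v, l) \<in> E" "conn E (V - {l})"
      by (rule conn_remove_vertex[OF assms(2) less(2,3) True])
    define U where "U = V - {l}"
    have U: "finite U" "conn E U" "v \<in> U" "l \<notin> U" "insert l U = V" "U \<subset> V"
      using lv less(2) by (auto simp: U_def)
    have cU: "card U < card V" by (rule psubset_card_mono[OF less(2) U(6)])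
    have nb: "(l, a) \<in> E \<longleftrightarrow> a = v" if "a \<in> insert l U" for a
    proof
      assume "(l, a) \<in> E"
      moreover have "a \<noteq> l" using \<open>(l, a) \<in> E\<close> assms(3) by (auto simp: irrefl_def)
      moreover have "(l, v) \<in> E" using lv(3) symD[OF assms(2)] by blast
      moreover have "(a, v) \<in> rtrancl_on (V - {l}) E"
        using conn_reach[OF lv(4)] that \<open>a \<noteq> l\<close> lv(2) by (simp add: U_def)
      ultimately show "a = v"
        using less(4) lv(1,2) that unfolding acyclic_on_def U_def by blast
    qed (use lv symD[OF assms(2)] in auto)
    let ?S = "star_rel v"
    let ?N = "\<lambda>E. {A. v \<in> A \<and> A \<subset> U \<and> conn E A}"
    let ?g = "\<lambda>E A. gamma_poly E A * gamma_poly (contract E A) (U - A)"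
    have finN: "finite (?N E)" for E by (rule finite_subset[of _ "Pow U"]) (use U in auto)
    have sub: "?N E \<subseteq> ?N ?S" by (auto intro: conn_star)
    have "gamma_poly E V = gamma_poly E U + pCons 0 (\<Sum>A\<in>?N E. ?g E A)"
      unfolding U(5)[symmetric] by (rule gamma_poly_leaf) (use U assms(2) nb in auto)
    also have "coeff_le \<dots> (gamma_poly ?S U + pCons 0 (\<Sum>A\<in>?N ?S. ?g ?S A))"
    proof (intro coeff_le_add coeff_le_pCons)
      show "coeff_le (gamma_poly E U) (gamma_poly ?S U)"
        using less(1)[OF cU] U acyclic_on_subset[OF less(4)] by auto
      have "coeff_le (\<Sum>A\<in>?N E. ?g E A) (\<Sum>A\<in>?N E. ?g ?S A)"
      proof (intro coeff_le_sum)
        fix A assume "A \<in> ?N E"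
        then have A: "v \<in> A" "A \<subset> U" "conn E A" by auto
        have fin: "finite A" using A U finite_subset by auto
        have "card A < card U" by (rule psubset_card_mono[OF U(1) A(2)])
        then have "coeff_le (gamma_poly E A) (gamma_poly ?S A)"
          using less(1)[of A v] A cU fin acyclic_on_subset[OF less(4), of A] U by auto
        moreover have "coeff_le (gamma_poly (contract E A) (U - A)) (gamma_poly (contract ?S A) (U - A))"
        proof (rule gamma_poly_mono)
          show "conn (contract E A) (U - A)"
            using conn_contract_tube[OF assms(2) U(2) _ A(2)] A by auto
          show "contract E A \<inter> (U - A) \<times> (U - A) \<subseteq> contract ?S A"
          proof clarify
            fix a b assume "(a, b) \<in> contract E A" "a \<in> U" "a \<notin> A" "b \<in> U" "b \<notin> A"
            then have "a \<noteq> b" using assms(3) by (auto simp: contract_def irrefl_def)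
            moreover have "a \<in> ?S `` A" "b \<in> ?S `` A"
              using A \<open>a \<notin> A\<close> \<open>b \<notin> A\<close> by (auto)
            ultimately show "(a, b) \<in> contract ?S A" by (simp add: contract_def)
          qed
        qed (use U assms(2) in auto)
        ultimately show "coeff_le (?g E A) (?g ?S A)"
          by (rule coeff_le_mult) (use U fin assms(2) in \<open>auto intro: gamma_poly_nonneg\<close>)
      qed
      also have "coeff_le (\<Sum>A\<in>?N E. ?g ?S A) (\<Sum>A\<in>?N ?S. ?g ?S A)"
      proof (rule coeff_le_sum_subset[OF finN sub])
        fix A assume "A \<in> ?N ?S"
        then have "finite A" using U finite_subset by auto
        then show "coeff_nonneg (?g ?S A)" using U by (intro coeff_nonneg_mult gamma_poly_nonneg) auto
      qed
      finally show "coeff_le (\<Sum>A\<in>?N E. ?g E A) (\<Sum>A\<in>?N ?S. ?g ?S A)" .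
    qed
    also have "gamma_poly ?S U + pCons 0 (\<Sum>A\<in>?N ?S. ?g ?S A) = gamma_poly ?S V"
      unfolding U(5)[symmetric]
      by (rule gamma_poly_leaf[symmetric]) (use U in \<open>auto simp: conn_star\<close>)
    also have "gamma_poly ?S V = gamma_poly (star_rel c) V"
      by (rule gamma_poly_star_center) (use less lv in auto)
    finally show ?thesis .
  qed
qed

section \<open>Faces of Minkowski sums\<close>

definition top_face :: "'a::euclidean_space \<Rightarrow> 'a set \<Rightarrow> 'a set" where
  "top_face y X = {x \<in> X. \<forall>z\<in>X. y \<bullet> z \<le> y \<bullet> x}"

lemma top_face_summands:
  assumes "finite I" "\<And>i. i \<in> I \<Longrightarrow> s i \<in> X i"
  shows "sum s I \<in> top_face y (\<Sum>i\<in>I. X i) \<longleftrightarrow> (\<forall>i\<in>I. s i \<in> top_face y (X i))"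
proof
  assume top: "sum s I \<in> top_face y (\<Sum>i\<in>I. X i)"
  show "\<forall>i\<in>I. s i \<in> top_face y (X i)"
  proof
    fix i assume i: "i \<in> I"
    have "y \<bullet> z \<le> y \<bullet> s i" if "z \<in> X i" for z
    proof -
      have "sum (s(i := z)) I \<in> (\<Sum>i\<in>I. X i)"
        unfolding set_sum_alt[OF assms(1)] using that assms(2) by fastforce
      then have "y \<bullet> sum (s(i := z)) I \<le> y \<bullet> sum s I" using top by (simp add: top_face_def)
      moreover have "sum (s(i := z)) I = z + sum s (I - {i})"
        using assms(1) i by (simp add: sum.remove)
      moreover have "sum s I = s i + sum s (I - {i})" using assms(1) i by (simp add: sum.remove)
      ultimately show ?thesis by (simp add: inner_add_right)
    qed
    then show "s i \<in> top_face y (X i)" using assms(2)[OF i] by (simp add: top_face_def)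
  qed
next
  assume top: "\<forall>i\<in>I. s i \<in> top_face y (X i)"
  have "y \<bullet> z \<le> y \<bullet> sum s I" if z: "z \<in> (\<Sum>i\<in>I. X i)" for z
  proof -
    obtain s' where s': "z = sum s' I" "\<forall>i\<in>I. s' i \<in> X i"
      using z unfolding set_sum_alt[OF assms(1)] by auto
    then show ?thesis
      using top by (auto simp: inner_sum_right top_face_def intro!: sum_mono)
  qed
  moreover have "sum s I \<in> (\<Sum>i\<in>I. X i)"
    unfolding set_sum_alt[OF assms(1)] using assms(2) by auto
  ultimately show "sum s I \<in> top_face y (\<Sum>i\<in>I. X i)" by (simp add: top_face_def)
qed

lemma top_face_sum:
  assumes "finite I"
  shows "top_face y (\<Sum>i\<in>I. X i) = (\<Sum>i\<in>I. top_face y (X i))"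
proof (intro set_eqI iffI)
  fix x assume x: "x \<in> top_face y (\<Sum>i\<in>I. X i)"
  then have "x \<in> (\<Sum>i\<in>I. X i)" by (simp add: top_face_def)
  then obtain s where s: "x = sum s I" "\<forall>i\<in>I. s i \<in> X i"
    unfolding set_sum_alt[OF assms] by auto
  then have "\<forall>i\<in>I. s i \<in> top_face y (X i)" using top_face_summands[where s = s and X = X and y = y, OF assms] x by auto
  then show "x \<in> (\<Sum>i\<in>I. top_face y (X i))" unfolding set_sum_alt[OF assms] using s by auto
next
  fix x assume "x \<in> (\<Sum>i\<in>I. top_face y (X i))"
  then obtain s where s: "x = sum s I" "\<forall>i\<in>I. s i \<in> top_face y (X i)"
    unfolding set_sum_alt[OF assms] by auto
  then show "x \<in> top_face y (\<Sum>i\<in>I. X i)"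
    using top_face_summands[where s = s and X = X and y = y, OF assms] by (auto simp: top_face_def)
qed

text \<open>A face of a Minkowski sum determines the faces of the summands: in a point of
  the face, any one summand may be exchanged for another maximal point of its own set.\<close>

lemma top_face_sum_inject:
  assumes "finite I" "\<And>i. i \<in> I \<Longrightarrow> top_face y (X i) \<noteq> {}" "i \<in> I"
    "top_face y (\<Sum>i\<in>I. X i) \<subseteq> top_face y' (\<Sum>i\<in>I. X i)"
  shows "top_face y (X i) \<subseteq> top_face y' (X i)"
proof
  fix x assume x: "x \<in> top_face y (X i)"
  obtain s0 where s0: "\<forall>i\<in>I. s0 i \<in> top_face y (X i)"
    using bchoice[of I "\<lambda>i x. x \<in> top_face y (X i)"] assms(2) by blast
  define s where "s = s0(i := x)"
  have s: "s j \<in> top_face y (X j)" if "j \<in> I" for j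
    using s0 x that by (simp add: s_def)
  then have sX: "s j \<in> X j" if "j \<in> I" for j using that by (simp add: top_face_def)
  have "sum s I \<in> top_face y (\<Sum>i\<in>I. X i)" using top_face_summands[where s = s and X = X and y = y, OF assms(1) sX] s by auto
  then have "sum s I \<in> top_face y' (\<Sum>i\<in>I. X i)" using assms(4) by blast
  then have "s i \<in> top_face y' (X i)" using top_face_summands[where s = s and X = X and y = y', OF assms(1) sX] assms(3) by auto
  then show "x \<in> top_face y' (X i)" by (simp add: s_def)
qed

lemma top_face_face_of:
  assumes "convex X" shows "top_face y X face_of X"
proof (cases "top_face y X = {}")
  case False
  then obtain x where x: "x \<in> top_face y X" by auto
  have "top_face y X = X \<inter> {z. y \<bullet> z = y \<bullet> x}"
    using x by (force simp: top_face_def intro: antisym)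
  moreover have "X \<inter> {z. y \<bullet> z = y \<bullet> x} face_of X"
    by (rule face_of_Int_supporting_hyperplane_le[OF assms]) (use x in \<open>auto simp: top_face_def\<close>)
  ultimately show ?thesis by simp
qed simp

lemma nonempty_faces:
  assumes "polytope P" "\<And>y. top_face y P \<noteq> {}"
  shows "{F. F face_of P \<and> F \<noteq> {}} = range (\<lambda>y. top_face y P)"
proof (intro set_eqI iffI)
  fix F assume F: "F \<in> {F. F face_of P \<and> F \<noteq> {}}"
  then have "F exposed_face_of P"
    using exposed_face_of_polyhedron[OF polytope_imp_polyhedron[OF assms(1)]] by simp
  then obtain a b where ab: "P \<subseteq> {x. a \<bullet> x \<le> b}" "F = P \<inter> {x. a \<bullet> x = b}"
    by (auto simp: exposed_face_of_def)
  obtain x0 where x0: "x0 \<in> P" "a \<bullet> x0 = b" using F ab by auto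
  have "F = top_face a P"
  proof (intro set_eqI iffI)
    fix x assume "x \<in> F"
    then show "x \<in> top_face a P" using ab by (auto simp: top_face_def)
  next
    fix x assume x: "x \<in> top_face a P"
    then have "x \<in> P" "b \<le> a \<bullet> x" using x0 by (auto simp: top_face_def)
    moreover have "a \<bullet> x \<le> b" using ab(1) \<open>x \<in> P\<close> by auto
    ultimately show "x \<in> F" unfolding ab(2) by simp
  qed
  then show "F \<in> range (\<lambda>y. top_face y P)" by simp
next
  fix F assume "F \<in> range (\<lambda>y. top_face y P)"
  then show "F \<in> {F. F face_of P \<and> F \<noteq> {}}"
    using top_face_face_of[OF polytope_imp_convex[OF assms(1)]] assms(2) by auto
qed

section \<open>Sums of faces of the standard simplex\<close>

lemma basis_inner:
  assumes "bij_betw e V (Basis :: 'a::euclidean_space set)" "i \<in> V" "j \<in> V"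
  shows "e i \<bullet> (e j :: 'a) = (if i = j then 1 else 0)"
proof -
  have "e i \<in> Basis" "e j \<in> Basis" "e i = e j \<longleftrightarrow> i = j"
    using assms by (auto simp: bij_betw_def inj_on_def)
  then show ?thesis using inner_Basis[of "e i" "e j"] by simp
qed

lemma hull_basis_mem:
  assumes "bij_betw e V (Basis :: 'a::euclidean_space set)" "M \<subseteq> V" "i \<in> V"
    "(e i :: 'a) \<in> convex hull (e ` M)"
  shows "i \<in> M"
proof (rule ccontr)
  assume "i \<notin> M"
  have "convex hull (e ` M) \<subseteq> {x. e i \<bullet> x = 0}"
    by (rule hull_minimal)
      (use \<open>i \<notin> M\<close> assms basis_inner[OF assms(1,3)] in \<open>auto simp: convex_hyperplane\<close>)
  then have "e i \<bullet> e i = 0" using assms(4) by blast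
  then show False using basis_inner[OF assms(1,3,3)] by simp
qed

lemma hull_basis_inject:
  assumes "bij_betw e V (Basis :: 'a::euclidean_space set)" "M \<subseteq> V" "M' \<subseteq> V"
    "convex hull (e ` M) = (convex hull (e ` M') :: 'a set)"
  shows "M = M'"
  using hull_basis_mem[OF assms(1)] assms(2-4) by (metis hull_inc image_eqI subset_antisym subset_iff)

lemma top_face_simplex:
  fixes e :: "'v \<Rightarrow> 'a::euclidean_space"
  assumes "finite S" "S \<noteq> {}"
  defines "M \<equiv> \<lambda>y. {i \<in> S. \<forall>j\<in>S. y \<bullet> e j \<le> y \<bullet> e i}"
  shows "top_face y (convex hull (e ` S)) = convex hull (e ` M y)" "M y \<noteq> {}"
proof -
  have "Max ((\<lambda>i. y \<bullet> e i) ` S) \<in> (\<lambda>i. y \<bullet> e i) ` S" using assms(1,2) by simp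
  then obtain i where i: "i \<in> S" "y \<bullet> e i = Max ((\<lambda>i. y \<bullet> e i) ` S)" by auto
  then have iM: "i \<in> M y" using assms(1) by (simp add: M_def)
  then show "M y \<noteq> {}" by auto
  let ?X = "convex hull (e ` S)"
  have le: "?X \<subseteq> {z. y \<bullet> z \<le> y \<bullet> e i}"
    by (rule hull_minimal) (use iM in \<open>auto simp: M_def convex_halfspace_le\<close>)
  have eq: "convex hull (e ` M y) \<subseteq> {z. y \<bullet> z = y \<bullet> e i}"
    by (rule hull_minimal) (use iM in \<open>auto simp: M_def convex_hyperplane intro: antisym\<close>)
  have sub: "convex hull (e ` M y) \<subseteq> ?X" by (rule hull_mono) (auto simp: M_def)
  show "top_face y ?X = convex hull (e ` M y)"
  proof
    show "convex hull (e ` M y) \<subseteq> top_face y ?X"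
    proof
      fix x assume x: "x \<in> convex hull (e ` M y)"
      have "y \<bullet> x = y \<bullet> e i" using eq x by blast
      moreover have "y \<bullet> z \<le> y \<bullet> e i" if "z \<in> ?X" for z using le that by blast
      ultimately show "x \<in> top_face y ?X" using sub x unfolding top_face_def by auto
    qed
    have "top_face y ?X face_of ?X" by (rule top_face_face_of) simp
    then obtain S' where S': "S' \<subseteq> e ` S" "top_face y ?X = convex hull S'"
      using face_of_convex_hull_subset[OF finite_imp_compact] assms(1) by (metis finite_imageI)
    have "S' \<subseteq> e ` M y"
    proof
      fix z assume z: "z \<in> S'"
      then obtain k where k: "k \<in> S" "z = e k" using S' by auto
      have "z \<in> top_face y ?X" using z S'(2) by (simp add: hull_inc)
      then have "y \<bullet> e j \<le> y \<bullet> e k" if "j \<in> S" for j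
        using that k by (simp add: top_face_def hull_inc)
      then show "z \<in> e ` M y" using k by (auto simp: M_def)
    qed
    then show "top_face y ?X \<subseteq> convex hull (e ` M y)" using S'(2) by (simp add: hull_mono)
  qed
qed

lemma Union_comps: "\<Union> (comps E W) = W"
proof
  show "W \<subseteq> \<Union> (comps E W)" using comps_cover[of _ W E] by auto
qed (auto dest: comps_sub)

text \<open>The orthogonal complement of the differences \<open>e i - e j\<close> along edges consists of the vectors that are
  constant on each component; the indicator vectors of the components form an orthogonal basis of
  it.\<close>

lemma dim_edge_space:
  fixes e :: "'v \<Rightarrow> 'a::euclidean_space"
  assumes "bij_betw e V (Basis :: 'a set)" "sym L" "finite V"
  shows "dim {e i - e j | i j. (i, j) \<in> L \<and> i \<in> V \<and> j \<in> V} = card V - num_comps L V"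
proof -
  let ?D = "{e i - e j | i j. (i, j) \<in> L \<and> i \<in> V \<and> j \<in> V}"
  define chi where "chi C = (\<Sum>i\<in>C. e i)" for C
  have chi: "chi C \<bullet> e i = (if i \<in> C then 1 else 0)" if "C \<subseteq> V" "i \<in> V" for C i
  proof -
    have "chi C \<bullet> e i = (\<Sum>j\<in>C. if j = i then 1 else 0)"
      unfolding chi_def inner_sum_left
      by (rule sum.cong) (use that basis_inner[OF assms(1)] in auto)
    then show ?thesis using finite_subset[OF that(1) assms(3)] by simp
  qed
  let ?B = "chi ` comps L V"
  have orth: "chi C \<bullet> chi C' = (if C = C' then real (card C) else 0)"
    if "C \<in> comps L V" "C' \<in> comps L V" for C C'
  proof -
    have "chi C \<bullet> chi C' = (\<Sum>i\<in>C'. if i \<in> C then 1 else 0)"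
      unfolding chi_def[of C'] inner_sum_right
      by (rule sum.cong) (use chi[OF comps_sub[OF that(1)]] comps_sub[OF that(2)] in auto)
    also have "\<dots> = (if C = C' then real (card C) else 0)"
    proof (cases "C = C'")
      case False
      then have "x \<notin> C" if "x \<in> C'" for x
        using comps_disj[OF assms(2) \<open>C \<in> comps L V\<close> \<open>C' \<in> comps L V\<close>, of x] that by auto
      then show ?thesis using False by (simp add: sum.neutral)
    qed simp
    finally show ?thesis .
  qed
  have pos: "card C > 0" if "C \<in> comps L V" for C
    using comps_nonempty[OF that] comps_sub[OF that] finite_subset[OF _ assms(3)]
    by (simp add: card_gt_0_iff)
  have inj: "inj_on chi (comps L V)"
  proof (rule inj_onI)
    fix C C' assume "C \<in> comps L V" "C' \<in> comps L V" "chi C = chi C'"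
    then show "C = C'" using orth[of C C'] orth[of C C] pos[of C] by (auto split: if_splits)
  qed
  have ind: "independent ?B"
  proof (rule pairwise_orthogonal_independent)
    show "pairwise orthogonal ?B" by (auto simp: pairwise_def orthogonal_def orth)
    show "0 \<notin> ?B"
    proof
      assume "0 \<in> ?B"
      then obtain C where "C \<in> comps L V" "chi C = 0" by auto
      then show False using orth[of C C] pos[of C] by auto
    qed
  qed
  have perp: "{y \<in> UNIV. \<forall>x\<in>span ?D. orthogonal x y} = span ?B"
  proof
    show "span ?B \<subseteq> {y \<in> UNIV. \<forall>x\<in>span ?D. orthogonal x y}"
    proof (rule span_minimal)
      show "?B \<subseteq> {y \<in> UNIV. \<forall>x\<in>span ?D. orthogonal x y}"
      proof (intro subsetI CollectI conjI UNIV_I ballI)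
        fix z x assume "z \<in> ?B" and x: "x \<in> span ?D"
        then obtain C where C: "C \<in> comps L V" "z = chi C" by auto
        have "orthogonal (chi C) x"
        proof (rule orthogonal_to_span[OF x])
          fix z assume "z \<in> ?D"
          then obtain i j where ij: "z = e i - e j" "(i, j) \<in> L" "i \<in> V" "j \<in> V" by auto
          have "i \<in> C \<longleftrightarrow> j \<in> C"
            using comps_closed[OF assms(2) C(1)] ij symD[OF assms(2)] by blast
          then show "orthogonal (chi C) z"
            using chi[OF comps_sub[OF C(1)]] ij by (simp add: orthogonal_def inner_diff_right)
        qed
        then show "orthogonal x z" by (simp add: C(2) orthogonal_commute)
      qed
      show "subspace {y \<in> UNIV. \<forall>x\<in>span ?D. orthogonal x y}"
        using subspace_orthogonal_to_vectors[of "span ?D"] by simp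
    qed
    show "{y \<in> UNIV. \<forall>x\<in>span ?D. orthogonal x y} \<subseteq> span ?B"
    proof
      fix y assume "y \<in> {y \<in> UNIV. \<forall>x\<in>span ?D. orthogonal x y}"
      then have y: "\<forall>x\<in>span ?D. orthogonal x y" by simp
      have edge: "y \<bullet> e i = y \<bullet> e j" if "(i, j) \<in> L" "i \<in> V" "j \<in> V" for i j
      proof -
        have "e i - e j \<in> span ?D" by (rule span_base) (use that in auto)
        then have "y \<bullet> (e i - e j) = 0" using y by (auto simp: orthogonal_def inner_commute)
        then show ?thesis by (simp add: inner_diff_right)
      qed
      have const: "y \<bullet> e i = y \<bullet> e j" if "(i, j) \<in> rtrancl_on V L" for i j
        using that by (induct rule: rtrancl_on_induct) (auto dest: edge)
      have "y = (\<Sum>b\<in>Basis. (y \<bullet> b) *\<^sub>R b)" by (simp add: euclidean_representation)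
      also have "\<dots> = (\<Sum>i\<in>V. (y \<bullet> e i) *\<^sub>R e i)"
        by (rule sum.reindex_bij_betw[OF assms(1), symmetric])
      also have "\<dots> = (\<Sum>i\<in>\<Union> (comps L V). (y \<bullet> e i) *\<^sub>R e i)"
        by (simp only: Union_comps)
      also have "\<dots> = (\<Sum>C\<in>comps L V. \<Sum>i\<in>C. (y \<bullet> e i) *\<^sub>R e i)"
      proof (subst sum.Union_disjoint)
        show "\<forall>C\<in>comps L V. finite C" using comps_sub[of _ L V] finite_subset[OF _ assms(3)] by auto
        show "\<forall>C\<in>comps L V. \<forall>C'\<in>comps L V. C \<noteq> C' \<longrightarrow> C \<inter> C' = {}"
          using comps_disj[OF assms(2)] by (metis disjoint_iff)
      qed simp
      also have "\<dots> \<in> span ?B"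
      proof (rule span_sum)
        fix C assume C: "C \<in> comps L V"
        then obtain a where a: "a \<in> C" using comps_nonempty by blast
        have "(\<Sum>i\<in>C. (y \<bullet> e i) *\<^sub>R e i) = (\<Sum>i\<in>C. (y \<bullet> e a) *\<^sub>R e i)"
          using const reach_comps[OF assms(2) C a] by (intro sum.cong) auto
        also have "\<dots> = (y \<bullet> e a) *\<^sub>R chi C" by (simp add: chi_def scaleR_sum_right)
        also have "\<dots> \<in> span ?B" by (intro span_scale span_base) (use C in auto)
        finally show "(\<Sum>i\<in>C. (y \<bullet> e i) *\<^sub>R e i) \<in> span ?B" .
      qed
      finally show "y \<in> span ?B" .
    qed
  qed
  have "dim (span ?B) + dim (span ?D) = DIM('a)"
    using dim_subspace_orthogonal_to_vectors[OF subspace_span subspace_UNIV subset_UNIV, of ?D]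
    unfolding perp by (simp only: dim_UNIV)
  moreover have "dim (span ?B) = num_comps L V"
    using ind card_image[OF inj] by (simp add: dim_eq_card_independent num_comps_def)
  moreover have "DIM('a) = card V" using bij_betw_same_card[OF assms(1)] by simp
  ultimately show ?thesis by simp
qed

text \<open>Two points of the sum that differ in one summand only differ by a vector parallel to the face of that
  simplex, so the direction space of the sum contains all \<open>e i - e j\<close> with \<open>i\<close> and \<open>j\<close> in a common
  index set.\<close>

lemma aff_dim_sum_simplices:
  fixes e :: "'v \<Rightarrow> 'a::euclidean_space"
  assumes bij: "bij_betw e V (Basis :: 'a set)" and "finite V" "finite I"
    and M: "\<And>S. S \<in> I \<Longrightarrow> M S \<subseteq> V \<and> M S \<noteq> {}"
    and L: "L = {(i, j). \<exists>S\<in>I. i \<in> M S \<and> j \<in> M S}"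
  shows "aff_dim (\<Sum>S\<in>I. convex hull (e ` M S)) = int (card V - num_comps L V)"
proof -
  let ?Q = "\<Sum>S\<in>I. convex hull (e ` M S)"
  let ?D = "{e i - e j | i j. (i, j) \<in> L \<and> i \<in> V \<and> j \<in> V}"
  define p where "p S = (SOME i. i \<in> M S)" for S
  have p: "p S \<in> M S" if "S \<in> I" for S using M[OF that] by (simp add: p_def some_in_eq)
  have mem: "sum s I \<in> ?Q" if "\<And>S. S \<in> I \<Longrightarrow> s S \<in> convex hull (e ` M S)" for s
    unfolding set_sum_alt[OF assms(3)] using that by auto
  define q where "q = (\<Sum>S\<in>I. e (p S))"
  have q: "q \<in> ?Q" unfolding q_def by (rule mem) (use p in \<open>auto intro: hull_inc\<close>)
  let ?A = "(\<lambda>x. x - q) ` ?Q"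
  have "span ?A = span ?D"
  proof
    show "span ?A \<subseteq> span ?D"
    proof (rule span_minimal)
      show "?A \<subseteq> span ?D"
      proof clarify
        fix x assume "x \<in> ?Q"
        then obtain s where s: "x = sum s I" "\<forall>S\<in>I. s S \<in> convex hull (e ` M S)"
          unfolding set_sum_alt[OF assms(3)] by auto
        have "s S - e (p S) \<in> span ?D" if S: "S \<in> I" for S
        proof -
          have "convex hull (e ` M S) \<subseteq> (+) (e (p S)) ` span ?D"
          proof (rule hull_minimal)
            show "convex ((+) (e (p S)) ` span ?D)"
              by (intro convex_translation subspace_imp_convex subspace_span)
            show "e ` M S \<subseteq> (+) (e (p S)) ` span ?D"
            proof clarify
              fix i assume i: "i \<in> M S"
              have "(i, p S) \<in> L" "i \<in> V" "p S \<in> V" using i p[OF S] M[OF S] S L by auto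
              then have "e i - e (p S) \<in> span ?D" by (intro span_base) auto
              then show "e i \<in> (+) (e (p S)) ` span ?D" by (rule rev_image_eqI) simp
            qed
          qed
          then show ?thesis using s(2) S by auto
        qed
        then have "(\<Sum>S\<in>I. s S - e (p S)) \<in> span ?D" by (rule span_sum)
        then show "x - q \<in> span ?D" by (simp add: s q_def sum_subtractf)
      qed
    qed simp
    show "span ?D \<subseteq> span ?A"
    proof (rule span_minimal)
      show "?D \<subseteq> span ?A"
      proof clarify
        fix i j assume "(i, j) \<in> L"
        then obtain S where S: "S \<in> I" "i \<in> M S" "j \<in> M S" by (auto simp: L)
        define r where "r k = (\<lambda>T. e (p T))(S := e k)" for k
        have r: "sum (r k) I \<in> ?Q" if "k \<in> M S" for k
          by (rule mem) (use p that in \<open>auto simp: r_def intro: hull_inc\<close>)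
        have "sum (r k) I = e k + (\<Sum>T\<in>I - {S}. e (p T))" for k
          using assms(3) S by (simp add: sum.remove r_def)
        then have "e i - e j = (sum (r i) I - q) - (sum (r j) I - q)" by simp
        also have "\<dots> \<in> span ?A"
          using r S by (intro span_diff span_base) auto
        finally show "e i - e j \<in> span ?A" .
      qed
    qed simp
  qed
  then have "dim ?A = dim ?D" using dim_span[of ?A] dim_span[of ?D] by (simp only:)
  also have "\<dots> = card V - num_comps L V"
    by (rule dim_edge_space[OF bij _ assms(2)]) (auto simp: L sym_def)
  finally show ?thesis using aff_dim_eq_dim_subtract[OF hull_inc[OF q]] by simp
qed

section \<open>The faces of a graph-associahedron\<close>

lemma maxima_cong:
  assumes "\<And>i. i \<in> W \<Longrightarrow> w i = w' i"
  shows "maxima E w W = maxima E w' W"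
proof -
  have "(\<forall>j\<in>S. w j \<le> w i) \<longleftrightarrow> (\<forall>j\<in>S. w' j \<le> w' i)" if "S \<subseteq> W" "i \<in> S" for S i
    using that assms by (metis subsetD)
  then show ?thesis unfolding maxima_def by blast
qed

definition tubes :: "'v rel \<Rightarrow> 'v set \<Rightarrow> 'v set set" where
  "tubes E V = {S. S \<subseteq> V \<and> conn E S}"

definition tube_sum :: "('v \<Rightarrow> 'a::euclidean_space) \<Rightarrow> 'v rel \<Rightarrow> 'v set \<Rightarrow> 'a set" where
  "tube_sum e E V = (\<Sum>S\<in>tubes E V. convex hull (e ` S))"

lemma polytope_tube_sum:
  assumes "finite V" shows "polytope (tube_sum e E V)"
proof -
  have fin: "finite (tubes E V)" using assms by (simp add: tubes_def)
  have "finite (\<Sum>S\<in>tubes E V. e ` S)"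
  proof (rule finite_subset)
    show "(\<Sum>S\<in>tubes E V. e ` S) \<subseteq> (\<lambda>s. sum s (tubes E V)) ` (tubes E V \<rightarrow>\<^sub>E e ` V)"
    proof
      fix x assume "x \<in> (\<Sum>S\<in>tubes E V. e ` S)"
      then obtain s where s: "x = sum s (tubes E V)" "\<forall>S\<in>tubes E V. s S \<in> e ` S"
        unfolding set_sum_alt[OF fin] by auto
      then show "x \<in> (\<lambda>s. sum s (tubes E V)) ` (tubes E V \<rightarrow>\<^sub>E e ` V)"
        by (intro image_eqI[of _ _ "restrict s (tubes E V)"]) (auto simp: tubes_def)
    qed
    show "finite ((\<lambda>s. sum s (tubes E V)) ` (tubes E V \<rightarrow>\<^sub>E e ` V))"
      using assms fin by (simp add: finite_PiE)
  qed
  then show ?thesis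
    unfolding tube_sum_def convex_hull_set_sum[symmetric] by (rule polytope_convex_hull)
qed

lemma top_face_tube_sum:
  fixes e :: "'v \<Rightarrow> 'a::euclidean_space" and y :: 'a and E :: "'v rel"
  assumes "finite V"
  defines "\<Theta> \<equiv> maxima E (\<lambda>i. y \<bullet> e i) V"
  shows "top_face y (tube_sum e E V) = (\<Sum>S\<in>tubes E V. convex hull (e ` {i. (S, i) \<in> \<Theta>}))"
    "\<And>S. S \<in> tubes E V \<Longrightarrow> top_face y (convex hull (e ` S)) = convex hull (e ` {i. (S, i) \<in> \<Theta>})"
    "\<And>S. S \<in> tubes E V \<Longrightarrow> {i. (S, i) \<in> \<Theta>} \<subseteq> V \<and> {i. (S, i) \<in> \<Theta>} \<noteq> {}"
proof -
  have M: "{i. (S, i) \<in> \<Theta>} = {i \<in> S. \<forall>j\<in>S. y \<bullet> e j \<le> y \<bullet> e i}" "finite S" "S \<noteq> {}" "S \<subseteq> V"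
    if "S \<in> tubes E V" for S
    using that finite_subset[OF _ assms(1)] conn_nonempty
    by (auto simp: tubes_def \<Theta>_def maxima_def)
  show *: "top_face y (convex hull (e ` S)) = convex hull (e ` {i. (S, i) \<in> \<Theta>})"
    if "S \<in> tubes E V" for S
    using top_face_simplex(1)[of S y e] M[OF that] by simp
  show "{i. (S, i) \<in> \<Theta>} \<subseteq> V \<and> {i. (S, i) \<in> \<Theta>} \<noteq> {}" if "S \<in> tubes E V" for S
    using top_face_simplex(2)[of S y e] M[OF that] by auto
  have "finite (tubes E V)" using assms(1) by (simp add: tubes_def)
  from top_face_sum[OF this, of y "\<lambda>S. convex hull (e ` S)"]
  show "top_face y (tube_sum e E V) = (\<Sum>S\<in>tubes E V. convex hull (e ` {i. (S, i) \<in> \<Theta>}))"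
    unfolding tube_sum_def by (simp add: * cong: sum.cong)
qed

lemma aff_dim_top_face:
  fixes e :: "'v \<Rightarrow> 'a::euclidean_space"
  assumes bij: "bij_betw e V (Basis :: 'a set)" and "finite V"
  shows "aff_dim (top_face y (tube_sum e E V)) =
    int (card V - num_comps (tied (maxima E (\<lambda>i. y \<bullet> e i) V)) V)"
  unfolding top_face_tube_sum(1)[OF assms(2)]
proof (rule aff_dim_sum_simplices[OF assms])
  show "finite (tubes E V)" using assms(2) by (simp add: tubes_def)
  show "tied (maxima E (\<lambda>i. y \<bullet> e i) V) = {(i, j). \<exists>S\<in>tubes E V.
      i \<in> {i. (S, i) \<in> maxima E (\<lambda>i. y \<bullet> e i) V} \<and> j \<in> {i. (S, i) \<in> maxima E (\<lambda>i. y \<bullet> e i) V}}"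
    by (auto simp: tied_def maxima_def tubes_def)
qed (rule top_face_tube_sum(3)[OF assms(2)])

lemma top_face_tube_sum_nonempty:
  assumes "finite V"
  shows "top_face y (tube_sum e E V) \<noteq> {}"
proof -
  have fin: "finite (tubes E V)" using assms by (simp add: tubes_def)
  have "\<forall>S\<in>tubes E V. \<exists>x. x \<in> top_face y (convex hull (e ` S))"
    using top_face_tube_sum(2,3)[OF assms, where e = e and y = y and E = E] by (simp add: ex_in_conv)
  then obtain s where "\<forall>S\<in>tubes E V. s S \<in> top_face y (convex hull (e ` S))"
    using bchoice by meson
  then have "sum s (tubes E V) \<in> (\<Sum>S\<in>tubes E V. top_face y (convex hull (e ` S)))"
    unfolding set_sum_alt[OF fin] by auto
  also have "\<dots> = top_face y (tube_sum e E V)"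
    unfolding tube_sum_def by (rule top_face_sum[OF fin, symmetric])
  finally show ?thesis by auto
qed

lemma top_face_tube_sum_eq_iff:
  fixes e :: "'v \<Rightarrow> 'a::euclidean_space"
  assumes bij: "bij_betw e V (Basis :: 'a set)" and fin: "finite V"
  shows "top_face y (tube_sum e E V) = top_face y' (tube_sum e E V) \<longleftrightarrow>
    maxima E (\<lambda>i. y \<bullet> e i) V = maxima E (\<lambda>i. y' \<bullet> e i) V"
proof
  assume eq: "top_face y (tube_sum e E V) = top_face y' (tube_sum e E V)"
  have finT: "finite (tubes E V)" using fin by (simp add: tubes_def)
  note t = top_face_tube_sum(2,3)[OF fin, where e = e and E = E]
  have ne: "top_face y (convex hull (e ` S)) \<noteq> {}" if "S \<in> tubes E V" for y S
    using t[OF that] by simp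
  have same: "{i. (S, i) \<in> maxima E (\<lambda>i. y \<bullet> e i) V} = {i. (S, i) \<in> maxima E (\<lambda>i. y' \<bullet> e i) V}"
    if S: "S \<in> tubes E V" for S
  proof (rule hull_basis_inject[OF bij])
    have "top_face y (convex hull (e ` S)) = top_face y' (convex hull (e ` S))"
    proof
      show "top_face y (convex hull (e ` S)) \<subseteq> top_face y' (convex hull (e ` S))"
        using eq unfolding tube_sum_def by (intro top_face_sum_inject[OF finT ne S]) auto
      show "top_face y' (convex hull (e ` S)) \<subseteq> top_face y (convex hull (e ` S))"
        using eq unfolding tube_sum_def by (intro top_face_sum_inject[OF finT ne S]) auto
    qed
    then show "convex hull (e ` {i. (S, i) \<in> maxima E (\<lambda>i. y \<bullet> e i) V}) =
        convex hull (e ` {i. (S, i) \<in> maxima E (\<lambda>i. y' \<bullet> e i) V})"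
      using t(1)[OF S] by simp
  qed (use t(2)[OF S] in auto)
  show "maxima E (\<lambda>i. y \<bullet> e i) V = maxima E (\<lambda>i. y' \<bullet> e i) V"
  proof (intro set_eqI)
    fix p :: "'v set \<times> 'v"
    obtain S i where p: "p = (S, i)" by (cases p)
    show "p \<in> maxima E (\<lambda>i. y \<bullet> e i) V \<longleftrightarrow> p \<in> maxima E (\<lambda>i. y' \<bullet> e i) V"
    proof (cases "S \<in> tubes E V")
      case True
      then show ?thesis using same[OF True] p by blast
    next
      case False
      then show ?thesis by (auto simp: p maxima_def tubes_def)
    qed
  qed
next
  assume "maxima E (\<lambda>i. y \<bullet> e i) V = maxima E (\<lambda>i. y' \<bullet> e i) V"
  then show "top_face y (tube_sum e E V) = top_face y' (tube_sum e E V)"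
    by (simp add: top_face_tube_sum(1)[OF fin])
qed

theorem sum_faces_tube_sum:
  fixes e :: "'v \<Rightarrow> 'a::euclidean_space" and V :: "'v set" and E :: "'v rel"
  assumes bij: "bij_betw e V (Basis :: 'a set)" and fin: "finite V"
  defines "P \<equiv> tube_sum e E V"
  shows "(\<Sum>F | F face_of P \<and> F \<noteq> {}. x ^ nat (aff_dim F)) = facepoly E V x"
proof -
  let ?\<Theta> = "\<lambda>y. maxima E (\<lambda>i. y \<bullet> e i) V"
  have surj: "\<exists>y. maxima E w V = ?\<Theta> y" for w
  proof (intro exI maxima_cong)
    fix i assume i: "i \<in> V"
    have "(\<Sum>j\<in>V. w j *\<^sub>R e j) \<bullet> e i = (\<Sum>j\<in>V. if j = i then w j else 0)"
      unfolding inner_sum_left by (rule sum.cong) (use i basis_inner[OF bij] in auto)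
    then show "w i = (\<Sum>j\<in>V. w j *\<^sub>R e j) \<bullet> e i" using i fin by simp
  qed
  have faces: "faces E V = range ?\<Theta>"
    using surj by (fastforce simp: faces_def)
  have nonempty: "{F. F face_of P \<and> F \<noteq> {}} = range (\<lambda>y. top_face y P)"
    unfolding P_def
    by (rule nonempty_faces[OF polytope_tube_sum[OF fin] top_face_tube_sum_nonempty[OF fin]])
  define Y where "Y \<Theta> = (SOME y. ?\<Theta> y = \<Theta>)" for \<Theta>
  have Y: "?\<Theta> (Y \<Theta>) = \<Theta>" if "\<Theta> \<in> faces E V" for \<Theta>
    unfolding Y_def by (rule someI_ex) (use that faces in auto)
  have bij_faces: "bij_betw (\<lambda>\<Theta>. top_face (Y \<Theta>) P) (faces E V) {F. F face_of P \<and> F \<noteq> {}}"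
  proof (rule bij_betwI')
      fix \<Theta> \<Theta>' assume "\<Theta> \<in> faces E V" "\<Theta>' \<in> faces E V"
      then show "top_face (Y \<Theta>) P = top_face (Y \<Theta>') P \<longleftrightarrow> \<Theta> = \<Theta>'"
        using top_face_tube_sum_eq_iff[OF bij fin, of "Y \<Theta>" E "Y \<Theta>'"] Y by (simp add: P_def)
    next
      fix \<Theta> assume "\<Theta> \<in> faces E V"
      then show "top_face (Y \<Theta>) P \<in> {F. F face_of P \<and> F \<noteq> {}}"
        unfolding nonempty by simp
    next
      fix F assume "F \<in> {F. F face_of P \<and> F \<noteq> {}}"
      then obtain y where "F = top_face y P"
        unfolding nonempty by auto
      moreover have "?\<Theta> y \<in> faces E V" using faces by simp
      ultimately show "\<exists>\<Theta>\<in>faces E V. F = top_face (Y \<Theta>) P"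
        using top_face_tube_sum_eq_iff[OF bij fin, of y E "Y (?\<Theta> y)"] Y by (auto simp: P_def)
    qed
  have "(\<Sum>F | F face_of P \<and> F \<noteq> {}. x ^ nat (aff_dim F)) =
      (\<Sum>\<Theta>\<in>faces E V. x ^ nat (aff_dim (top_face (Y \<Theta>) P)))"
    by (rule sum.reindex_bij_betw[OF bij_faces, symmetric])
  also have "\<dots> = (\<Sum>\<Theta>\<in>faces E V. x ^ (card V - num_comps (tied \<Theta>) V))"
    by (rule sum.cong) (simp_all add: P_def aff_dim_top_face[OF bij fin] Y)
  finally show ?thesis by (simp add: facepoly_def)
qed

section \<open>The gamma-vector of a polytope and its face numbers\<close>

lemma gamma_expansion_sum_form:
  fixes x :: real
  assumes "2 * degree g \<le> n" "0 < x"
  shows "(x + 2) ^ n * poly g ((x + 1) / (x + 2)\<^sup>2) =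
    (\<Sum>i\<le>n div 2. coeff g i * (x + 1) ^ i * (x + 2) ^ (n - 2 * i))"
proof -
  let ?y = "(x + 1) / (x + 2)\<^sup>2"
  have "poly g ?y = (\<Sum>i\<le>n div 2. coeff g i * ?y ^ i)"
    unfolding poly_altdef
    by (rule sum.mono_neutral_left) (use assms(1) in \<open>auto simp: coeff_eq_0\<close>)
  moreover have "(x + 2) ^ n * ?y ^ i = (x + 1) ^ i * (x + 2) ^ (n - 2 * i)" if "i \<le> n div 2" for i
  proof -
    have "(x + 2) ^ n = (x + 2) ^ (n - 2 * i) * ((x + 2)\<^sup>2) ^ i"
      using that by (simp flip: power_add power_mult)
    then show ?thesis using assms(2) by (simp add: power_divide)
  qed
  ultimately show ?thesis
    by (auto simp: sum_distrib_left mult.left_commute mult.assoc intro!: sum.cong)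
qed

text \<open>Two polynomials that agree for \<open>x > 0\<close> are equal, which gives the claim for \<open>t \<noteq> 0\<close> after dividing by
  \<open>t ^ n\<close>; the case \<open>t = 0\<close> follows by continuity.\<close>

lemma homogenize:
  assumes "gamma_expansion n (\<lambda>x. \<Sum>i\<le>n. a i * x ^ i) g"
  shows "(\<Sum>i\<le>n. a i * (\<alpha> - t) ^ i * t ^ (n - i)) =
    (\<Sum>i\<le>n div 2. coeff g i * (\<alpha> * t) ^ i * (\<alpha> + t) ^ (n - 2 * i))"
proof -
  have deg: "2 * degree g \<le> n" using assms by (simp add: gamma_expansion_def)
  define pf where "pf = (\<Sum>i\<le>n. monom (a i) i)"
  define pg where "pg = (\<Sum>i\<le>n div 2. smult (coeff g i) ([:1, 1:] ^ i * [:2, 1:] ^ (n - 2 * i)))"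
  have pf: "poly pf x = (\<Sum>i\<le>n. a i * x ^ i)" for x by (simp add: pf_def poly_sum poly_monom)
  have pg: "poly pg x = (\<Sum>i\<le>n div 2. coeff g i * (x + 1) ^ i * (x + 2) ^ (n - 2 * i))" for x
    by (simp add: pg_def poly_sum add.commute mult.assoc)
  have "{0<..} \<subseteq> {x. poly (pf - pg) x = 0}"
    using assms gamma_expansion_sum_form[OF deg] by (auto simp: gamma_expansion_def pf pg)
  then have "infinite {x. poly (pf - pg) x = 0}" using infinite_Ioi finite_subset by blast
  then have "pf - pg = 0" using poly_roots_finite by blast
  then have eq: "(\<Sum>i\<le>n. a i * x ^ i) =
      (\<Sum>i\<le>n div 2. coeff g i * (x + 1) ^ i * (x + 2) ^ (n - 2 * i))" for x
    by (metis pf pg eq_iff_diff_eq_0)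
  let ?l = "\<lambda>t. \<Sum>i\<le>n. a i * (\<alpha> - t) ^ i * t ^ (n - i)"
  let ?r = "\<lambda>t. \<Sum>i\<le>n div 2. coeff g i * (\<alpha> * t) ^ i * (\<alpha> + t) ^ (n - 2 * i)"
  have nonzero: "?l t = ?r t" if "t \<noteq> 0" for t
  proof -
    have "?l t = t ^ n * (\<Sum>i\<le>n. a i * ((\<alpha> - t) / t) ^ i)"
      unfolding sum_distrib_left
      by (rule sum.cong) (use that in \<open>auto simp: power_divide power_diff field_simps\<close>)
    also have "\<dots> = t ^ n * (\<Sum>i\<le>n div 2. coeff g i * (\<alpha> / t) ^ i * ((\<alpha> + t) / t) ^ (n - 2 * i))"
    proof -
      have "(\<alpha> - t) / t + 1 = \<alpha> / t" "(\<alpha> - t) / t + 2 = (\<alpha> + t) / t"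
        using that by (simp_all add: field_simps)
      then show ?thesis unfolding eq[of "(\<alpha> - t) / t"] by simp
    qed
    also have "\<dots> = ?r t"
      unfolding sum_distrib_left
    proof (rule sum.cong[OF refl])
      fix i assume "i \<in> {..n div 2}"
      then have "t ^ n = t ^ (n - 2 * i) * t ^ i * t ^ i"
        by (simp flip: power_add)
      then show "t ^ n * (coeff g i * (\<alpha> / t) ^ i * ((\<alpha> + t) / t) ^ (n - 2 * i)) =
          coeff g i * (\<alpha> * t) ^ i * (\<alpha> + t) ^ (n - 2 * i)"
        using that by (simp add: power_divide power_mult_distrib)
    qed
    finally show ?thesis .
  qed
  have "((\<lambda>t. ?l t - ?r t) \<longlongrightarrow> ?l 0 - ?r 0) (at 0)"
    by (intro tendsto_intros)
  moreover have "((\<lambda>t. ?l t - ?r t) \<longlongrightarrow> 0) (at 0)"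
    by (rule tendsto_eventually) (simp add: eventually_at_filter nonzero)
  ultimately have "?l 0 = ?r 0" using tendsto_unique[of "at (0::real)"] by fastforce
  then show ?thesis using nonzero by (cases "t = 0") auto
qed

lemma gamma_vector_eq:
  assumes "poly_dim P = n" "gamma_expansion n (\<lambda>x. \<Sum>i\<le>n. real (f_vector P i) * x ^ i) g"
  shows "gamma_vector P = coeff g"
  unfolding gamma_vector_def assms(1)
proof (rule the_equality, intro conjI allI impI)
  have deg: "2 * degree g \<le> n" using assms by (simp add: gamma_expansion_def)
  show "coeff g i = 0" if "i > n div 2" for i
    using that deg by (intro coeff_eq_0) simp
  show "H_poly P \<alpha> t = (\<Sum>i\<le>n div 2. coeff g i * (\<alpha> * t) ^ i * (\<alpha> + t) ^ (n - 2 * i))" for \<alpha> t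
    using homogenize[OF assms(2)] by (simp add: H_poly_def F_poly_def assms(1))
next
  fix h assume "(\<forall>i>n div 2. h i = 0) \<and> (\<forall>\<alpha> t. H_poly P \<alpha> t =
      (\<Sum>i\<le>n div 2. h i * (\<alpha> * t) ^ i * (\<alpha> + t) ^ (n - 2 * i)))"
  then have h: "\<And>i. i > n div 2 \<Longrightarrow> h i = 0"
    "\<And>\<alpha> t. H_poly P \<alpha> t = (\<Sum>i\<le>n div 2. h i * (\<alpha> * t) ^ i * (\<alpha> + t) ^ (n - 2 * i))" by auto
  define g' where "g' = (\<Sum>i\<le>n div 2. monom (h i) i)"
  have coeff: "coeff g' i = h i" for i
    using h(1)[of i] by (simp add: g'_def coeff_sum)
  have "degree g' \<le> n div 2" by (rule degree_le) (simp add: coeff h(1))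
  then have deg: "2 * degree g' \<le> n" by simp
  have "gamma_expansion n (\<lambda>x. \<Sum>i\<le>n. real (f_vector P i) * x ^ i) g'"
    unfolding gamma_expansion_def
  proof (intro conjI allI impI deg)
    fix x :: real assume "x > 0"
    have "(\<Sum>i\<le>n. real (f_vector P i) * x ^ i) = H_poly P (x + 1) 1"
      by (simp add: H_poly_def F_poly_def assms(1))
    also have "\<dots> = (x + 2) ^ n * poly g' ((x + 1) / (x + 2)\<^sup>2)"
      unfolding gamma_expansion_sum_form[OF deg \<open>x > 0\<close>] coeff h(2) by (simp add: add.commute)
    finally show "(\<Sum>i\<le>n. real (f_vector P i) * x ^ i) =
        (x + 2) ^ n * poly g' ((x + 1) / (x + 2)\<^sup>2)" .
  qed
  then have "g' = g" using gamma_expansion_unique assms(2) by blast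
  then show "h = coeff g" using coeff by auto
qed

lemma gamma_vector_tube_sum:
  fixes e :: "'v \<Rightarrow> 'a::euclidean_space" and E :: "'v rel"
  assumes bij: "bij_betw e V (Basis :: 'a set)" and fin: "finite V" and "sym E" and conn: "conn E V"
  shows "gamma_vector (tube_sum e E V) = coeff (gamma_poly E V)"
proof -
  define P where "P = tube_sum e E V"
  define n where "n = card V - 1"
  have poly: "polytope P" unfolding P_def by (rule polytope_tube_sum[OF fin])
  have aff: "aff_dim P = int n"
  proof -
    let ?L = "tied (maxima E (\<lambda>i. 0 \<bullet> e i) V)"
    have "conn ?L V"
      unfolding conn_def
    proof (intro conjI ballI)
      fix i j assume "i \<in> V" "j \<in> V"
      then have "(i, j) \<in> ?L" using conn by (auto simp: tied_def maxima_def)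
      then show "(i, j) \<in> rtrancl_on V ?L" using \<open>i \<in> V\<close> \<open>j \<in> V\<close> by (rule reach_edge)
    qed (rule conn_nonempty[OF conn])
    moreover have "top_face 0 P = P" by (simp add: top_face_def)
    ultimately show ?thesis
      using aff_dim_top_face[OF bij fin, of 0 E] num_comps_conn[of ?L V] by (simp add: P_def n_def)
  qed
  let ?N = "{F. F face_of P \<and> F \<noteq> {}}"
  have finN: "finite ?N" using finite_polytope_faces[OF poly] by (rule rev_finite_subset) auto
  have "(\<Sum>i\<le>n. real (f_vector P i) * x ^ i) = facepoly E V x" for x
  proof -
    have "(\<Sum>i\<le>n. real (f_vector P i) * x ^ i) =
        (\<Sum>i\<le>n. \<Sum>F\<in>{F. F \<in> ?N \<and> nat (aff_dim F) = i}. x ^ nat (aff_dim F))"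
    proof (rule sum.cong[OF refl])
      fix i
      have "{F. F \<in> ?N \<and> nat (aff_dim F) = i} = {F. F face_of P \<and> aff_dim F = int i}"
      proof -
        have "F \<in> ?N \<and> nat (aff_dim F) = i \<longleftrightarrow> F face_of P \<and> aff_dim F = int i" for F
          using aff_dim_geq[of F] aff_dim_empty[of F] by (cases "F = {}") auto
        then show ?thesis by (simp only:)
      qed
      then show "real (f_vector P i) * x ^ i =
          (\<Sum>F\<in>{F. F \<in> ?N \<and> nat (aff_dim F) = i}. x ^ nat (aff_dim F))"
        by (simp add: f_vector_def)
    qed
    also have "\<dots> = (\<Sum>F\<in>?N. x ^ nat (aff_dim F))"
    proof (rule sum.group[OF finN])
      show "(\<lambda>F. nat (aff_dim F)) ` ?N \<subseteq> {..n}"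
        using aff_dim_subset[OF face_of_imp_subset, of _ P] aff by (auto simp: nat_le_iff)
    qed simp
    also have "\<dots> = facepoly E V x"
      unfolding P_def by (rule sum_faces_tube_sum[OF bij fin])
    finally show ?thesis .
  qed
  moreover have "gamma_expansion n (facepoly E V) (gamma_poly E V)"
    using gamma_expansion_gamma_poly[OF fin \<open>sym E\<close>] num_comps_conn[OF conn] by (simp add: n_def)
  ultimately have "gamma_expansion n (\<lambda>x. \<Sum>i\<le>n. real (f_vector P i) * x ^ i) (gamma_poly E V)" by simp
  then show ?thesis
    using gamma_vector_eq[of P n] aff by (simp add: P_def poly_dim_def)
qed

section \<open>Cycles, trees and Hamiltonian graphs\<close>

lemma graph_onI:
  assumes "pverts G = {1..m}" "parcs G \<subseteq> {1..m} \<times> {1..m}" "sym (parcs G)" "irrefl (parcs G)"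
  shows "graph_on m G"
proof -
  have "pair_graph G"
  proof
    show "finite (parcs G)" using assms(2) by (rule finite_subset) simp
    show "symmetric (with_proj G)" using assms(3) by (simp add: symmetric_def)
  qed (use assms in \<open>auto simp: irrefl_def\<close>)
  then show ?thesis using assms(1) by (simp add: graph_on_def)
qed

lemma graph_onD:
  assumes "graph_on m G"
  shows "pverts G = {1..m}" "sym (parcs G)" "irrefl (parcs G)" "parcs G \<subseteq> {1..m} \<times> {1..m}"
proof -
  interpret pair_graph G using assms by (simp add: graph_on_def)
  show V: "pverts G = {1..m}" using assms by (simp add: graph_on_def)
  show "sym (parcs G)" using pair_sym_arcs by (simp add: symmetric_def)
  show "irrefl (parcs G)" using pair_no_loops unfolding irrefl_def by fastforce
  show "parcs G \<subseteq> {1..m} \<times> {1..m}" using wellformed' V by auto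
qed

lemma connected_induced_iff:
  assumes "sym (parcs G)"
  shows "Digraph_Component.connected (with_proj G \<restriction> S) \<longleftrightarrow> conn (parcs G) S"
proof -
  have "parcs (mk_symmetric (with_proj G \<restriction> S)) = parcs G \<inter> S \<times> S"
    using symD[OF assms] by (force simp: parcs_mk_symmetric)
  then have "rtrancl_on S (parcs (mk_symmetric (with_proj G \<restriction> S))) = rtrancl_on S (parcs G)"
    by (intro reach_local) auto
  then show ?thesis
    by (simp add: Digraph_Component.connected_def strongly_connected_def conn_def reachable_def)
qed

lemma graph_connected_iff:
  assumes "graph_on m G"
  shows "graph_connected G \<longleftrightarrow> conn (parcs G) {1..m}"
proof -
  note G = graph_onD[OF assms]
  have "parcs (mk_symmetric (with_proj G)) = parcs G"
    using symD[OF G(2)] by (force simp: parcs_mk_symmetric)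
  then show ?thesis
    by (simp add: Digraph_Component.connected_def strongly_connected_def conn_def reachable_def G(1))
qed

lemma gamma_vector_graph:
  fixes e :: "nat \<Rightarrow> 'a::euclidean_space"
  assumes "graph_on m G" "conn (parcs G) {1..m}" "bij_betw e {1..m} (Basis :: 'a set)"
  shows "gamma_vector (graph_associahedron e G) = coeff (gamma_poly (parcs G) {1..m})"
proof -
  note G = graph_onD[OF assms(1)]
  have "building_set G = tubes (parcs G) {1..m}"
    using conn_nonempty by (auto simp: building_set_def tubes_def connected_induced_iff[OF G(2)] G(1))
  then have "graph_associahedron e G = tube_sum e (parcs G) {1..m}"
    by (simp add: graph_associahedron_def tube_sum_def)
  then show ?thesis using gamma_vector_tube_sum[OF assms(3) _ G(2) assms(2)] by simp
qed

lemma pcas_verts: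
  "pcas u p v \<Longrightarrow> pawalk_verts u p = u # map snd p"
  "pcas u p v \<Longrightarrow> pawalk_verts u p = map fst p @ [v]"
  by (induct p arbitrary: u) auto

lemma pcas_append_iff: "pcas u (p @ q) v \<longleftrightarrow> (\<exists>w. pcas u p w \<and> pcas w q v)"
  by (induct p arbitrary: u) auto

lemma graph_cycle_iff:
  "graph_cycle G p \<longleftrightarrow> (\<exists>u\<in>pverts G. set p \<subseteq> parcs G \<and> pcas u p u \<and> distinct (map snd p)) \<and> 3 \<le> length p"
proof -
  have "pcas u p u \<Longrightarrow> distinct (tl (pawalk_verts u p)) \<longleftrightarrow> distinct (map snd p)" for u
    by (simp add: pcas_verts(1))
  then show ?thesis
    unfolding graph_cycle_def pre_digraph.cycle_def pre_digraph.awalk_def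
      cas_with_proj_eq awalk_verts_with_proj_eq by auto
qed

lemma graph_cycle_verts:
  assumes "graph_cycle G p"
  obtains xs where "length xs = length p" "3 \<le> length xs" "distinct xs" "set xs = fst ` set p"
    "\<forall>i<length xs. (xs ! i, xs ! (Suc i mod length xs)) \<in> parcs G"
proof
  obtain u where u: "set p \<subseteq> parcs G" "pcas u p u" "distinct (map snd p)" and len: "3 \<le> length p"
    using assms by (auto simp: graph_cycle_iff)
  let ?xs = "map fst p"
  have eq: "?xs @ [u] = u # map snd p" using pcas_verts[OF u(2)] by simp
  then have "mset ?xs = mset (map snd p)" by (metis add_mset_add_single mset.simps(2) mset_append
        add_right_cancel mset_single_iff_right)
  then show "distinct ?xs" using u(3) mset_eq_imp_distinct_iff by blast
  show "3 \<le> length ?xs" using len by simp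
  show "\<forall>i<length ?xs. (?xs ! i, ?xs ! (Suc i mod length ?xs)) \<in> parcs G"
  proof (intro allI impI)
    fix i assume i: "i < length ?xs"
    have "snd (p ! i) = (?xs @ [u]) ! Suc i" using i by (simp add: eq)
    also have "\<dots> = ?xs ! (Suc i mod length ?xs)"
    proof (cases "Suc i = length ?xs")
      case True
      have "p \<noteq> []" using len by auto
      then have "u = ?xs ! 0" using arg_cong[OF eq, of "\<lambda>l. l ! 0"] by (simp add: nth_append)
      then show ?thesis using True by (simp add: nth_append)
    next
      case False
      then show ?thesis using i by (simp add: nth_append)
    qed
    finally have "p ! i = (?xs ! i, ?xs ! (Suc i mod length ?xs))"
      using i by (simp add: prod_eq_iff)
    then show "(?xs ! i, ?xs ! (Suc i mod length ?xs)) \<in> parcs G"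
      using u(1) i by (metis length_map nth_mem subsetD)
  qed
qed auto

lemma graph_cycle_two_neighbours:
  assumes "graph_cycle G p" "v \<in> fst ` set p"
  obtains a b where "a \<noteq> b" "a \<in> fst ` set p" "b \<in> fst ` set p" "(v, a) \<in> parcs G" "(b, v) \<in> parcs G"
proof -
  obtain xs where xs: "length xs = length p" "3 \<le> length xs" "distinct xs" "set xs = fst ` set p"
    "\<forall>i<length xs. (xs ! i, xs ! (Suc i mod length xs)) \<in> parcs G"
    by (rule graph_cycle_verts[OF assms(1)])
  let ?k = "length xs"
  obtain i where i: "i < ?k" "v = xs ! i" using assms(2) xs(4) by (metis in_set_conv_nth)
  define j where "j = (if i = 0 then ?k - 1 else i - 1)"
  have j: "j < ?k" "Suc j mod ?k = i" "j \<noteq> Suc i mod ?k"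
    using i xs(2) by (auto simp: j_def mod_Suc)
  have k: "Suc i mod ?k < ?k" using xs(2) by (intro mod_less_divisor) linarith
  show ?thesis
  proof (rule that)
    show "xs ! (Suc i mod ?k) \<noteq> xs ! j" using nth_eq_iff_index_eq[OF xs(3) k j(1)] j(3) by simp
    show "(v, xs ! (Suc i mod ?k)) \<in> parcs G" using xs(5) i by blast
    show "(xs ! j, v) \<in> parcs G" using xs(5) i(2) j(1,2) by metis
  qed (use xs(4) k j(1) in \<open>metis nth_mem\<close>)+
qed

text \<open>A path between two neighbours of \<open>l\<close> that avoids \<open>l\<close> closes up to a cycle through \<open>l\<close>, which has
  length at least 3 because the neighbours are distinct.\<close>

lemma acyclic_on_graph_tree:
  assumes "graph_on m G" "\<nexists>p. graph_cycle G p"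
  shows "acyclic_on (parcs G) {1..m}"
  unfolding acyclic_on_def
proof (intro ballI impI notI)
  note G = graph_onD[OF assms(1)]
  fix l a b
  assume l: "l \<in> {1..m}" and ab: "a \<in> {1..m} - {l}" "b \<in> {1..m} - {l}" "a \<noteq> b"
    and edges: "(l, a) \<in> parcs G" "(l, b) \<in> parcs G"
    and reach: "(a, b) \<in> rtrancl_on ({1..m} - {l}) (parcs G)"
  define U where "U = {1..m} - {l}"
  let ?H = "\<lparr>pverts = U, parcs = parcs G \<inter> U \<times> U\<rparr>"
  interpret H: pair_wf_digraph ?H by unfold_locales auto
  have "rtrancl_on U (parcs G \<inter> U \<times> U) = rtrancl_on U (parcs G)" by (rule reach_local) auto
  then have "reachable (with_proj ?H) a b" using reach by (simp add: reachable_def U_def)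
  then obtain p where p: "H.apath a p b" unfolding H.reachable_apath by auto
  then have p: "set p \<subseteq> parcs G \<inter> U \<times> U" "pcas a p b" "distinct (pawalk_verts a p)"
    by (auto simp: H.apath_def H.awalk_def)
  let ?c = "(l, a) # p @ [(b, l)]"
  have "p \<noteq> []" using p(2) ab(3) by auto
  moreover have "distinct (map snd ?c)"
  proof -
    have "distinct (a # map snd p)" using p(3) pcas_verts(1)[OF p(2)] by simp
    moreover have "l \<notin> set (a # map snd p)" using p(1) ab by (auto simp: U_def)
    ultimately show ?thesis by auto
  qed
  moreover have "(b, l) \<in> parcs G" using edges(2) symD[OF G(2)] by blast
  moreover have "pcas a (p @ [(b, l)]) l" unfolding pcas_append_iff using p(2) by auto
  then have "pcas l ?c l" by (simp only: pcas.simps fst_conv snd_conv simp_thms)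
  moreover have "set ?c \<subseteq> parcs G" using p(1) edges(1) calculation by auto
  moreover have "3 \<le> length ?c" using \<open>p \<noteq> []\<close> by (cases p) auto
  ultimately have "graph_cycle G ?c"
    unfolding graph_cycle_iff G(1) using l by blast
  then show False using assms(2) by blast
qed

lemma hamiltonian_if_supergraph:
  assumes "3 \<le> m" "pverts G = {1..m}" "parcs (cycle_graph m) \<subseteq> parcs G"
  shows "hamiltonian G"
proof -
  let ?q = "map (\<lambda>i. (i, Suc i)) [1..<m]" and ?p = "map (\<lambda>i. (i, Suc i)) [1..<m] @ [(m, 1)]"
  have "pcas 1 (map (\<lambda>i. (i, Suc i)) [1..<k]) k" if "1 \<le> k" for k
    using that by (induct k rule: dec_induct) (auto simp: pcas_append_iff)
  then have walk: "pcas 1 ?p 1" using assms(1) by (auto simp: pcas_append_iff)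
  have sub: "set ?p \<subseteq> parcs G" using assms by (auto simp: cycle_graph_def path_graph_def)
  have "map snd ?p = map Suc [1..<m] @ [1]" by simp
  then have dist: "distinct (map snd ?p)" by (auto simp: distinct_map inj_on_def)
  have "graph_cycle G ?p"
    unfolding graph_cycle_iff using walk sub dist assms(1,2) by (intro conjI bexI[of _ 1]) auto
  moreover have "fst ` set ?p = {1..m}" using assms(1) by (force simp: image_iff)
  ultimately show ?thesis using assms(2) unfolding hamiltonian_def by blast
qed

text \<open>Numbering the vertices along a Hamiltonian cycle embeds the cycle graph as a spanning subgraph.\<close>

lemma cycle_le_hamiltonian:
  assumes "graph_on m G" "hamiltonian G"
  shows "3 \<le> m" "conn (parcs G) {1..m}" 
    "coeff_le (gamma_poly (parcs (cycle_graph m)) {1..m}) (gamma_poly (parcs G) {1..m})"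
proof -
  note G = graph_onD[OF assms(1)]
  obtain p where p: "graph_cycle G p" "fst ` set p = {1..m}"
    using assms(2) G(1) by (auto simp: hamiltonian_def)
  obtain xs where xs: "length xs = length p" "3 \<le> length xs" "distinct xs" "set xs = fst ` set p"
    "\<forall>i<length xs. (xs ! i, xs ! (Suc i mod length xs)) \<in> parcs G"
    by (rule graph_cycle_verts[OF p(1)])
  have len: "length xs = m" using distinct_card[OF xs(3)] xs(4) p(2) by simp
  then show "3 \<le> m" using xs(2) by simp
  let ?f = "\<lambda>i. xs ! (i - 1)"
  let ?C = "parcs (cycle_graph m)"
  have inj: "inj_on ?f {1..m}"
    by (rule inj_onI) (use nth_eq_iff_index_eq[OF xs(3)] len in auto)
  have "?f ` {1..m} \<subseteq> {1..m}"
  proof clarify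
    fix i assume "i \<in> {1..m}"
    then have "xs ! (i - 1) \<in> set xs" using len by (intro nth_mem) auto
    then show "xs ! (i - 1) \<in> {1..m}" using xs(4) p(2) by simp
  qed
  then have img: "?f ` {1..m} = {1..m}"
    by (rule card_subset_eq[rotated]) (use card_image[OF inj] in \<open>simp_all del: One_nat_def\<close>)
  have edge: "(xs ! i, xs ! (Suc i mod m)) \<in> parcs G" if "i < m" for i using xs(5) that len by blast
  have hom: "(?f a, ?f b) \<in> parcs G" if ab: "a \<in> {1..m}" "b \<in> {1..m}" "(a, b) \<in> ?C" for a b
  proof -
    consider "b = Suc a" | "a = Suc b" | "a = m" "b = 1" | "a = 1" "b = m"
      using ab(3) by (auto simp: cycle_graph_def path_graph_def)
    then show ?thesis
    proof cases
      case 1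
      then show ?thesis using edge[of "a - 1"] that by auto
    next
      case 2
      then have "(?f b, ?f a) \<in> parcs G" using edge[of "b - 1"] that by auto
      then show ?thesis using symD[OF G(2)] by blast
    next
      case 3
      then show ?thesis using edge[of "m - 1"] that by auto
    next
      case 4
      then have "(?f b, ?f a) \<in> parcs G" using edge[of "m - 1"] that by auto
      then show ?thesis using symD[OF G(2)] by blast
    qed
  qed
  have connC: "conn ?C {1..m}"
    by (rule conn_mono[OF conn_interval])
      (use \<open>3 \<le> m\<close> in \<open>auto simp: cycle_graph_def path_graph_def\<close>)
  have symC: "sym ?C" by (auto simp: cycle_graph_def path_graph_def sym_def)
  note h = gamma_poly_hom[OF _ symC G(2) inj connC hom]
  show "conn (parcs G) {1..m}" using h(1) img by simp
  show "coeff_le (gamma_poly ?C {1..m}) (gamma_poly (parcs G) {1..m})" using h(2) img by simp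
qed

lemma special_graphs:
  shows "graph_on m (path_graph m)" "graph_on m (complete_graph m)" "graph_on m (star_graph m)"
    "3 \<le> m \<Longrightarrow> graph_on m (cycle_graph m)"
  by (rule graph_onI;
      force simp: path_graph_def complete_graph_def star_graph_def cycle_graph_def sym_def irrefl_def)+

lemma special_conn:
  assumes "1 \<le> m"
  shows "conn (parcs (path_graph m)) {1..m}" "conn (parcs (complete_graph m)) {1..m}"
    "conn (parcs (star_graph m)) {1..m}" "conn (parcs (cycle_graph m)) {1..m}"
proof -
  show path: "conn (parcs (path_graph m)) {1..m}"
    by (rule conn_mono[OF conn_interval[OF assms]]) (auto simp: path_graph_def)
  show "conn (parcs (complete_graph m)) {1..m}" "conn (parcs (cycle_graph m)) {1..m}"
    by (rule conn_mono[OF path]; auto simp: path_graph_def complete_graph_def cycle_graph_def)+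
  show "conn (parcs (star_graph m)) {1..m}"
    by (rule conn_mono[OF conn_star[of 1]]) (use assms in \<open>auto simp: star_graph_def\<close>)
qed

lemma special_gamma_poly:
  "gamma_poly (parcs (path_graph m)) {1..m} = gamma_poly path_rel {1..m}"
  "gamma_poly (parcs (complete_graph m)) {1..m} = gamma_poly (- Id) {1..m}"
  "gamma_poly (parcs (star_graph m)) {1..m} = gamma_poly (star_rel 1) {1..m}"
  by (rule gamma_poly_local(1); auto simp: path_graph_def complete_graph_def star_graph_def)+

text \<open>Both neighbours of the largest vertex on a cycle would be its predecessor.\<close>

lemma graph_tree_path:
  assumes "1 \<le> m" shows "graph_tree (path_graph m)"
  unfolding graph_tree_def
proof (intro conjI notI)
  show "graph_connected (path_graph m)"
    using graph_connected_iff[OF special_graphs(1)] special_conn(1)[OF assms] by simp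
  assume "\<exists>p. graph_cycle (path_graph m) p"
  then obtain p where p: "graph_cycle (path_graph m) p" by auto
  let ?X = "fst ` set p"
  have X: "finite ?X" "?X \<noteq> {}" using p by (auto simp: graph_cycle_iff)
  obtain a b where "a \<noteq> b" "a \<in> ?X" "b \<in> ?X" "(Max ?X, a) \<in> parcs (path_graph m)"
    "(b, Max ?X) \<in> parcs (path_graph m)"
    by (rule graph_cycle_two_neighbours[OF p Max_in[OF X]])
  moreover have "a \<le> Max ?X" "b \<le> Max ?X" using calculation X by auto
  ultimately show False by (auto simp: path_graph_def)
qed

text \<open>Both neighbours on a cycle of a vertex other than the centre would be the centre.\<close>

lemma graph_tree_star:
  assumes "1 \<le> m" shows "graph_tree (star_graph m)"
  unfolding graph_tree_def
proof (intro conjI notI)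
  show "graph_connected (star_graph m)"
    using graph_connected_iff[OF special_graphs(3)] special_conn(3)[OF assms] by simp
  assume "\<exists>p. graph_cycle (star_graph m) p"
  then obtain p where p: "graph_cycle (star_graph m) p" by auto
  let ?X = "fst ` set p"
  obtain v where v: "v \<in> ?X"
    using p by (cases p) (auto simp: graph_cycle_iff)
  obtain a b where ab: "a \<noteq> b" "a \<in> ?X" "b \<in> ?X" "(v, a) \<in> parcs (star_graph m)"
    by (rule graph_cycle_two_neighbours[OF p v]) blast
  obtain w where w: "w \<in> ?X" "w \<noteq> 1" using ab by metis
  obtain a b where "a \<noteq> b" "(w, a) \<in> parcs (star_graph m)" "(b, w) \<in> parcs (star_graph m)"
    by (rule graph_cycle_two_neighbours[OF p w(1)]) blast
  then show False using w(2) by (auto simp: star_graph_def)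
qed

theorem mainTheorem1:
  fixes n :: nat and e :: "nat \<Rightarrow> 'a::euclidean_space"
  assumes "n \<ge> 1"
    and "bij_betw e {1..n + 1} (Basis :: 'a set)"
  shows
    "(\<forall>G. graph_on (n + 1) G \<longrightarrow> (\<forall>i \<le> n div 2.
        (graph_connected G \<longrightarrow>
           gamma_vector (associahedron e n) i \<le> gamma_vector (graph_associahedron e G) i \<and>
           gamma_vector (graph_associahedron e G) i \<le> gamma_vector (permutohedron e n) i) \<and>
        (hamiltonian G \<longrightarrow>
           gamma_vector (cyclohedron e n) i \<le> gamma_vector (graph_associahedron e G) i \<and>
           gamma_vector (graph_associahedron e G) i \<le> gamma_vector (permutohedron e n) i) \<and>
        (graph_tree G \<longrightarrow>
           gamma_vector (associahedron e n) i \<le> gamma_vector (graph_associahedron e G) i \<and>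
           gamma_vector (graph_associahedron e G) i \<le> gamma_vector (stellohedron e n) i))) \<and>
     (\<exists>G. graph_on (n + 1) G \<and> graph_connected G \<and> (\<forall>i \<le> n div 2.
        gamma_vector (graph_associahedron e G) i = gamma_vector (associahedron e n) i)) \<and>
     (\<exists>G. graph_on (n + 1) G \<and> graph_connected G \<and> (\<forall>i \<le> n div 2.
        gamma_vector (graph_associahedron e G) i = gamma_vector (permutohedron e n) i)) \<and>
     (n \<ge> 2 \<longrightarrow>
       (\<exists>G. graph_on (n + 1) G \<and> hamiltonian G \<and> (\<forall>i \<le> n div 2.
          gamma_vector (graph_associahedron e G) i = gamma_vector (cyclohedron e n) i)) \<and>
       (\<exists>G. graph_on (n + 1) G \<and> hamiltonian G \<and> (\<forall>i \<le> n div 2.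
          gamma_vector (graph_associahedron e G) i = gamma_vector (permutohedron e n) i))) \<and>
     (\<exists>G. graph_on (n + 1) G \<and> graph_tree G \<and> (\<forall>i \<le> n div 2.
        gamma_vector (graph_associahedron e G) i = gamma_vector (associahedron e n) i)) \<and>
     (\<exists>G. graph_on (n + 1) G \<and> graph_tree G \<and> (\<forall>i \<le> n div 2.
        gamma_vector (graph_associahedron e G) i = gamma_vector (stellohedron e n) i))"
proof -
  define m where "m = n + 1"
  have m: "1 \<le> m" and bij: "bij_betw e {1..m} (Basis :: 'a set)" using assms by (auto simp: m_def)
  define \<gamma> where "\<gamma> E = coeff (gamma_poly E {1..m})" for E :: "nat rel"
  have coeff_le: "\<gamma> E i \<le> \<gamma> E' i" if "coeff_le (gamma_poly E {1..m}) (gamma_poly E' {1..m})" for E E' i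
    using that by (simp add: \<gamma>_def coeff_le_def)
  have G: "gamma_vector (graph_associahedron e G) = \<gamma> (parcs G)"
    if "graph_on m G" "conn (parcs G) {1..m}" for G
    using gamma_vector_graph[OF that bij] by (simp add: \<gamma>_def)
  have As: "gamma_vector (associahedron e n) = \<gamma> path_rel"
    and Pe: "gamma_vector (permutohedron e n) = \<gamma> (- Id)"
    and St: "gamma_vector (stellohedron e n) = \<gamma> (star_rel 1)"
    using G[OF special_graphs(1) special_conn(1)[OF m]] G[OF special_graphs(2) special_conn(2)[OF m]]
      G[OF special_graphs(3) special_conn(3)[OF m]]
    by (simp_all add: associahedron_def permutohedron_def stellohedron_def m_def[symmetric]
        \<gamma>_def special_gamma_poly del: One_nat_def)
  have Cy: "gamma_vector (cyclohedron e n) = \<gamma> (parcs (cycle_graph m))" if "3 \<le> m"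
    using G[OF special_graphs(4)[OF that] special_conn(4)[OF m]] by (simp add: cyclohedron_def m_def)
  have connected: "\<gamma> path_rel i \<le> \<gamma> (parcs G) i \<and> \<gamma> (parcs G) i \<le> \<gamma> (- Id) i"
    if "graph_on m G" "conn (parcs G) {1..m}" for G i
    using gamma_poly_path_le[OF _ graph_onD(2)[OF that(1)] that(2)]
      gamma_poly_le_complete[OF _ graph_onD(2)[OF that(1)] that(2) graph_onD(3)[OF that(1)]]
    by (auto intro!: coeff_le)
  have tree: "\<gamma> (parcs G) i \<le> \<gamma> (star_rel 1) i" if "graph_on m G" "graph_tree G" for G i
  proof -
    have "conn (parcs G) {1..m}" "acyclic_on (parcs G) {1..m}"
      using that graph_connected_iff[OF that(1)] acyclic_on_graph_tree[OF that(1)]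
      by (auto simp: graph_tree_def)
    then show ?thesis
      using gamma_poly_tree_le_star[of "{1..m}" "parcs G" 1] graph_onD[OF that(1)] m by (auto intro!: coeff_le)
  qed
  have bounds: "\<forall>G. graph_on m G \<longrightarrow> (\<forall>i \<le> n div 2.
        (graph_connected G \<longrightarrow>
           gamma_vector (associahedron e n) i \<le> gamma_vector (graph_associahedron e G) i \<and>
           gamma_vector (graph_associahedron e G) i \<le> gamma_vector (permutohedron e n) i) \<and>
        (hamiltonian G \<longrightarrow>
           gamma_vector (cyclohedron e n) i \<le> gamma_vector (graph_associahedron e G) i \<and>
           gamma_vector (graph_associahedron e G) i \<le> gamma_vector (permutohedron e n) i) \<and>
        (graph_tree G \<longrightarrow>
           gamma_vector (associahedron e n) i \<le> gamma_vector (graph_associahedron e G) i \<and>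
           gamma_vector (graph_associahedron e G) i \<le> gamma_vector (stellohedron e n) i))"
  proof (intro allI impI conjI)
    fix G i assume on: "graph_on m G"
    { assume "graph_connected G"
      then have c: "conn (parcs G) {1..m}" using graph_connected_iff[OF on] by simp
      show "gamma_vector (associahedron e n) i \<le> gamma_vector (graph_associahedron e G) i"
        "gamma_vector (graph_associahedron e G) i \<le> gamma_vector (permutohedron e n) i"
        using connected[OF on c] by (simp_all add: As Pe G[OF on c]) }
    { assume "hamiltonian G"
      note h = cycle_le_hamiltonian[OF on this]
      show "gamma_vector (cyclohedron e n) i \<le> gamma_vector (graph_associahedron e G) i"
        "gamma_vector (graph_associahedron e G) i \<le> gamma_vector (permutohedron e n) i"
        using connected[OF on h(2)] coeff_le[OF h(3)] by (simp_all add: Cy[OF h(1)] Pe G[OF on h(2)]) }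
    { assume t: "graph_tree G"
      then have c: "conn (parcs G) {1..m}"
        using graph_connected_iff[OF on] by (simp add: graph_tree_def)
      show "gamma_vector (associahedron e n) i \<le> gamma_vector (graph_associahedron e G) i"
        "gamma_vector (graph_associahedron e G) i \<le> gamma_vector (stellohedron e n) i"
        using connected[OF on c] tree[OF on t] by (simp_all add: As St G[OF on c]) }
  qed
  have path: "graph_on m (path_graph m) \<and> graph_connected (path_graph m) \<and> graph_tree (path_graph m)"
    using special_graphs(1) graph_tree_path[OF m] by (auto simp: graph_tree_def)
  have star: "graph_on m (star_graph m) \<and> graph_tree (star_graph m)"
    using special_graphs(3) graph_tree_star[OF m] by auto
  have complete: "graph_on m (complete_graph m) \<and> graph_connected (complete_graph m)"
    using special_graphs(2) graph_connected_iff[OF special_graphs(2)] special_conn(2)[OF m] by auto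
  have ham: "graph_on m (cycle_graph m) \<and> hamiltonian (cycle_graph m) \<and> hamiltonian (complete_graph m)"
    if "n \<ge> 2"
  proof -
    have "3 \<le> m" using that by (simp add: m_def)
    moreover have "hamiltonian (cycle_graph m)"
      by (rule hamiltonian_if_supergraph[OF \<open>3 \<le> m\<close>]) (auto simp: cycle_graph_def)
    moreover have "hamiltonian (complete_graph m)"
      by (rule hamiltonian_if_supergraph[OF \<open>3 \<le> m\<close>])
        (use \<open>3 \<le> m\<close> in \<open>auto simp: cycle_graph_def complete_graph_def path_graph_def\<close>)
    ultimately show ?thesis using special_graphs(4) by blast
  qed
  show ?thesis
    unfolding m_def[symmetric]
    using bounds path star complete ham
    unfolding associahedron_def cyclohedron_def permutohedron_def stellohedron_def m_def[symmetric]
    by (intro conjI impI) blast+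
qed

end
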